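(* Let $m\ge3$ be an integer. Closure and opening are inverse bijections between two sets: balanced blossom trees of total charge $m$ in which all vertex degrees are multiples of $m$, and $m$-leg maps in which all vertex degrees are multiples of $m$. Both maps preserve the degree distribution $(\lambda,\mu)$.
   Context: All maps are planar, connected, considered up to orientation-preserving homeomorphism, and bipartite: vertices are black or white and each edge joins a black and a white vertex. Maps may carry half-edges attached to single vertices and lying in the infinite face. A half-edge at a white vertex is a leaf; one at a black vertex is a bud. Maps are rooted at a half-edge. Degrees count edges and half-edges. The degree distribution is the pair of multisets of degrees of white and of black vertices. A $k$-leg map has exactly $k$ leaves and no buds, and is rooted at one of its leaves. A tree is such a map with a single face. Its charge is the number of leaves minus the number of buds, not counting the root half-edge; the total charge counts it. For an edge $e$ of a tree $T$, cutting $e$ into a leaf at its white end and a bud at its black end yields $T_e^\bullet$ (containing the black end) and $T_e^\circ$ (containing the white end), rooted at the new half-edges. The lower subtree at $e$ is the one not containing the root. A blossom tree is a tree such that, for every edge $e$: the lower subtree has charge $\ge0$ if it is $T_e^\circ$, and $\le1$ if it is $T_e^\bullet$. Closure. Let $T$ be a tree of total charge $k\ge1$. Going counterclockwise around $T$, repeatedly match a bud immediately followed (among still unmatched half-edges in the cyclic order) by a leaf. The $k$ leaves left unmatched are single. $T$ is balanced if it is rooted at a single leaf. The closure of a balanced tree fuses every matched bud–leaf pair into an edge, drawn counterclockwise around the tree without crossings, and keeps the root; it is a $k$-leg map. Opening. For a $k$-leg map, walk counterclockwise around the infinite face from the root. Each time a non-separating edge has just been traversed from its black to its white endpoint, cut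 it into a bud (black side) and a leaf (white side). Continue until a tree is obtained. *)

theory Defs
  imports
    "HOL-Library.Multiset"
    "HOL-Library.While_Combinator"
    "HOL-Combinatorics.Permutations"
    "HOL-Combinatorics.Orbits"
begin

section \<open>Rooted bipartite plane maps with half-edges\<close>

text \<open>
  Maps are encoded by their rotation systems. Each edge consists of two darts, one at each end,
  exchanged by \<open>opp\<close>; a half-edge is a single dart fixed by \<open>opp\<close>. The permutation \<open>rot\<close> sends
  a dart to the next one counterclockwise around the same vertex, so that vertices are the orbits
  of \<open>rot\<close>. The set \<open>black\<close> contains the darts attached to black vertices.
\<close>

record 'a hmap =
  darts :: "'a set"
  rot :: "'a \<Rightarrow> 'a"
  opp :: "'a \<Rightarrow> 'a"
  black :: "'a set"
  root_dart :: 'a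

definition vertices :: "'a hmap \<Rightarrow> 'a set set" where
  "vertices M = {orbit (rot M) d | d. d \<in> darts M}"

definition edges :: "'a hmap \<Rightarrow> 'a set set" where
  "edges M = {{d, opp M d} | d. d \<in> darts M \<and> opp M d \<noteq> d}"

text \<open>
  One step of the walk along the boundary of a face that is kept on the right: traverse \<open>d\<close>,
  then leave the vertex reached by the next dart counterclockwise. A half-edge is
  followed out and back. For the infinite face, having it on the right means walking
  counterclockwise around the map.
\<close>

definition next_dart :: "'a hmap \<Rightarrow> 'a \<Rightarrow> 'a" where
  "next_dart M d = rot M (opp M d)"

definition faces :: "'a hmap \<Rightarrow> 'a set set" where
  "faces M = {orbit (next_dart M) d | d. d \<in> darts M}"

definition half_edges :: "'a hmap \<Rightarrow> 'a set" where
  "half_edges M = {d \<in> darts M. opp M d = d}"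

definition leaves :: "'a hmap \<Rightarrow> 'a set" where
  "leaves M = half_edges M - black M"

definition buds :: "'a hmap \<Rightarrow> 'a set" where
  "buds M = half_edges M \<inter> black M"

definition dart_conn :: "'a hmap \<Rightarrow> ('a \<times> 'a) set" where
  "dart_conn M =
     ({(d, rot M d) | d. d \<in> darts M} \<union> {(d, opp M d) | d. d \<in> darts M})\<^sup>*"

definition connected_map :: "'a hmap \<Rightarrow> bool" where
  "connected_map M \<longleftrightarrow> (\<forall>d \<in> darts M. \<forall>d' \<in> darts M. (d, d') \<in> dart_conn M)"

text \<open>
  Planarity is Euler's formula; half-edges do not contribute to it. The infinite
  face is the face containing the root half-edge.
\<close>

definition plane_map :: "'a hmap \<Rightarrow> bool" where
  "plane_map M \<longleftrightarrow>
     finite (darts M) \<and>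
     rot M permutes darts M \<and>
     opp M permutes darts M \<and> (\<forall>d. opp M (opp M d) = d) \<and>
     black M \<subseteq> darts M \<and>
     (\<forall>d \<in> darts M. rot M d \<in> black M \<longleftrightarrow> d \<in> black M) \<and>
     (\<forall>d \<in> darts M. opp M d \<noteq> d \<longrightarrow> (opp M d \<in> black M \<longleftrightarrow> d \<notin> black M)) \<and>
     connected_map M \<and>
     card (vertices M) + card (faces M) = card (edges M) + 2 \<and>
     root_dart M \<in> half_edges M \<and>
     half_edges M \<subseteq> orbit (next_dart M) (root_dart M)"

definition leg_map :: "nat \<Rightarrow> 'a hmap \<Rightarrow> bool" where
  "leg_map k M \<longleftrightarrow>
     plane_map M \<and> card (leaves M) = k \<and> buds M = {} \<and> root_dart M \<in> leaves M"

definition plane_tree :: "'a hmap \<Rightarrow> bool" where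
  "plane_tree T \<longleftrightarrow> plane_map T \<and> card (faces T) = 1"

text \<open>
  The degree of a vertex is the number of darts attached to it. The first component collects the
  degrees of white vertices, the second one those of black vertices.
\<close>

definition degree_distribution :: "'a hmap \<Rightarrow> nat multiset \<times> nat multiset" where
  "degree_distribution M =
     (image_mset card (mset_set {v \<in> vertices M. v \<inter> black M = {}}),
      image_mset card (mset_set {v \<in> vertices M. v \<subseteq> black M}))"

definition degrees_multiple_of :: "nat \<Rightarrow> 'a hmap \<Rightarrow> bool" where
  "degrees_multiple_of m M \<longleftrightarrow> (\<forall>v \<in> vertices M. m dvd card v)"


section \<open>Isomorphism\<close>

text \<open>Orientation-preserving homeomorphisms of rooted maps.\<close>

definition map_iso :: "('a hmap \<times> 'a hmap) set" where
  "map_iso = {(M, N). plane_map M \<and> plane_map N \<and>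
     (\<exists>f. bij_betw f (darts M) (darts N) \<and>
          (\<forall>d \<in> darts M. f (rot M d) = rot N (f d) \<and>
                          f (opp M d) = opp N (f d) \<and>
                          (f d \<in> black N \<longleftrightarrow> d \<in> black M)) \<and>
          f (root_dart M) = root_dart N)}"

text \<open>
  The operation on isomorphism classes induced by an operation on labelled maps; the result is a
  class if the operation respects \<open>map_iso\<close>.
\<close>

definition lift_iso :: "('a hmap \<Rightarrow> 'a hmap) \<Rightarrow> 'a hmap set \<Rightarrow> 'a hmap set" where
  "lift_iso F X = map_iso `` (F ` X)"


section \<open>Charges and blossom trees\<close>

definition charge :: "'a hmap \<Rightarrow> int" where
  "charge T = int (card (leaves T - {root_dart T})) - int (card (buds T - {root_dart T}))"

definition total_charge :: "'a hmap \<Rightarrow> int" where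
  "total_charge T = int (card (leaves T)) - int (card (buds T))"

text \<open>Cut the edge containing the dart \<open>d\<close> into two half-edges.\<close>

definition cut_edge :: "'a hmap \<Rightarrow> 'a \<Rightarrow> 'a hmap" where
  "cut_edge M d = M\<lparr>opp := (opp M)(d := d, opp M d := opp M d)\<rparr>"

text \<open>The connected component of \<open>d\<close>, rooted at \<open>d\<close>.\<close>

definition component_at :: "'a hmap \<Rightarrow> 'a \<Rightarrow> 'a hmap" where
  "component_at M d = (let C = {d' \<in> darts M. (d, d') \<in> dart_conn M} in
     \<lparr>darts = C,
      rot = (\<lambda>x. if x \<in> C then rot M x else x),
      opp = (\<lambda>x. if x \<in> C then opp M x else x),
      black = black M \<inter> C,
      root_dart = d\<rparr>)"

text \<open>An edge is given by its black dart \<open>b\<close>; its white dart is \<open>opp T b\<close>.\<close>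

definition black_subtree :: "'a hmap \<Rightarrow> 'a \<Rightarrow> 'a hmap" where
  "black_subtree T b = component_at (cut_edge T b) b"

definition white_subtree :: "'a hmap \<Rightarrow> 'a \<Rightarrow> 'a hmap" where
  "white_subtree T b = component_at (cut_edge T b) (opp T b)"

definition blossom_tree :: "'a hmap \<Rightarrow> bool" where
  "blossom_tree T \<longleftrightarrow> plane_tree T \<and>
     (\<forall>b \<in> black T. opp T b \<noteq> b \<longrightarrow>
        (root_dart T \<notin> darts (white_subtree T b) \<longrightarrow> charge (white_subtree T b) \<ge> 0) \<and>
        (root_dart T \<notin> darts (black_subtree T b) \<longrightarrow> charge (black_subtree T b) \<le> 1))"


section \<open>Closure\<close>

text \<open>The darts met strictly after \<open>x\<close> and strictly before \<open>y\<close> on the walk from \<open>x\<close>.\<close>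

definition between :: "'a hmap \<Rightarrow> 'a \<Rightarrow> 'a \<Rightarrow> 'a set" where
  "between M x y =
     {(next_dart M ^^ i) x | i. 0 < i \<and> (\<forall>j. 0 < j \<and> j \<le> i \<longrightarrow> (next_dart M ^^ j) x \<noteq> y)}"

text \<open>
  A set \<open>P\<close> of pairs (bud, leaf) records the matches already made. A further pair can be matched if
  the leaf immediately follows the bud among the half-edges that are still unmatched.
\<close>

definition matchable :: "'a hmap \<Rightarrow> ('a \<times> 'a) set \<Rightarrow> 'a \<Rightarrow> 'a \<Rightarrow> bool" where
  "matchable T P b l \<longleftrightarrow>
     b \<in> buds T - Field P \<and> l \<in> leaves T - Field P \<and> half_edges T \<inter> between T b l \<subseteq> Field P"

inductive partial_matching :: "'a hmap \<Rightarrow> ('a \<times> 'a) set \<Rightarrow> bool" for T where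
  empty: "partial_matching T {}"
| match: "partial_matching T P \<Longrightarrow> matchable T P b l \<Longrightarrow> partial_matching T (insert (b, l) P)"

text \<open>The result of matching as long as possible; it does not depend on the choices made.\<close>

definition matching :: "'a hmap \<Rightarrow> ('a \<times> 'a) set" where
  "matching T = (THE P. partial_matching T P \<and> (\<forall>b l. \<not> matchable T P b l))"

definition single_leaves :: "'a hmap \<Rightarrow> 'a set" where
  "single_leaves T = leaves T - Field (matching T)"

definition balanced :: "'a hmap \<Rightarrow> bool" where
  "balanced T \<longleftrightarrow> plane_tree T \<and> total_charge T \<ge> 1 \<and> root_dart T \<in> single_leaves T"

text \<open>
  Fusing a bud with a leaf only changes \<open>opp\<close>: vertices, rotation and root are kept. As the pairs
  match like parentheses along the boundary, this is the crossing-free drawing.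
\<close>

definition tree_closure :: "'a hmap \<Rightarrow> 'a hmap" where
  "tree_closure T = T\<lparr>opp := (\<lambda>d.
     if d \<in> Field (matching T) then THE d'. (d, d') \<in> matching T \<or> (d', d) \<in> matching T
     else opp T d)\<rparr>"


section \<open>Opening\<close>

definition separating :: "'a hmap \<Rightarrow> 'a \<Rightarrow> bool" where
  "separating M d \<longleftrightarrow> \<not> connected_map (cut_edge M d)"

text \<open>
  The state is the current map together with the dart about to be traversed. After an edge has been
  traversed, the walk goes on from its end point, whether or not the edge has been cut; this is why
  the next dart is computed in the map before the cut.
\<close>

definition opening_step :: "'a hmap \<times> 'a \<Rightarrow> 'a hmap \<times> 'a" where
  "opening_step = (\<lambda>(M, d).
     (if d \<in> black M \<and> opp M d \<noteq> d \<and> \<not> separating M d then cut_edge M d else M,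
      next_dart M d))"

definition map_opening :: "'a hmap \<Rightarrow> 'a hmap" where
  "map_opening M = fst (while (\<lambda>(N, d). \<not> plane_tree N) opening_step (M, root_dart M))"


section \<open>The two families\<close>

text \<open>Every finite map has a copy whose darts are natural numbers.\<close>

definition blossom_family :: "nat \<Rightarrow> nat hmap set" where
  "blossom_family m =
     {T. blossom_tree T \<and> balanced T \<and> total_charge T = int m \<and> degrees_multiple_of m T}"

definition leg_family :: "nat \<Rightarrow> nat hmap set" where
  "leg_family m = {M. leg_map m M \<and> degrees_multiple_of m M}"

end

theory Submission
  imports Defs
begin

text \<open>
  In a plane map an edge separates iff both of its sides lie on the same face, by Euler's
  inequality. Cutting a nonseparating edge on the infinite face therefore merges an inner face,
  which carries no half-edges, into the infinite face. Hence the pairs cut by the opening are matched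
  again by the closure, and closing the opening of a map gives back the map.

  Conversely, let \<open>T\<close> be a balanced tree, and number its darts along the contour from the root. The
  matched pairs form a parenthesis system, and the walk on the closure of \<open>T\<close> cuts in its
  \<open>r\<close>-th round around the infinite face exactly the pairs of nesting depth \<open>r\<close>, as long as it cuts
  no edge of \<open>T\<close>. Whether an edge of \<open>T\<close> survives is decided when it is first traversed from black
  to white: by then all the pairs joining its two sides must have been cut. Let \<open>I\<close> (resp. \<open>O\<close>) be
  the number of pairs with only their leaf (resp. bud) in the lower subtree. The edge survives iff
  \<open>O \<le> I\<close> if the lower subtree contains its white end, and iff \<open>I \<le> O + 1\<close> otherwise. The charge of
  the lower subtree is \<open>I - O + S\<close>, where the number \<open>S\<close> of single leaves in it is less than \<open>m\<close>. As
  this charge is \<open>- 1\<close> resp. \<open>1\<close> modulo \<open>m\<close>, the condition is equivalent to the one defining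
  blossom trees.
\<close>

section \<open>Orbits of permutations\<close>

text \<open>The obstacle is that the opening, run on a closure, may also cut an edge of the tree,
  after which its state is no longer described by a set of fused pairs. Since a cut is never undone,
  such a run can be given up at once: its result differs from the tree. This yields an equivalence:
  opening the closure of \<open>T\<close> gives back \<open>T\<close> iff all edges of
  \<open>T\<close> survive. It is used in both directions. For a blossom tree it gives the inverse
  law. For a leg map \<open>M\<close>, the tree opened from \<open>M\<close> closes to
  \<open>M\<close>, so opening this closure returns the same tree, and the tree is a blossom tree
  without any direct analysis of the cuts. The link between the rounds of the walk and the charges
  is that \<open>I - O\<close> is a difference of nesting depths at the two darts of the edge. The
  tolerance 1 in the second condition is an effect of timing: the second dart of an edge is reached
  after the buds below the edge have been passed in the same round.\<close>

lemma permutation_orbit_eq: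
  assumes "permutation f" "y \<in> orbit f x"
  shows "orbit f y = orbit f x"
  using cyclic_on_orbit'[OF assms(1)] assms(2) by (rule orbit_cyclic_eq3)

lemma orbit_closed:
  assumes "y \<in> orbit f x" "f x \<in> X" "\<And>z. z \<in> X \<Longrightarrow> f z \<in> X"
  shows "y \<in> X"
  using assms by induct auto

lemma permutation_fun_swap:
  assumes "permutation f"
  shows "permutation (f(a := f b, b := f a))"
proof -
  have "f(a := f b, b := f a) = f \<circ> transpose a b"
    by (auto simp: transpose_def)
  then show ?thesis
    using assms by (simp add: permutation_compose permutation_swap_id)
qed

text \<open>Under \<open>g\<close> the point \<open>a\<close> is followed by the old successor of
  \<open>b\<close>; the orbit of \<open>b\<close> is then run through up to \<open>b\<close> itself,
  whence \<open>g\<close> returns to the old successor of \<open>a\<close>.\<close>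

lemma orbit_fun_swap_merge:
  assumes "permutation f" "b \<notin> orbit f a"
  defines "g \<equiv> f(a := f b, b := f a)"
  shows "orbit g a = orbit f a \<union> orbit f b"
proof
  have ab: "orbit f a \<inter> orbit f b = {}"
    using assms permutation_orbit_eq permutation_self_in_orbit by (metis disjoint_iff)
  have self: "a \<in> orbit f a" "b \<in> orbit f b"
    using permutation_self_in_orbit[OF assms(1)] by auto
  show "orbit g a \<subseteq> orbit f a \<union> orbit f b"
  proof
    fix y assume "y \<in> orbit g a"
    then show "y \<in> orbit f a \<union> orbit f b"
      by (rule orbit_closed) (auto simp: g_def intro: orbit.intros)
  qed
  have B: "y \<in> orbit g a" if "y \<in> orbit f b" for y
    using that
  proof induct
    case base
    have "g a = f b" using self ab by (auto simp: g_def)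
    then show ?case by (metis orbit.base)
  next
    case (step y)
    show ?case
    proof (cases "y = b")
      case True
      have "g a = f b" using self ab by (auto simp: g_def)
      then show ?thesis using True by (metis orbit.base)
    next
      case False
      then have "g y = f y" using step(1) self ab by (auto simp: g_def)
      then show ?thesis using step(2) by (metis orbit.step)
    qed
  qed
  have "b \<in> orbit g a" using B self by auto
  then have "g b \<in> orbit g a" by (rule orbit.step)
  then have fa: "f a \<in> orbit g a" by (simp add: g_def)
  have A: "y \<in> orbit g a" if "y \<in> orbit f a" for y
    using that
  proof induct
    case base
    show ?case by (rule fa)
  next
    case (step y)
    show ?case
    proof (cases "y = a")
      case True
      then show ?thesis using fa by simp
    next
      case False
      then have "g y = f y" using step(1) self ab by (auto simp: g_def)
      then show ?thesis using step(2) by (metis orbit.step)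
    qed
  qed
  show "orbit f a \<union> orbit f b \<subseteq> orbit g a" using A B by auto
qed

lemma orbit_fun_swap_other:
  assumes "permutation f" "a \<notin> orbit f x" "b \<notin> orbit f x"
  shows "orbit (f(a := f b, b := f a)) x = orbit f x"
  using permutation_self_in_orbit[OF assms(1)] by (rule orbit_cong) (use assms in auto)

text \<open>The iterates of \<open>f\<close> after \<open>b\<close>, up to the first arrival at
  \<open>a\<close>, form a set closed under the modified map, because \<open>a\<close> is now sent
  back to \<open>f b\<close>. This set contains the new orbit of \<open>a\<close> and misses
  \<open>b\<close>.\<close>

lemma orbit_fun_swap_split:
  assumes "permutation f" "b \<in> orbit f a" "a \<noteq> b"
  shows "b \<notin> orbit (f(a := f b, b := f a)) a"
proof -
  let ?g = "f(a := f b, b := f a)"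
  have "a \<in> orbit f b"
    using assms permutation_orbit_eq permutation_self_in_orbit by metis
  define k where "k = funpow_dist1 f b a"
  have k: "(f ^^ k) b = a" "0 < k" using funpow_dist1_prop[OF \<open>a \<in> orbit f b\<close>] by (auto simp: k_def)
  have k1: "(f ^^ i) b \<noteq> a" if "0 < i" "i < k" for i
    using funpow_dist1_least that by (metis k_def)
  \<comment> \<open>An earlier return to \<open>b\<close> would shorten the way to \<open>a\<close>,
    against the choice of \<open>k\<close>.\<close>
  have k2: "(f ^^ i) b \<noteq> b" if "0 < i" "i < k" for i
  proof
    assume "(f ^^ i) b = b"
    then have "(f ^^ (k - i)) b = (f ^^ (k - i)) ((f ^^ i) b)" by simp
    also have "\<dots> = (f ^^ (k - i + i)) b" by (simp add: funpow_add)
    also have "\<dots> = a" using that k by simp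
    finally show False using k1[of "k - i"] that by auto
  qed
  define X where "X = {(f ^^ i) b | i. 0 < i \<and> i \<le> k}"
  have fb: "f b \<in> X" using k(2) by (auto simp: X_def intro!: exI[of _ 1])
  have bX: "b \<notin> X"
  proof
    assume "b \<in> X"
    then obtain i where "0 < i" "i \<le> k" "(f ^^ i) b = b" by (auto simp: X_def)
    then show False using k2[of i] k assms(3) by (cases "i = k") auto
  qed
  have "y \<in> X" if "y \<in> orbit ?g a" for y
    using that
  proof (rule orbit_closed)
    show "?g a \<in> X" using fb assms(3) by simp
    fix z assume "z \<in> X"
    then obtain i where i: "0 < i" "i \<le> k" "z = (f ^^ i) b" by (auto simp: X_def)
    show "?g z \<in> X"
    proof (cases "i = k")
      case True
      then show ?thesis using i k fb assms(3) by simp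
    next
      case False
      then have "z \<noteq> a" "z \<noteq> b" using k1 k2 i by auto
      then have "?g z = (f ^^ Suc i) b" using i by simp
      then show ?thesis using False i unfolding X_def by (intro CollectI exI[of _ "Suc i"]) auto
    qed
  qed
  then show ?thesis using bX by auto
qed

text \<open>The orbits of \<open>a\<close> and \<open>b\<close> are replaced by their union, and all
  other orbits are untouched.\<close>

lemma card_orbits_fun_swap:
  assumes "permutation f" "finite S" "a \<in> S" "b \<in> S" "b \<notin> orbit f a"
  shows "card {orbit f d | d. d \<in> S} = Suc (card {orbit (f(a := f b, b := f a)) d | d. d \<in> S})"
proof -
  let ?g = "f(a := f b, b := f a)"
  let ?F = "{orbit f d | d. d \<in> S}" and ?G = "{orbit ?g d | d. d \<in> S}"
  let ?A = "orbit f a" and ?B = "orbit f b"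
  note self = permutation_self_in_orbit[OF assms(1)]
  note eq = permutation_orbit_eq[OF assms(1)]
  have pg: "permutation ?g" by (rule permutation_fun_swap[OF assms(1)])
  have m: "orbit ?g a = ?A \<union> ?B" by (rule orbit_fun_swap_merge[OF assms(1,5)])
  have AB: "?A \<noteq> ?B" using assms(5) self by auto
  have x: "orbit ?g d = (if d \<in> ?A \<union> ?B then ?A \<union> ?B else orbit f d)" for d
  proof (cases "d \<in> ?A \<union> ?B")
    case True
    then show ?thesis using permutation_orbit_eq[OF pg, of d a] m by auto
  next
    case False
    then have "a \<notin> orbit f d" "b \<notin> orbit f d" using eq self by auto
    then show ?thesis using False orbit_fun_swap_other[OF assms(1)] by auto
  qed
  have "?G = insert (?A \<union> ?B) (?F - {?A, ?B})"
  proof (intro equalityI subsetI)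
    fix X assume "X \<in> ?G"
    then obtain d where d: "d \<in> S" "X = orbit ?g d" by auto
    show "X \<in> insert (?A \<union> ?B) (?F - {?A, ?B})"
      using d x[of d] self[of d] by (auto split: if_splits)
  next
    fix X assume "X \<in> insert (?A \<union> ?B) (?F - {?A, ?B})"
    then consider "X = ?A \<union> ?B" | d where "d \<in> S" "X = orbit f d" "X \<noteq> ?A" "X \<noteq> ?B" by auto
    then show "X \<in> ?G"
    proof cases
      case 1
      then show ?thesis using m assms(3) by auto
    next
      case 2
      then have "d \<notin> ?A \<union> ?B" using eq by auto
      then show ?thesis using 2 x[of d] by auto
    qed
  qed
  moreover have "?A \<union> ?B \<notin> ?F - {?A, ?B}"
  proof
    assume "?A \<union> ?B \<in> ?F - {?A, ?B}"
    then obtain d where "?A \<union> ?B = orbit f d" "?A \<union> ?B \<noteq> ?A" by auto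
    then show False using self eq by (metis UnI1)
  qed
  moreover have fin: "finite ?F" using assms(2) by auto
  moreover have "?A \<in> ?F" "?B \<in> ?F" using assms by auto
  moreover have "card {?A, ?B} = 2" using AB by auto
  moreover have "card {?A, ?B} \<le> card ?F" using fin \<open>?A \<in> ?F\<close> \<open>?B \<in> ?F\<close> by (intro card_mono) auto
  ultimately show ?thesis
    using card_Diff_subset[of "{?A, ?B}" ?F] by auto
qed

section \<open>Rotation systems and cutting edges\<close>

text \<open>The axioms of a plane map that survive cutting an arbitrary edge. Connectedness, Euler's
  formula and the condition on the infinite face may fail after a cut, so inductions over edges run
  on this weaker notion.\<close>

definition premap :: "'a hmap \<Rightarrow> bool" where
  "premap M \<longleftrightarrow>
     finite (darts M) \<and> rot M permutes darts M \<and>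
     opp M permutes darts M \<and> (\<forall>d. opp M (opp M d) = d) \<and>
     black M \<subseteq> darts M \<and>
     (\<forall>d \<in> darts M. rot M d \<in> black M \<longleftrightarrow> d \<in> black M) \<and>
     (\<forall>d \<in> darts M. opp M d \<noteq> d \<longrightarrow> (opp M d \<in> black M \<longleftrightarrow> d \<notin> black M))"

lemma plane_map_iff:
  "plane_map M \<longleftrightarrow> premap M \<and> connected_map M \<and>
     card (vertices M) + card (faces M) = card (edges M) + 2 \<and>
     root_dart M \<in> half_edges M \<and> half_edges M \<subseteq> orbit (next_dart M) (root_dart M)"
  unfolding plane_map_def premap_def by blast

lemma plane_map_premap: "plane_map M \<Longrightarrow> premap M"
  by (simp add: plane_map_iff)

lemma premapD:
  assumes "premap M"
  shows "finite (darts M)" "rot M permutes darts M" "opp M permutes darts M"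
    "opp M (opp M d) = d" "black M \<subseteq> darts M"
    "permutation (rot M)" "permutation (opp M)"
    "next_dart M permutes darts M" "permutation (next_dart M)"
proof -
  show *: "finite (darts M)" "rot M permutes darts M" "opp M permutes darts M"
    "opp M (opp M d) = d" "black M \<subseteq> darts M"
    using assms by (auto simp: premap_def)
  have "next_dart M = rot M \<circ> opp M" by (auto simp: next_dart_def)
  then show n: "next_dart M permutes darts M" using * permutes_compose by metis
  show "permutation (rot M)" "permutation (opp M)" "permutation (next_dart M)"
    using * n by (auto simp: permutation_permutes)
qed

lemma opp_in_darts: "premap M \<Longrightarrow> opp M d \<in> darts M \<longleftrightarrow> d \<in> darts M"
  by (simp add: permutes_in_image premapD(3))

lemma rot_in_darts: "premap M \<Longrightarrow> rot M d \<in> darts M \<longleftrightarrow> d \<in> darts M"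
  by (simp add: permutes_in_image premapD(2))

lemma next_in_darts: "premap M \<Longrightarrow> next_dart M d \<in> darts M \<longleftrightarrow> d \<in> darts M"
  by (simp add: permutes_in_image premapD(8))

lemma opp_outside: "premap M \<Longrightarrow> opp M d \<noteq> d \<Longrightarrow> d \<in> darts M"
  using permutes_not_in premapD(3) by metis

lemma opp_black:
  "premap M \<Longrightarrow> opp M d \<noteq> d \<Longrightarrow> opp M d \<in> black M \<longleftrightarrow> d \<notin> black M"
  using opp_outside[of M d] by (auto simp: premap_def)

lemma rot_black: "premap M \<Longrightarrow> d \<in> darts M \<Longrightarrow> rot M d \<in> black M \<longleftrightarrow> d \<in> black M"
  by (auto simp: premap_def)

lemma orbit_next_subset: "premap M \<Longrightarrow> d \<in> darts M \<Longrightarrow> orbit (next_dart M) d \<subseteq> darts M"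
  by (rule permutes_orbit_subset[OF premapD(8)])

lemma dart_conn_closed:
  assumes "(x, y) \<in> dart_conn M" "x \<in> X"
    "\<And>z. z \<in> X \<Longrightarrow> z \<in> darts M \<Longrightarrow> rot M z \<in> X"
    "\<And>z. z \<in> X \<Longrightarrow> z \<in> darts M \<Longrightarrow> opp M z \<in> X"
  shows "y \<in> X"
  using assms(1)[unfolded dart_conn_def]
  by (induct rule: rtrancl_induct) (use assms in auto)

lemma dart_conn_refl [simp]: "(x, x) \<in> dart_conn M"
  by (simp add: dart_conn_def)

lemma dart_conn_trans: "(x, y) \<in> dart_conn M \<Longrightarrow> (y, z) \<in> dart_conn M \<Longrightarrow> (x, z) \<in> dart_conn M"
  unfolding dart_conn_def by (rule rtrancl_trans)

lemma dart_conn_rot: "(x, y) \<in> dart_conn M \<Longrightarrow> y \<in> darts M \<Longrightarrow> (x, rot M y) \<in> dart_conn M"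
  unfolding dart_conn_def by (rule rtrancl_into_rtrancl) auto

lemma dart_conn_opp: "(x, y) \<in> dart_conn M \<Longrightarrow> y \<in> darts M \<Longrightarrow> (x, opp M y) \<in> dart_conn M"
  unfolding dart_conn_def by (rule rtrancl_into_rtrancl) auto

text \<open>The relation is generated by forward steps only. A step along \<open>rot\<close> is
  undone by going on around the vertex, since the orbits of \<open>rot\<close> are cycles; a step
  along \<open>opp\<close> undoes itself.\<close>

lemma dart_conn_sym:
  assumes "premap M" "(x, y) \<in> dart_conn M"
  shows "(y, x) \<in> dart_conn M"
proof -
  have "y \<in> {y. (y, x) \<in> dart_conn M}" using assms(2)
  proof (rule dart_conn_closed)
    fix z assume z: "z \<in> {y. (y, x) \<in> dart_conn M}" "z \<in> darts M"
    have "z \<in> orbit (rot M) (rot M z)"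
      using permutation_self_in_orbit permutation_orbit_step premapD(6)[OF assms(1)] by metis
    then have "z \<in> {y. (rot M z, y) \<in> dart_conn M \<and> y \<in> darts M}"
      by (rule orbit_closed)
        (use z in \<open>auto intro: dart_conn_rot simp: rot_in_darts[OF assms(1)]\<close>)
    then show "rot M z \<in> {y. (y, x) \<in> dart_conn M}" using z dart_conn_trans by auto
    have "(opp M z, opp M (opp M z)) \<in> dart_conn M"
      using dart_conn_opp[OF dart_conn_refl] z assms(1) opp_in_darts by metis
    then show "opp M z \<in> {y. (y, x) \<in> dart_conn M}"
      using z premapD(4)[OF assms(1)] dart_conn_trans by auto
  qed auto
  then show ?thesis by auto
qed

lemma orbit_next_conn:
  assumes "premap M" "d \<in> darts M" "d' \<in> orbit (next_dart M) d"
  shows "(d, d') \<in> dart_conn M"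
proof -
  have "d' \<in> {y. (d, y) \<in> dart_conn M \<and> y \<in> darts M}"
    using assms(3) by (rule orbit_closed)
      (use assms in \<open>auto simp: next_dart_def rot_in_darts opp_in_darts intro!: dart_conn_rot dart_conn_opp\<close>)
  then show ?thesis by auto
qed

context
  fixes M :: "'a hmap" and b w :: 'a
  assumes M: "premap M" and w: "opp M b = w" and ne: "w \<noteq> b"
begin

private lemma bw: "b \<in> darts M" "w \<in> darts M" "opp M w = b"
  using opp_outside[OF M, of b] opp_in_darts[OF M, of b] premapD(4)[OF M, of b] w ne by auto

lemma cut_edge_simps:
  "darts (cut_edge M b) = darts M" "rot (cut_edge M b) = rot M" "black (cut_edge M b) = black M"
  "root_dart (cut_edge M b) = root_dart M" "vertices (cut_edge M b) = vertices M"
  "opp (cut_edge M b) = (opp M)(b := b, w := w)"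
  using w by (auto simp: cut_edge_def vertices_def)

lemma premap_cut_edge: "premap (cut_edge M b)"
proof -
  have "opp (cut_edge M b) = opp M \<circ> transpose b w"
    using w ne bw by (auto simp: cut_edge_def transpose_def)
  then have "opp (cut_edge M b) permutes darts M"
    using permutes_compose[OF permutes_swap_id premapD(3)[OF M]] bw by metis
  moreover have "opp (cut_edge M b) (opp (cut_edge M b) d) = d" for d
    using premapD(4)[OF M] w bw ne by (metis cut_edge_simps(6) fun_upd_apply)
  ultimately show ?thesis
    using M unfolding premap_def cut_edge_simps(1,2,3) using cut_edge_simps(6) by auto
qed

text \<open>Once \<open>opp\<close> fixes both darts, \<open>b\<close> is followed by
  \<open>rot M b\<close>, the old successor of \<open>w\<close>, and vice versa. A cut thus has the
  form \<open>f(a := f b, b := f a)\<close>, and the orbit lemmas tell what it does to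
  faces.\<close>

lemma next_dart_cut_edge:
  "next_dart (cut_edge M b) = (next_dart M)(b := next_dart M w, w := next_dart M b)"
  by (rule ext) (use bw(3) w ne in \<open>simp add: next_dart_def cut_edge_simps\<close>)

lemma edges_cut_edge: "edges M = insert {b, w} (edges (cut_edge M b))" "{b, w} \<notin> edges (cut_edge M b)"
proof -
  have inj: "opp M d = opp M d' \<longleftrightarrow> d = d'" for d d' using premapD(4)[OF M] by metis
  show "{b, w} \<notin> edges (cut_edge M b)"
    by (auto simp: edges_def cut_edge_simps doubleton_eq_iff split: if_splits)
  show "edges M = insert {b, w} (edges (cut_edge M b))"
  proof (intro equalityI subsetI)
    fix e assume "e \<in> edges M"
    then obtain d where d: "d \<in> darts M" "opp M d \<noteq> d" "e = {d, opp M d}" by (auto simp: edges_def)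
    show "e \<in> insert {b, w} (edges (cut_edge M b))"
    proof (cases "d = b \<or> d = w")
      case True
      then show ?thesis using d bw w by auto
    next
      case False
      then have "e = {d, opp (cut_edge M b) d}" "opp (cut_edge M b) d \<noteq> d"
        using d by (auto simp: cut_edge_simps)
      then show ?thesis using d by (auto simp: edges_def cut_edge_simps(1))
    qed
  next
    fix e assume "e \<in> insert {b, w} (edges (cut_edge M b))"
    then consider "e = {b, w}" | d where "d \<in> darts M" "opp (cut_edge M b) d \<noteq> d"
        "e = {d, opp (cut_edge M b) d}"
      by (auto simp: edges_def cut_edge_simps(1))
    then show "e \<in> edges M"
    proof cases
      case 1
      then show ?thesis using bw(1) w ne unfolding edges_def by blast
    next
      case 2
      then have "opp (cut_edge M b) d = opp M d" by (auto simp: cut_edge_simps split: if_splits)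
      then show ?thesis using 2 unfolding edges_def by auto
    qed
  qed
qed

lemma finite_edges: "finite (edges M)"
  unfolding edges_def using premapD(1)[OF M] by auto

lemma card_edges_cut_edge: "card (edges M) = Suc (card (edges (cut_edge M b)))"
  using edges_cut_edge finite_edges by (metis card_insert_disjoint finite_insert)

lemma half_edges_cut_edge: "half_edges (cut_edge M b) = half_edges M \<union> {b, w}"
  using bw by (auto simp: half_edges_def cut_edge_simps)

lemma cut_edge_conn:
  assumes "(x, y) \<in> dart_conn (cut_edge M b)" shows "(x, y) \<in> dart_conn M"
proof -
  have "y \<in> {y. (x, y) \<in> dart_conn M}" using assms
    by (rule dart_conn_closed)
      (auto simp: cut_edge_simps intro: dart_conn_opp dart_conn_rot)
  then show ?thesis by simp
qed

lemma conn_cut_edge: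
  assumes "(b, x) \<in> dart_conn M"
  shows "(b, x) \<in> dart_conn (cut_edge M b) \<or> (w, x) \<in> dart_conn (cut_edge M b)"
proof -
  have "x \<in> {x. (b, x) \<in> dart_conn (cut_edge M b) \<or> (w, x) \<in> dart_conn (cut_edge M b)}"
    using assms
  proof (rule dart_conn_closed)
    fix z assume z: "z \<in> {x. (b, x) \<in> dart_conn (cut_edge M b) \<or> (w, x) \<in> dart_conn (cut_edge M b)}"
      "z \<in> darts M"
    show "rot M z \<in> {x. (b, x) \<in> dart_conn (cut_edge M b) \<or> (w, x) \<in> dart_conn (cut_edge M b)}"
      using z dart_conn_rot[of _ z "cut_edge M b"] cut_edge_simps by auto
    show "opp M z \<in> {x. (b, x) \<in> dart_conn (cut_edge M b) \<or> (w, x) \<in> dart_conn (cut_edge M b)}"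
    proof (cases "z = b \<or> z = w")
      case True
      then show ?thesis using w bw by auto
    next
      case False
      then have "opp (cut_edge M b) z = opp M z" by (simp add: cut_edge_simps)
      then show ?thesis using z dart_conn_opp[of _ z "cut_edge M b"] cut_edge_simps(1) by auto
    qed
  qed auto
  then show ?thesis by auto
qed

lemma conn_cut_edge_other:
  assumes "(x, y) \<in> dart_conn M" "(x, b) \<notin> dart_conn M"
  shows "(x, y) \<in> dart_conn (cut_edge M b)"
proof -
  have "y \<in> {y. (x, y) \<in> dart_conn M \<and> (x, y) \<in> dart_conn (cut_edge M b)}" using assms(1)
  proof (rule dart_conn_closed)
    fix z assume z: "z \<in> {y. (x, y) \<in> dart_conn M \<and> (x, y) \<in> dart_conn (cut_edge M b)}" "z \<in> darts M"
    show "rot M z \<in> {y. (x, y) \<in> dart_conn M \<and> (x, y) \<in> dart_conn (cut_edge M b)}"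
      using z dart_conn_rot[of x z "cut_edge M b"] cut_edge_simps by (auto intro: dart_conn_rot)
    have "z \<noteq> b" "z \<noteq> w"
      using z assms(2) dart_conn_opp[of x w M] bw by auto
    then have "opp (cut_edge M b) z = opp M z" by (simp add: cut_edge_simps)
    then show "opp M z \<in> {y. (x, y) \<in> dart_conn M \<and> (x, y) \<in> dart_conn (cut_edge M b)}"
      using z dart_conn_opp[of x z "cut_edge M b"] cut_edge_simps(1) by (auto intro: dart_conn_opp)
  qed auto
  then show ?thesis by simp
qed

text \<open>If the two ends stay connected, every passage through the cut edge can be replaced by a
  detour.\<close>

lemma cut_edge_conn_eq:
  assumes "(b, w) \<in> dart_conn (cut_edge M b)" "(x, y) \<in> dart_conn M"
  shows "(x, y) \<in> dart_conn (cut_edge M b)"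
proof (cases "(x, b) \<in> dart_conn M")
  case True
  have c: "(b, z) \<in> dart_conn (cut_edge M b)" if "(b, z) \<in> dart_conn M" for z
    using conn_cut_edge[OF that] assms(1) dart_conn_trans by metis
  have "(b, x) \<in> dart_conn M" "(b, y) \<in> dart_conn M"
    using True assms(2) dart_conn_sym[OF M] dart_conn_trans by metis+
  then show ?thesis using c dart_conn_sym[OF premap_cut_edge] dart_conn_trans by metis
qed (use conn_cut_edge_other assms in auto)

lemma card_faces_cut_edge_merge:
  assumes "w \<notin> orbit (next_dart M) b"
  shows "card (faces M) = Suc (card (faces (cut_edge M b)))"
  using card_orbits_fun_swap[OF premapD(9)[OF M] premapD(1)[OF M] bw(1,2) assms]
  unfolding faces_def next_dart_cut_edge cut_edge_simps(1) .

text \<open>Exchanging the two successors a second time restores \<open>next_dart M\<close>, so the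
  count for a merge applies with the two maps in opposite roles.\<close>

lemma card_faces_cut_edge_split:
  assumes "w \<in> orbit (next_dart M) b"
  shows "card (faces (cut_edge M b)) = Suc (card (faces M))"
proof -
  let ?f = "next_dart M" and ?g = "next_dart (cut_edge M b)"
  have "w \<notin> orbit ?g b"
    using orbit_fun_swap_split[OF premapD(9)[OF M] assms] ne unfolding next_dart_cut_edge by auto
  moreover have "?g(b := ?g w, w := ?g b) = ?f"
    using ne by (auto simp: next_dart_cut_edge)
  ultimately show ?thesis
    using card_orbits_fun_swap[OF premapD(9)[OF premap_cut_edge] premapD(1)[OF M] bw(1,2)]
    unfolding faces_def cut_edge_simps(1) by metis
qed

end

section \<open>Euler's inequality\<close>

definition dart_comp :: "'a hmap \<Rightarrow> 'a \<Rightarrow> 'a set" where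
  "dart_comp M d = {d' \<in> darts M. (d, d') \<in> dart_conn M}"

definition components :: "'a hmap \<Rightarrow> 'a set set" where
  "components M = dart_comp M ` darts M"

lemma dart_comp_eq:
  assumes "premap M" "(x, y) \<in> dart_conn M"
  shows "dart_comp M x = dart_comp M y"
  using assms dart_conn_sym[OF assms] unfolding dart_comp_def by (blast intro: dart_conn_trans)

text \<open>Only the component of \<open>b\<close> can break, and each of its darts remains
  connected to \<open>b\<close> or to \<open>w\<close>.\<close>

lemma card_components_cut_edge:
  assumes M: "premap M" and w: "opp M b = w" "w \<noteq> b"
  shows "card (components (cut_edge M b)) \<le> Suc (card (components M))"
proof -
  let ?N = "cut_edge M b"
  note cs = cut_edge_simps[OF M w]
  have bM: "b \<in> darts M" using opp_outside[OF M] w by auto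
  have "components ?N \<subseteq> (components M - {dart_comp M b}) \<union> {dart_comp ?N b, dart_comp ?N w}"
  proof
    fix X assume "X \<in> components ?N"
    then obtain x where x: "x \<in> darts M" "X = dart_comp ?N x" by (auto simp: components_def cs)
    show "X \<in> (components M - {dart_comp M b}) \<union> {dart_comp ?N b, dart_comp ?N w}"
    proof (cases "(b, x) \<in> dart_conn M")
      case True
      from conn_cut_edge[OF M w this] show ?thesis
        using x dart_comp_eq[OF premap_cut_edge[OF M w]] by auto
    next
      case False
      then have nb: "(x, b) \<notin> dart_conn M" using dart_conn_sym[OF M] by blast
      then have "X = dart_comp M x"
        using x cut_edge_conn[OF M w] conn_cut_edge_other[OF M w _ nb]
        by (auto simp: dart_comp_def cs)
      moreover have "dart_comp M x \<noteq> dart_comp M b"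
      proof
        assume "dart_comp M x = dart_comp M b"
        moreover have "b \<in> dart_comp M b" using bM by (simp add: dart_comp_def)
        ultimately have "b \<in> dart_comp M x" by simp
        then show False using nb by (simp add: dart_comp_def)
      qed
      ultimately show ?thesis using x by (auto simp: components_def)
    qed
  qed
  moreover have fin: "finite (components M)" by (simp add: components_def premapD(1)[OF M])
  ultimately have "card (components ?N) \<le> card ((components M - {dart_comp M b}) \<union> {dart_comp ?N b, dart_comp ?N w})"
    by (intro card_mono) auto
  also have "\<dots> \<le> card (components M - {dart_comp M b}) + card {dart_comp ?N b, dart_comp ?N w}"
    by (rule card_Un_le)
  also have "\<dots> \<le> (card (components M) - 1) + 2"
    using fin bM by (intro add_mono) (auto simp: components_def card_insert_if)
  also have "\<dots> = Suc (card (components M))"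
    using fin bM card_gt_0_iff[of "components M"] by (auto simp: components_def)
  finally show ?thesis .
qed

text \<open>Edges are removed one at a time. A cut that creates a face creates at most one
  component, worth 2 on the right; a cut that merges faces creates none. Without edges
  \<open>next_dart\<close> is \<open>rot\<close>, so vertices, faces and components coincide, which
  accounts for the factor 2.\<close>

lemma euler_inequality:
  "premap M \<Longrightarrow> card (vertices M) + card (faces M) \<le> card (edges M) + 2 * card (components M)"
proof (induction "card (edges M)" arbitrary: M rule: less_induct)
  case less
  note M = less.prems
  show ?case
  proof (cases "\<exists>b. opp M b \<noteq> b")
    case True
    then obtain b w where w: "opp M b = w" "w \<noteq> b" by auto
    let ?N = "cut_edge M b"
    note e = card_edges_cut_edge[OF M w] and c = card_components_cut_edge[OF M w]
    have IH: "card (vertices M) + card (faces ?N) \<le> card (edges ?N) + 2 * card (components ?N)"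
      using less.hyps[OF _ premap_cut_edge[OF M w]] e cut_edge_simps(5)[OF M w] by simp
    show ?thesis
    proof (cases "w \<in> orbit (next_dart M) b")
      case True
      then show ?thesis using IH e c card_faces_cut_edge_split[OF M w True] by auto
    next
      case False
      \<comment> \<open>The merged face contains both ends, so they stay connected and no component
        is added.\<close>
      have "orbit (next_dart ?N) b = orbit (next_dart M) b \<union> orbit (next_dart M) w"
        unfolding next_dart_cut_edge[OF M w]
        by (rule orbit_fun_swap_merge[OF premapD(9)[OF M] False])
      then have "w \<in> orbit (next_dart ?N) b"
        using permutation_self_in_orbit[OF premapD(9)[OF M]] by auto
      then have "(b, w) \<in> dart_conn ?N"
        using orbit_next_conn[OF premap_cut_edge[OF M w]] opp_outside[OF M] w
        by (simp add: cut_edge_simps[OF M w])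
      then have "(x, y) \<in> dart_conn ?N \<longleftrightarrow> (x, y) \<in> dart_conn M" for x y
        using cut_edge_conn_eq[OF M w] cut_edge_conn[OF M w] by blast
      then have "components ?N = components M"
        by (auto simp: components_def dart_comp_def cut_edge_simps[OF M w])
      then show ?thesis using IH e card_faces_cut_edge_merge[OF M w False] by auto
    qed
  next
    case False
    then have id: "opp M d = d" for d by auto
    have "next_dart M = rot M" by (auto simp: next_dart_def id)
    then have f: "faces M = vertices M" by (simp add: faces_def vertices_def)
    have "dart_comp M d = orbit (rot M) d" if "d \<in> darts M" for d
    proof
      show "dart_comp M d \<subseteq> orbit (rot M) d"
        unfolding dart_comp_def
        by (auto elim!: dart_conn_closed intro: orbit.step permutation_self_in_orbit premapD(6)[OF M] simp: id)
      show "orbit (rot M) d \<subseteq> dart_comp M d"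
        using orbit_next_conn[OF M that] permutes_orbit_subset[OF premapD(2)[OF M] that]
        by (auto simp: \<open>next_dart M = rot M\<close> dart_comp_def)
    qed
    then have "components M = vertices M"
      by (auto simp: components_def vertices_def)
    then show ?thesis using f by simp
  qed
qed

lemma euler_connected:
  assumes "premap M" "connected_map M"
  shows "card (vertices M) + card (faces M) \<le> card (edges M) + 2"
proof -
  have "dart_comp M d = darts M" if "d \<in> darts M" for d
    using assms(2) that by (auto simp: connected_map_def dart_comp_def)
  then have "components M \<subseteq> {darts M}" by (auto simp: components_def)
  then have "card (components M) \<le> 1" using card_mono[of "{darts M}"] by fastforce
  then show ?thesis using euler_inequality[OF assms(1)] by auto
qed

lemma connected_cut_edge_iff:
  assumes "premap M" "connected_map M" "opp M b = w" "w \<noteq> b"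
  shows "connected_map (cut_edge M b) \<longleftrightarrow> (b, w) \<in> dart_conn (cut_edge M b)"
proof
  assume "connected_map (cut_edge M b)"
  then show "(b, w) \<in> dart_conn (cut_edge M b)"
    using opp_outside[OF assms(1)] opp_in_darts[OF assms(1)] assms
    by (auto simp: connected_map_def cut_edge_simps[OF assms(1,3,4)])
next
  assume "(b, w) \<in> dart_conn (cut_edge M b)"
  from cut_edge_conn_eq[OF assms(1,3,4) this] show "connected_map (cut_edge M b)"
    using assms(2) by (auto simp: connected_map_def cut_edge_simps[OF assms(1,3,4)])
qed

lemma orbit_next_cut_edge_merge:
  assumes "premap M" "opp M b = w" "w \<noteq> b" "w \<notin> orbit (next_dart M) b"
  shows "orbit (next_dart (cut_edge M b)) b = orbit (next_dart M) b \<union> orbit (next_dart M) w"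
  unfolding next_dart_cut_edge[OF assms(1-3)]
  by (rule orbit_fun_swap_merge[OF premapD(9)[OF assms(1)] assms(4)])

lemma separating_iff_same_face:
  assumes "plane_map M" "opp M b \<noteq> b"
  shows "separating M b \<longleftrightarrow> opp M b \<in> orbit (next_dart M) b"
proof -
  define w where "w = opp M b"
  have M: "premap M" "connected_map M" and w: "opp M b = w" "w \<noteq> b"
    and e: "card (vertices M) + card (faces M) = card (edges M) + 2"
    using assms by (auto simp: plane_map_iff w_def)
  note N = premap_cut_edge[OF M(1) w]
  show ?thesis
  proof (cases "w \<in> orbit (next_dart M) b")
    case True
    \<comment> \<open>A cut map has one edge less and, in this case, one face more, so its vertices
      and faces together outnumber its edges by 4. This is too many for a connected map.\<close>
    have "\<not> connected_map (cut_edge M b)"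
    proof
      assume "connected_map (cut_edge M b)"
      from euler_connected[OF N this] show False
        using e card_faces_cut_edge_split[OF M(1) w True] card_edges_cut_edge[OF M(1) w]
          cut_edge_simps(5)[OF M(1) w] by auto
    qed
    then show ?thesis using True w by (auto simp: separating_def)
  next
    case False
    have "w \<in> orbit (next_dart (cut_edge M b)) b"
      using orbit_next_cut_edge_merge[OF M(1) w False] permutation_self_in_orbit[OF premapD(9)[OF M(1)]]
      by auto
    then have "(b, w) \<in> dart_conn (cut_edge M b)"
      using orbit_next_conn[OF N] opp_outside[OF M(1)] w by (simp add: cut_edge_simps[OF M(1) w])
    then show ?thesis using False w connected_cut_edge_iff[OF M w] by (auto simp: separating_def)
  qed
qed

section \<open>Opening\<close>

lemma orbit_next_eq:
  "premap M \<Longrightarrow> y \<in> orbit (next_dart M) x \<Longrightarrow> orbit (next_dart M) y = orbit (next_dart M) x"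
  by (rule permutation_orbit_eq[OF premapD(9)])

lemma self_in_orbit_next: "premap M \<Longrightarrow> x \<in> orbit (next_dart M) x"
  by (rule permutation_self_in_orbit[OF premapD(9)])

text \<open>A face and an edge disappear together, which keeps Euler's formula. As \<open>b\<close>
  lies on the infinite face, the merge also brings \<open>w\<close> there, so both new half-edges
  are where a plane map requires them.\<close>

lemma plane_map_cut_edge:
  assumes M: "plane_map M" and w: "opp M b = w" "w \<noteq> b"
    and ns: "\<not> separating M b" and b: "b \<in> orbit (next_dart M) (root_dart M)"
  shows "plane_map (cut_edge M b)"
    and "orbit (next_dart (cut_edge M b)) (root_dart M) =
      orbit (next_dart M) (root_dart M) \<union> orbit (next_dart M) w"
proof -
  have pM: "premap M" and e: "card (vertices M) + card (faces M) = card (edges M) + 2"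
    and r: "root_dart M \<in> half_edges M" "half_edges M \<subseteq> orbit (next_dart M) (root_dart M)"
    using M by (auto simp: plane_map_iff)
  let ?N = "cut_edge M b"
  note cs = cut_edge_simps[OF pM w]
  have nw: "w \<notin> orbit (next_dart M) b" using separating_iff_same_face[OF M, of b] w ns by auto
  have eq: "orbit (next_dart M) b = orbit (next_dart M) (root_dart M)"
    by (rule orbit_next_eq[OF pM b])
  have m: "orbit (next_dart ?N) b = orbit (next_dart M) b \<union> orbit (next_dart M) w"
    by (rule orbit_next_cut_edge_merge[OF pM w nw])
  have "root_dart M \<in> orbit (next_dart ?N) b" using m eq self_in_orbit_next[OF pM] by auto
  then have m': "orbit (next_dart ?N) (root_dart M) = orbit (next_dart ?N) b"
    by (rule orbit_next_eq[OF premap_cut_edge[OF pM w]])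
  then show o: "orbit (next_dart ?N) (root_dart M) =
      orbit (next_dart M) (root_dart M) \<union> orbit (next_dart M) w"
    using m eq by simp
  have "half_edges ?N \<subseteq> orbit (next_dart ?N) (root_dart M)"
    using half_edges_cut_edge[OF pM w] o r b self_in_orbit_next[OF pM] by auto
  then show "plane_map ?N"
    unfolding plane_map_iff cs(4,5)
    using premap_cut_edge[OF pM w] ns e r card_faces_cut_edge_merge[OF pM w nw]
      card_edges_cut_edge[OF pM w] half_edges_cut_edge[OF pM w]
    by (auto simp: separating_def)
qed

text \<open>Along a face, edges are traversed alternately from black to white and from white to black.\<close>

lemma card_black_white_on_face:
  assumes "premap M" "d \<in> darts M"
  defines "Z \<equiv> orbit (next_dart M) d"
  shows "card {x \<in> Z. opp M x \<noteq> x \<and> x \<in> black M} = card {x \<in> Z. opp M x \<noteq> x \<and> x \<notin> black M}"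
proof -
  note pM = assms(1)
  have ZD: "Z \<subseteq> darts M" unfolding Z_def by (rule orbit_next_subset[OF assms(1,2)])
  then have fin: "finite Z" using premapD(1)[OF pM] finite_subset by auto
  have inj: "inj_on (next_dart M) X" for X
    using permutes_inj[OF premapD(8)[OF pM]] inj_on_subset by blast
  have nZ: "next_dart M ` Z = Z"
  proof (rule card_subset_eq[OF fin])
    show "next_dart M ` Z \<subseteq> Z" unfolding Z_def by (auto intro: orbit.step)
    show "card (next_dart M ` Z) = card Z" using inj by (rule card_image)
  qed
  let ?h = "{x \<in> Z. opp M x = x \<and> x \<in> black M}"
  let ?b = "{x \<in> Z. opp M x \<noteq> x \<and> x \<in> black M}"
  let ?w = "{x \<in> Z. opp M x \<noteq> x \<and> x \<notin> black M}"
  have nb: "next_dart M x \<in> black M \<longleftrightarrow> opp M x \<in> black M" if "x \<in> Z" for x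
    using that ZD rot_black[OF pM] opp_in_darts[OF pM] by (auto simp: next_dart_def)
  have "?h \<union> ?b = Z \<inter> black M" by auto
  also have "card (Z \<inter> black M) = card {x \<in> Z. next_dart M x \<in> black M}"
  proof -
    have "Z \<inter> black M = next_dart M ` {x \<in> Z. next_dart M x \<in> black M}" using nZ by auto
    then show ?thesis by (simp add: card_image inj)
  qed
  \<comment> \<open>The walk arrives at a black vertex either by following a black half-edge out and
    back or by traversing an edge from its white end.\<close>
  also have "{x \<in> Z. next_dart M x \<in> black M} = ?h \<union> ?w"
    using nb opp_black[OF pM] by auto
  finally have "card (?h \<union> ?b) = card (?h \<union> ?w)" .
  moreover have "card (?h \<union> ?b) = card ?h + card ?b" using fin by (intro card_Un_disjoint) auto
  moreover have "card (?h \<union> ?w) = card ?h + card ?w" using fin by (intro card_Un_disjoint) auto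
  ultimately show ?thesis by simp
qed

text \<open>Progress of the opening. If all black edge darts of the infinite face were separating,
  their opposites would lie on it too. By the equality of counts these are all its white edge darts,
  so the face is closed under \<open>opp\<close> and \<open>rot\<close> and contains every
  dart.\<close>

lemma exists_black_nonseparating:
  assumes M: "plane_map M" and f: "card (faces M) \<noteq> 1"
  shows "\<exists>d \<in> orbit (next_dart M) (root_dart M). d \<in> black M \<and> opp M d \<noteq> d \<and> \<not> separating M d"
proof (rule ccontr)
  assume neg: "\<not> ?thesis"
  have pM: "premap M" and conn: "connected_map M" and r: "root_dart M \<in> darts M"
    using M by (auto simp: plane_map_iff half_edges_def)
  define Z where "Z = orbit (next_dart M) (root_dart M)"
  have Zd: "Z \<subseteq> darts M" unfolding Z_def by (rule orbit_next_subset[OF pM r])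
  then have fin: "finite Z" using premapD(1)[OF pM] finite_subset by auto
  let ?b = "{x \<in> Z. opp M x \<noteq> x \<and> x \<in> black M}"
  let ?w = "{x \<in> Z. opp M x \<noteq> x \<and> x \<notin> black M}"
  have bZ: "opp M x \<in> Z" if "x \<in> ?b" for x
    using that neg separating_iff_same_face[OF M, of x] orbit_next_eq[OF pM, of x] by (auto simp: Z_def)
  have "opp M ` ?b \<subseteq> ?w"
    using bZ opp_black[OF pM] premapD(4)[OF pM] by auto
  moreover have "card (opp M ` ?b) = card ?w"
    using card_black_white_on_face[OF pM r] permutes_inj[OF premapD(3)[OF pM]]
    by (subst card_image) (auto simp: Z_def intro: inj_on_subset)
  ultimately have wb: "opp M ` ?b = ?w" using fin by (intro card_subset_eq) auto
  have oZ: "opp M x \<in> Z" if "x \<in> Z" for x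
  proof (cases "opp M x = x \<or> x \<in> black M")
    case True
    then show ?thesis using bZ that by (cases "opp M x = x") auto
  next
    case False
    then have "x \<in> opp M ` ?b" using wb that by auto
    then show ?thesis using premapD(4)[OF pM] by auto
  qed
  have rZ: "rot M x \<in> Z" if "x \<in> Z" for x
  proof -
    have "next_dart M (opp M x) \<in> Z" using oZ[OF that] unfolding Z_def by (rule orbit.step)
    then show ?thesis by (simp add: next_dart_def premapD(4)[OF pM])
  qed
  have "darts M \<subseteq> Z"
  proof
    fix d assume "d \<in> darts M"
    then have "(root_dart M, d) \<in> dart_conn M" using conn r by (auto simp: connected_map_def)
    then show "d \<in> Z"
      by (rule dart_conn_closed) (use self_in_orbit_next[OF pM] oZ rZ in \<open>auto simp: Z_def\<close>)
  qed
  then have "faces M = {Z}"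
    using orbit_next_eq[OF pM] r unfolding faces_def Z_def by blast
  then show False using f by simp
qed

definition cuttable :: "'a hmap \<Rightarrow> 'a \<Rightarrow> bool" where
  "cuttable M d \<longleftrightarrow> d \<in> black M \<and> opp M d \<noteq> d \<and> \<not> separating M d"

lemma opening_step_eq:
  "opening_step (M, d) = (if cuttable M d then cut_edge M d else M, next_dart M d)"
  by (simp add: opening_step_def cuttable_def)

definition opening_state :: "'a hmap \<times> 'a \<Rightarrow> bool" where
  "opening_state = (\<lambda>(N, d). plane_map N \<and> d \<in> orbit (next_dart N) (root_dart N))"

lemma opening_state_step:
  assumes "opening_state (N, d)" shows "opening_state (opening_step (N, d))"
proof (cases "cuttable N d")
  case False
  then show ?thesis using assms by (auto simp: opening_step_eq opening_state_def intro: orbit.step)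
next
  case True
  have N: "plane_map N" and d: "d \<in> orbit (next_dart N) (root_dart N)"
    using assms by (auto simp: opening_state_def)
  have c: "opp N d = opp N d" "opp N d \<noteq> d" "\<not> separating N d" using True by (auto simp: cuttable_def)
  note p = plane_map_cut_edge[OF N c d]
  have "next_dart N d \<in> orbit (next_dart N) (root_dart N)" using d by (rule orbit.step)
  then show ?thesis using True p
    by (auto simp: opening_step_eq opening_state_def cut_edge_simps[OF plane_map_premap[OF N] c(1,2)])
qed

text \<open>The measure is lexicographic: the number of edges, then the number of steps until the
  walk meets a dart that can be cut. The latter is finite because such a dart lies on the infinite
  face, which the walk does not leave.\<close>

lemma opening_terminates:
  assumes "plane_map M"
  shows "\<exists>s. while_option (\<lambda>(N, d). \<not> plane_tree N) opening_step (M, root_dart M) = Some s"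
proof (rule wf_rel_while_option_Some[where P = opening_state])
  let ?e = "\<lambda>(N, d). card (edges N)"
  let ?s = "\<lambda>(N, d). LEAST i. cuttable N ((next_dart N ^^ i) d)"
  show "wf (measures [?e, ?s])" by simp
  show "opening_state (M, root_dart M)"
    using assms self_in_orbit_next[OF plane_map_premap[OF assms]] by (auto simp: opening_state_def)
  fix s
  assume a: "opening_state s \<and> (case s of (N, d) \<Rightarrow> \<not> plane_tree N)"
  obtain N d where s: "s = (N, d)" by force
  show "opening_state (opening_step s)" using a opening_state_step by (auto simp: s)
  have N: "plane_map N" and d: "d \<in> orbit (next_dart N) (root_dart N)" and f: "card (faces N) \<noteq> 1"
    using a by (auto simp: opening_state_def s plane_tree_def)
  show "(opening_step s, s) \<in> measures [?e, ?s]"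
  proof (cases "cuttable N d")
    case True
    then have "opp N d \<noteq> d" by (simp add: cuttable_def)
    then show ?thesis using True card_edges_cut_edge[OF plane_map_premap[OF N] refl]
      by (simp add: s opening_step_eq)
  next
    case False
    obtain c where c: "c \<in> orbit (next_dart N) (root_dart N)" "cuttable N c"
      using exists_black_nonseparating[OF N f] by (auto simp: cuttable_def)
    then have "c \<in> orbit (next_dart N) d"
      using orbit_next_eq[OF plane_map_premap[OF N] d] by simp
    then obtain n where n: "cuttable N ((next_dart N ^^ n) d)" using c by (auto simp: orbit_altdef)
    have "(LEAST i. cuttable N ((next_dart N ^^ i) d)) =
        Suc (LEAST i. cuttable N ((next_dart N ^^ Suc i) d))"
      using n by (rule Least_Suc) (use False in simp)
    then show ?thesis using False by (simp add: s opening_step_eq funpow_swap1)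
  qed
qed

text \<open>Invariant rule for the loop. Each step may use that the current map is plane and that
  the current dart lies on its infinite face; the dart at the exit is left existential.\<close>

lemma map_opening_rule:
  assumes M: "plane_map M" and init: "P M (root_dart M)"
    and step: "\<And>N d. plane_map N \<Longrightarrow> d \<in> orbit (next_dart N) (root_dart N) \<Longrightarrow> \<not> plane_tree N \<Longrightarrow> P N d \<Longrightarrow>
      P (if cuttable N d then cut_edge N d else N) (next_dart N d)"
  shows "plane_tree (map_opening M) \<and> (\<exists>d. P (map_opening M) d)"
proof -
  obtain s where s: "while_option (\<lambda>(N, d). \<not> plane_tree N) opening_step (M, root_dart M) = Some s"
    using opening_terminates[OF M] by auto
  have m: "map_opening M = fst s" using s by (simp add: map_opening_def while_def)
  have "opening_state s \<and> P (fst s) (snd s)"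
    using _ s
  proof (rule while_option_rule)
    show "opening_state (M, root_dart M) \<and> P (fst (M, root_dart M)) (snd (M, root_dart M))"
      using M init self_in_orbit_next[OF plane_map_premap[OF M]] by (auto simp: opening_state_def)
    fix s :: "'a hmap \<times> 'a"
    assume *: "opening_state s \<and> P (fst s) (snd s)" "case s of (N, d) \<Rightarrow> \<not> plane_tree N"
    obtain N d where "s = (N, d)" by force
    then show "opening_state (opening_step s) \<and> P (fst (opening_step s)) (snd (opening_step s))"
      using * opening_state_step[of N d] step[of N d]
      by (auto simp: opening_step_eq opening_state_def)
  qed
  moreover have "plane_tree (fst s)" using while_option_stop[OF s] by (auto split: prod.splits)
  ultimately show ?thesis unfolding m by auto
qed

section \<open>Cut edges as a partial matching\<close>

lemma between_first: "next_dart M x \<noteq> y \<Longrightarrow> next_dart M x \<in> between M x y"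
  unfolding between_def by (intro CollectI exI[of _ 1]) (auto simp: le_Suc_eq)

lemma between_step:
  assumes "z \<in> between M x y" "next_dart M z \<noteq> y"
  shows "next_dart M z \<in> between M x y"
proof -
  obtain i where i: "z = (next_dart M ^^ i) x" "0 < i" "\<forall>j. 0 < j \<and> j \<le> i \<longrightarrow> (next_dart M ^^ j) x \<noteq> y"
    using assms(1) by (auto simp: between_def)
  then show ?thesis using assms(2) unfolding between_def
    by (intro CollectI exI[of _ "Suc i"]) (auto simp: le_Suc_eq)
qed

lemma between_induct [consumes 1, case_names first step]:
  assumes "z \<in> between M x y" "next_dart M x \<noteq> y \<Longrightarrow> next_dart M x \<in> X"
    "\<And>z. z \<in> X \<Longrightarrow> next_dart M z \<noteq> y \<Longrightarrow> next_dart M z \<in> X"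
  shows "z \<in> X"
proof -
  obtain i where "z = (next_dart M ^^ i) x" "0 < i" "\<forall>j. 0 < j \<and> j \<le> i \<longrightarrow> (next_dart M ^^ j) x \<noteq> y"
    using assms(1) by (auto simp: between_def)
  then show ?thesis
  proof (induction i arbitrary: z)
    case (Suc i)
    show ?case
    proof (cases "i = 0")
      case True
      then show ?thesis using Suc.prems assms(2) by auto
    next
      case False
      then have "(next_dart M ^^ i) x \<in> X" using Suc by auto
      then show ?thesis using Suc.prems assms(3) by auto
    qed
  qed simp
qed

lemma partial_matching_Field:
  assumes "partial_matching T P"
  shows "P \<subseteq> buds T \<times> leaves T" "Field P \<subseteq> half_edges T" "finite P"
proof -
  show *: "P \<subseteq> buds T \<times> leaves T" using assms
    by induct (auto simp: matchable_def)
  then show "Field P \<subseteq> half_edges T" by (auto simp: Field_def buds_def leaves_def)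
  show "finite P" using assms by induct auto
qed

text \<open>The new pair is matched before all pairs of \<open>P\<close>, and the derivation of
  \<open>P\<close> is replayed after it. The cut inserts the former face of \<open>w\<close> into
  the walk after \<open>b\<close>. That face carries no half-edge of \<open>N\<close>, so between
  two older partners nothing but \<open>b\<close> and \<open>w\<close> can be new.\<close>

lemma partial_matching_cut_edge:
  assumes N: "plane_map N" and w: "opp N b = w" "w \<noteq> b" and b: "b \<in> black N"
    and ns: "\<not> separating N b" and o: "b \<in> orbit (next_dart N) (root_dart N)"
    and P: "partial_matching N P"
  shows "partial_matching (cut_edge N b) (insert (b, w) P)"
proof -
  let ?N = "cut_edge N b"
  let ?f = "next_dart N" and ?g = "next_dart ?N"
  have pN: "premap N" and out: "half_edges N \<subseteq> orbit ?f b"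
    using N orbit_next_eq[OF plane_map_premap[OF N] o] by (auto simp: plane_map_iff)
  note cs = cut_edge_simps[OF pN w] and nd = next_dart_cut_edge[OF pN w]
  have nw: "w \<notin> orbit ?f b" using separating_iff_same_face[OF N, of b] w ns by auto
  have dis: "orbit ?f b \<inter> orbit ?f w = {}"
    using nw orbit_next_eq[OF pN] self_in_orbit_next[OF pN] by (metis disjoint_iff)
  have self: "b \<in> orbit ?f b" "w \<in> orbit ?f w" using self_in_orbit_next[OF pN] by auto
  have he: "half_edges ?N = half_edges N \<union> {b, w}" by (rule half_edges_cut_edge[OF pN w])
  have bw: "b \<notin> half_edges N" "w \<notin> half_edges N" "w \<notin> black N"
    using opp_black[OF pN, of b] w b premapD(4)[OF pN, of b] by (auto simp: half_edges_def)
  have bl: "buds ?N = insert b (buds N)" "leaves ?N = insert w (leaves N)"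
    using he bw b by (auto simp: buds_def leaves_def cs)
  show ?thesis using P
  proof induct
    case empty
    \<comment> \<open>From \<open>b\<close> the walk now enters the former face of \<open>w\<close>
      and stays there until it reaches \<open>w\<close>.\<close>
    have "z \<in> orbit ?f w - {w}" if "z \<in> between ?N b w" for z
      using that
    proof (induct rule: between_induct)
      case first
      have "?g b = ?f w" using w by (simp add: nd)
      then show ?case using first orbit.base[of ?f w] by simp
    next
      case (step z)
      then have "z \<noteq> b" "z \<noteq> w" using dis self by auto
      then have "?g z = ?f z" by (simp add: nd)
      then show ?case using step orbit.step[of z ?f w] by auto
    qed
    then have "half_edges ?N \<inter> between ?N b w \<subseteq> {}"
      using he out dis self by auto
    then have "matchable ?N {} b w" by (auto simp: matchable_def bl)
    then show ?case by (rule partial_matching.match[OF partial_matching.empty])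
  next
    case (match P b1 l1)
    from match(3) have m: "b1 \<in> buds N" "b1 \<notin> Field P" "l1 \<in> leaves N" "l1 \<notin> Field P"
      "half_edges N \<inter> between N b1 l1 \<subseteq> Field P" by (auto simp: matchable_def)
    then have hb: "b1 \<in> half_edges N" "l1 \<in> half_edges N" by (auto simp: buds_def leaves_def)
    then have ne: "b1 \<noteq> b" "b1 \<noteq> w" "l1 \<noteq> b" "l1 \<noteq> w" using bw by auto
    let ?Bt = "between N b1 l1"
    \<comment> \<open>Invariant of the walk in the cut map: on the old infinite face it visits only
      darts that were already between \<open>b1\<close> and \<open>l1\<close>, and it enters the
      face of \<open>w\<close> only if \<open>b\<close> is one of them.\<close>
    have X: "z \<in> {z. z \<in> ?Bt \<and> z \<in> orbit ?f b \<or> b \<in> ?Bt \<and> z \<in> orbit ?f w}" if "z \<in> between ?N b1 l1" for z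
      using that
    proof (induct rule: between_induct)
      case first
      have "?g b1 = ?f b1" using ne by (simp add: nd)
      moreover have "?f b1 \<in> orbit ?f b" using hb(1) out by (auto intro: orbit.step)
      ultimately show ?case using first between_first[of N b1 l1] by auto
    next
      case (step z)
      consider "z = b" | "z = w" | "z \<noteq> b" "z \<noteq> w" by auto
      then show ?case
      proof cases
        case 1
        then have "b \<in> ?Bt" using step(1) dis self by auto
        moreover have "?g z = ?f w" using 1 w by (simp add: nd)
        ultimately show ?thesis using orbit.base[of ?f w] by simp
      next
        case 2
        then have "b \<in> ?Bt" using step(1) dis self by auto
        moreover have g: "?g z = ?f b" using 2 by (simp add: nd)
        ultimately have "?f b \<in> ?Bt" using between_step step(2) by metis
        then show ?thesis using g orbit.base[of ?f b] by simp
      next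
        case 3
        then have "?g z = ?f z" by (simp add: nd)
        then show ?thesis using step between_step[of z N b1 l1] orbit.step[of z ?f] by auto
      qed
    qed
    have "half_edges ?N \<inter> between ?N b1 l1 \<subseteq> Field (insert (b, w) P)"
    proof
      fix z assume z: "z \<in> half_edges ?N \<inter> between ?N b1 l1"
      show "z \<in> Field (insert (b, w) P)"
      proof (cases "z = b \<or> z = w")
        case False
        then have "z \<in> half_edges N" using z he by auto
        moreover from this have "z \<in> ?Bt" using X[of z] z out dis by auto
        ultimately show ?thesis using m(5) by auto
      qed auto
    qed
    then have "matchable ?N (insert (b, w) P) b1 l1"
      using m ne by (auto simp: matchable_def bl)
    then have "partial_matching ?N (insert (b1, l1) (insert (b, w) P))"
      by (rule partial_matching.match[OF match(2)])
    then show ?case by (simp add: insert_commute)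
  qed
qed

text \<open>The loop invariant describes the current map by the set \<open>Q\<close> of edges cut so
  far, written as pairs of a black and a white dart, and adds that \<open>Q\<close> is a partial
  matching of that map.\<close>

lemma map_opening_partial_matching:
  assumes M: "leg_map k M"
  obtains Q where "plane_tree (map_opening M)" "partial_matching (map_opening M) Q"
    "Q \<subseteq> {(b, w). b \<in> black M \<and> opp M b = w \<and> w \<noteq> b}"
    "map_opening M = M\<lparr>opp := \<lambda>d. if d \<in> Field Q then d else opp M d\<rparr>"
proof -
  define P where "P = (\<lambda>N (d :: 'a). \<exists>Q. partial_matching N Q \<and>
    Q \<subseteq> {(b, w). b \<in> black M \<and> opp M b = w \<and> w \<noteq> b} \<and>
    N = M\<lparr>opp := \<lambda>d. if d \<in> Field Q then d else opp M d\<rparr>)"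
  have "plane_map M" using M by (simp add: leg_map_def)
  then have "plane_tree (map_opening M) \<and> (\<exists>d. P (map_opening M) d)"
  proof (rule map_opening_rule)
    have "opp M = (\<lambda>d. if d \<in> Field {} then d else opp M d)" by auto
    then show "P M (root_dart M)" unfolding P_def
      by (intro exI[of _ "{}"]) (auto intro: partial_matching.empty)
    fix N d
    assume N: "plane_map N" "d \<in> orbit (next_dart N) (root_dart N)" "P N d"
    show "P (if cuttable N d then cut_edge N d else N) (next_dart N d)"
    proof (cases "cuttable N d")
      case False
      then show ?thesis using N(3) by (simp add: P_def)
    next
      case True
      obtain Q where Q: "partial_matching N Q" "Q \<subseteq> {(b, w). b \<in> black M \<and> opp M b = w \<and> w \<noteq> b}"
        and NQ: "N = M\<lparr>opp := \<lambda>d. if d \<in> Field Q then d else opp M d\<rparr>"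
        using N(3) by (auto simp: P_def)
      define w where "w = opp N d"
      have c: "opp N d = w" "w \<noteq> d" "d \<in> black N" "\<not> separating N d"
        using True by (auto simp: cuttable_def w_def)
      have d: "opp M d = w" "d \<notin> Field Q" "d \<in> black M"
        using c NQ by (auto split: if_splits)
      let ?Q = "insert (d, w) Q"
      have "cut_edge N d = M\<lparr>opp := \<lambda>x. if x \<in> Field ?Q then x else opp M x\<rparr>"
        unfolding cut_edge_def c(1) by (subst NQ, subst NQ) (auto intro!: arg_cong[of _ _ "\<lambda>f. M\<lparr>opp := f\<rparr>"])
      moreover have "partial_matching (cut_edge N d) ?Q"
        by (rule partial_matching_cut_edge[OF N(1) c(1,2,3,4) N(2) Q(1)])
      ultimately show ?thesis using True d Q(2) c(2) unfolding P_def by auto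
    qed
  qed
  then show ?thesis using that unfolding P_def by blast
qed

section \<open>Matching along the contour of a tree\<close>

text \<open>In a map with one face the boundary walk meets every dart once per turn, and positions
  on it turn statements about the cyclic order into inequalities. The start \<open>s\<close> is a
  parameter because the cycle is opened at different places: at a bud, at an unmatched leaf, at the
  root.\<close>

locale contour =
  fixes T :: "'a hmap" and s :: 'a
  assumes pT: "premap T" and sT: "s \<in> darts T"
    and single_face: "darts T \<subseteq> orbit (next_dart T) s"
begin

definition D :: "nat \<Rightarrow> 'a" where "D i = (next_dart T ^^ i) s"

definition N :: nat where "N = funpow_dist1 (next_dart T) s s"

definition pos :: "'a \<Rightarrow> nat" where "pos d = funpow_dist (next_dart T) s d"

lemma N_pos [simp]: "0 < N" by (simp add: N_def)

lemma D_0 [simp]: "D 0 = s" by (simp add: D_def)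

lemma next_D: "next_dart T (D i) = D (Suc i)" by (simp add: D_def)

lemma D_add: "(next_dart T ^^ j) (D i) = D (j + i)" by (simp add: D_def funpow_add)

lemma D_N [simp]: "D N = s"
  unfolding D_def N_def by (rule funpow_dist1_prop[OF self_in_orbit_next[OF pT]])

lemma D_in_darts [simp]: "D i \<in> darts T"
proof (induct i)
  case (Suc i)
  then show ?case using next_in_darts[OF pT, of "D i"] by (simp add: next_D)
qed (simp add: sT)

lemma inj_D: "inj_on D {0..<N}"
  unfolding D_def N_def by (rule inj_on_funpow_dist1[OF self_in_orbit_next[OF pT]])

lemma D_eq_iff: "i < N \<Longrightarrow> j < N \<Longrightarrow> D i = D j \<longleftrightarrow> i = j"
  using inj_D by (auto simp: inj_on_def)

lemma darts_eq: "darts T = D ` {0..<N}"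
proof
  show "darts T \<subseteq> D ` {0..<N}"
    using single_face orbit_conv_funpow_dist1[OF self_in_orbit_next[OF pT, of s]]
    by (simp add: D_def N_def)
qed auto

lemma D_pos [simp]: "d \<in> darts T \<Longrightarrow> D (pos d) = d"
  using single_face unfolding D_def pos_def by (intro funpow_dist_prop) auto

lemma pos_D [simp]: assumes "i < N" shows "pos (D i) = i"
proof -
  have "pos (D i) \<le> i" unfolding pos_def funpow_dist_def D_def by (rule Least_le) simp
  then show ?thesis using assms D_eq_iff[of "pos (D i)" i] by simp
qed

lemma pos_less [simp]: "d \<in> darts T \<Longrightarrow> pos d < N"
  unfolding darts_eq by auto

lemma pos_eq_iff: "d \<in> darts T \<Longrightarrow> e \<in> darts T \<Longrightarrow> pos d = pos e \<longleftrightarrow> d = e"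
  using D_pos by metis

lemma pos_s [simp]: "pos s = 0" using pos_D[of 0] by simp

text \<open>The value \<open>j = N\<close> stands for the start \<open>s\<close> met again after a
  full turn.\<close>

lemma between_D:
  assumes "i < j" "j \<le> N"
  shows "between T (D i) (D j) = {D k | k. i < k \<and> k < j}"
proof -
  have ne: "D k \<noteq> D j" if "i < k" "k < j" for k
    using that assms D_eq_iff[of k j] D_eq_iff[of k 0] by (cases "j = N") auto
  show ?thesis
  proof (intro equalityI subsetI)
    fix z assume "z \<in> between T (D i) (D j)"
    then obtain t where t: "z = D (t + i)" "0 < t" "\<forall>u. 0 < u \<and> u \<le> t \<longrightarrow> D (u + i) \<noteq> D j"
      unfolding between_def D_add by auto
    have "t < j - i"
    proof (rule ccontr)
      assume "\<not> t < j - i"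
      then show False using t(3) assms by (metis le_add_diff_inverse2 less_imp_le not_less zero_less_diff)
    qed
    then show "z \<in> {D k | k. i < k \<and> k < j}" using t by auto
  next
    fix z assume "z \<in> {D k | k. i < k \<and> k < j}"
    then obtain k where "z = D k" "i < k" "k < j" by auto
    then show "z \<in> between T (D i) (D j)"
      unfolding between_def D_add using ne by (auto intro!: exI[of _ "k - i"])
  qed
qed

lemma between_pos:
  assumes "x \<in> darts T" "y \<in> darts T" "pos x < pos y"
  shows "z \<in> between T x y \<longleftrightarrow> z \<in> darts T \<and> pos x < pos z \<and> pos z < pos y"
proof -
  have le: "pos y \<le> N" using pos_less[OF assms(2)] by (rule less_imp_le)
  have "between T x y = {D k | k. pos x < k \<and> k < pos y}"
    using between_D[OF assms(3) le] assms by simp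
  moreover have "z \<in> {D k | k. pos x < k \<and> k < pos y} \<longleftrightarrow>
      z \<in> darts T \<and> pos x < pos z \<and> pos z < pos y"
  proof
    assume "z \<in> {D k | k. pos x < k \<and> k < pos y}"
    then obtain k where k: "z = D k" "pos x < k" "k < pos y" by auto
    then have "pos z = k" using le by (simp add: pos_D)
    then show "z \<in> darts T \<and> pos x < pos z \<and> pos z < pos y" using k by simp
  next
    assume "z \<in> darts T \<and> pos x < pos z \<and> pos z < pos y"
    then show "z \<in> {D k | k. pos x < k \<and> k < pos y}" by (intro CollectI exI[of _ "pos z"]) simp
  qed
  ultimately show ?thesis by simp
qed

lemma between_to_origin:
  assumes "x \<in> darts T" "z \<in> darts T" "pos x < pos z"
  shows "z \<in> between T x s"
proof -
  have "between T x s = {D k | k. pos x < k \<and> k < N}"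
    using between_D[of "pos x" N] assms pos_less[of x] by simp
  then show ?thesis using assms pos_less[of z] by (auto intro!: exI[of _ "pos z"])
qed

lemma origin_between:
  assumes "x \<in> darts T" "y \<in> darts T" "pos y < pos x" "y \<noteq> s"
  shows "s \<in> between T x y"
proof -
  have ny: "0 < pos y" using assms D_pos by (metis D_0 gr0I)
  have nx: "pos x < N" using assms by simp
  have "D (u + pos x) \<noteq> y" if "0 < u" "u \<le> N - pos x" for u
  proof (cases "u = N - pos x")
    case True
    then have "u + pos x = N" using nx by linarith
    then show ?thesis using assms(4) by simp
  next
    case False
    then have "u + pos x < N" using that by linarith
    then have "pos (D (u + pos x)) = u + pos x" by simp
    then show ?thesis using assms(3) that by auto
  qed
  then have "\<forall>u. 0 < u \<and> u \<le> N - pos x \<longrightarrow> (next_dart T ^^ u) x \<noteq> y"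
    using D_add[of _ "pos x"] assms by simp
  moreover have "N - pos x + pos x = N" using nx by linarith
  then have "s = (next_dart T ^^ (N - pos x)) x"
    using D_add[of "N - pos x" "pos x"] assms(1) by (metis D_N D_pos)
  ultimately show ?thesis unfolding between_def using nx by auto
qed

text \<open>An unmatched half-edge at the origin keeps pairs from wrapping around, so pairs are
  intervals of positions. Since only matched half-edges lie inside a pair, the ends of a new pair
  lie outside all older ones, and none is crossed.\<close>

lemma partial_matching_nested:
  assumes "partial_matching T P" "s \<in> half_edges T" "s \<notin> Field P"
  shows "((b, l) \<in> P \<longrightarrow> pos b < pos l) \<and>
    ((b, l) \<in> P \<longrightarrow> x \<in> half_edges T \<longrightarrow> pos b < pos x \<longrightarrow> pos x < pos l \<longrightarrow> x \<in> Field P) \<and>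
    ((b, l) \<in> P \<longrightarrow> (b', l') \<in> P \<longrightarrow> pos b < pos b' \<longrightarrow> pos b' < pos l \<longrightarrow> pos l' < pos l) \<and>
    ((b, l) \<in> P \<longrightarrow> (b', l') \<in> P \<longrightarrow> pos b < pos l' \<longrightarrow> pos l' < pos l \<longrightarrow> pos b < pos b')"
  using assms(1,3)
proof (induct arbitrary: b l b' l' x)
  case empty
  then show ?case by simp
next
  case (match P b0 l0)
  have m: "b0 \<in> buds T" "b0 \<notin> Field P" "l0 \<in> leaves T" "l0 \<notin> Field P"
    "half_edges T \<inter> between T b0 l0 \<subseteq> Field P"
    using match(3) by (auto simp: matchable_def)
  have sP: "s \<notin> Field P" "s \<noteq> l0" using match(4) by auto
  have d: "b0 \<in> darts T" "l0 \<in> darts T" and h: "b0 \<in> half_edges T" "l0 \<in> half_edges T" and ne: "b0 \<noteq> l0"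
    using m(1,3) by (auto simp: buds_def leaves_def half_edges_def)
  \<comment> \<open>Otherwise the walk from \<open>b0\<close> to \<open>l0\<close> would pass the
    origin, which is unmatched.\<close>
  have "\<not> pos l0 < pos b0"
    using origin_between[OF d] sP assms(2) m(5) by auto
  then have lt: "pos b0 < pos l0" using ne pos_eq_iff[OF d] by (metis linorder_neqE_nat)
  have bt: "x \<in> Field P" if "x \<in> half_edges T" "pos b0 < pos x" "pos x < pos l0" for x
    using m(5) between_pos[OF d lt] that by (auto simp: half_edges_def)
  note IH = match(2)[OF sP(1)]
  have out: "pos b1 < pos l1" "\<lbrakk>pos b1 < pos b0; pos b0 < pos l1\<rbrakk> \<Longrightarrow> False"
    "\<lbrakk>pos b1 < pos l0; pos l0 < pos l1\<rbrakk> \<Longrightarrow> False" if "(b1, l1) \<in> P" for b1 l1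
    using IH that m(2,4) h by blast+
  have dP: "b1 \<in> darts T" "l1 \<in> darts T" "b1 \<noteq> b0" "b1 \<noteq> l0" "l1 \<noteq> b0" "l1 \<noteq> l0" if "(b1, l1) \<in> P" for b1 l1
    using that partial_matching_Field[OF match(1)] m(2,4)
    by (auto simp: Field_def buds_def leaves_def half_edges_def)
  have neq: "pos b1 \<noteq> pos b0" "pos b1 \<noteq> pos l0" "pos l1 \<noteq> pos b0" "pos l1 \<noteq> pos l0" if "(b1, l1) \<in> P" for b1 l1
    using dP[OF that] d pos_eq_iff by auto
  have c1: "(b, l) \<in> insert (b0, l0) P \<longrightarrow> pos b < pos l" using lt out by auto
  have c2: "(b, l) \<in> insert (b0, l0) P \<longrightarrow> x \<in> half_edges T \<longrightarrow> pos b < pos x \<longrightarrow> pos x < pos l \<longrightarrow>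
      x \<in> Field (insert (b0, l0) P)"
    using bt[of x] IH[of b l x] by auto
  have c3: "pos l' < pos l" if "(b, l) \<in> insert (b0, l0) P" "(b', l') \<in> insert (b0, l0) P"
      "pos b < pos b'" "pos b' < pos l"
    using that IH[of b l x b' l'] out[of b l] out[of b' l'] neq[of b' l'] by (auto simp: not_less_iff_gr_or_eq) (metis linorder_neqE_nat)+
  have c4: "pos b < pos b'" if "(b, l) \<in> insert (b0, l0) P" "(b', l') \<in> insert (b0, l0) P"
      "pos b < pos l'" "pos l' < pos l"
    using that IH[of b l x b' l'] out[of b l] out[of b' l'] neq[of b' l'] by (auto simp: not_less_iff_gr_or_eq) (metis linorder_neqE_nat)+
  show ?case using c1 c2 c3 c4 by blast
qed

text \<open>With the contour started at an unmatched bud, take the first unmatched leaf and the last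
  unmatched bud before it: nothing unmatched lies between them.\<close>

lemma bud_origin_matchable:
  assumes s: "s \<in> buds T - Field P" and l: "l \<in> leaves T - Field P"
  shows "\<exists>b l. matchable T P b l"
proof -
  define l1 where "l1 = arg_min pos (\<lambda>l. l \<in> leaves T - Field P)"
  have l1: "l1 \<in> leaves T - Field P" unfolding l1_def using l by (rule arg_min_natI)
  have l1_min: "pos l1 \<le> pos x" if "x \<in> leaves T - Field P" for x
    unfolding l1_def using that by (rule arg_min_nat_le)
  let ?S = "{b \<in> buds T - Field P. pos b < pos l1}"
  have dd: "x \<in> darts T" if "x \<in> leaves T \<or> x \<in> buds T" for x
    using that by (auto simp: leaves_def buds_def half_edges_def)
  have "s \<noteq> l1" using s l1 by (auto simp: buds_def leaves_def)
  then have "pos s < pos l1" using pos_eq_iff[OF sT, of l1] l1 dd by (metis DiffD1 gr0I pos_s)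
  then have "s \<in> ?S" using s by simp
  moreover have "finite ?S" by (rule finite_subset[OF _ premapD(1)[OF pT]]) (use dd in auto)
  ultimately have fin: "finite (pos ` ?S)" "pos ` ?S \<noteq> {}" by (simp_all only: finite_imageI image_is_empty) auto
  from Max_in[OF fin] obtain b1 where b1: "Max (pos ` ?S) = pos b1" "b1 \<in> ?S" by (rule imageE)
  have b1_max: "pos x \<le> pos b1" if "x \<in> ?S" for x
  proof -
    have "pos x \<in> pos ` ?S" using that by (rule imageI)
    from Max_ge[OF fin(1) this] show ?thesis unfolding b1(1) .
  qed
  have "half_edges T \<inter> between T b1 l1 \<subseteq> Field P"
  proof
    fix x assume x: "x \<in> half_edges T \<inter> between T b1 l1"
    then have p: "pos b1 < pos x" "pos x < pos l1"
      using between_pos[of b1 l1 x] b1(2) l1 dd by auto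
    show "x \<in> Field P"
    proof (rule ccontr)
      assume "x \<notin> Field P"
      then have "x \<in> leaves T - Field P \<or> x \<in> ?S" using x p by (auto simp: leaves_def buds_def)
      then show False using l1_min[of x] b1_max[of x] p by auto
    qed
  qed
  then have "matchable T P b1 l1" using b1(2) l1 by (auto simp: matchable_def)
  then show ?thesis by blast
qed

end

lemma plane_tree_contour:
  assumes "plane_tree T" "s \<in> darts T"
  shows "contour T s"
proof
  show p: "premap T" using assms by (auto simp: plane_tree_def plane_map_premap)
  show "s \<in> darts T" by fact
  obtain F where F: "faces T = {F}" using assms by (auto simp: plane_tree_def card_1_singleton_iff)
  show "darts T \<subseteq> orbit (next_dart T) s"
  proof
    fix d assume d: "d \<in> darts T"
    have "orbit (next_dart T) d \<in> faces T" "orbit (next_dart T) s \<in> faces T"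
      using d assms(2) by (auto simp: faces_def)
    then have "orbit (next_dart T) d = orbit (next_dart T) s" using F by auto
    then show "d \<in> orbit (next_dart T) s" using self_in_orbit_next[OF p, of d] by simp
  qed
qed

lemma partial_matching_inj:
  assumes "partial_matching T P"
  shows "(b, l) \<in> P \<Longrightarrow> (b, l') \<in> P \<Longrightarrow> l = l'" "(b, l) \<in> P \<Longrightarrow> (b', l) \<in> P \<Longrightarrow> b = b'"
proof -
  have "((b, l) \<in> P \<longrightarrow> (b, l') \<in> P \<longrightarrow> l = l') \<and> ((b, l) \<in> P \<longrightarrow> (b', l) \<in> P \<longrightarrow> b = b')"
    using assms
  proof induct
    case (match P b0 l0)
    then have "b0 \<notin> Field P" "l0 \<notin> Field P" by (auto simp: matchable_def)
    then have "(b0, l) \<notin> P" "(b, l0) \<notin> P" "(b', l0) \<notin> P" "(b0, l') \<notin> P" for b l b' l' by (auto simp: Field_def)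
    then show ?case using match(2) by auto
  qed simp
  then show "(b, l) \<in> P \<Longrightarrow> (b, l') \<in> P \<Longrightarrow> l = l'" "(b, l) \<in> P \<Longrightarrow> (b', l) \<in> P \<Longrightarrow> b = b'" by auto
qed

lemma finite_half_edges:
  assumes "premap T" shows "finite (half_edges T)" "finite (leaves T)" "finite (buds T)"
  using premapD(1)[OF assms] by (auto simp: half_edges_def leaves_def buds_def)

lemma partial_matching_card:
  assumes "premap T" "partial_matching T P"
  shows "card (leaves T \<inter> Field P) = card P" "card (buds T \<inter> Field P) = card P"
    "leaves T \<inter> Field P = snd ` P" "buds T \<inter> Field P = fst ` P"
proof -
  note P = partial_matching_Field[OF assms(2)]
  have d: "leaves T \<inter> buds T = {}" by (auto simp: leaves_def buds_def)
  show l: "leaves T \<inter> Field P = snd ` P" "buds T \<inter> Field P = fst ` P"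
    using P(1) d by (force simp: Field_def)+
  have "inj_on snd P" "inj_on fst P"
    using partial_matching_inj[OF assms(2)] by (auto simp: inj_on_def)
  then show "card (leaves T \<inter> Field P) = card P" "card (buds T \<inter> Field P) = card P"
    unfolding l by (auto intro: card_image)
qed

section \<open>Existence and uniqueness of the maximal matching\<close>

context
  fixes T :: "'a hmap"
  assumes tree: "plane_tree T" and pos: "total_charge T \<ge> 1"
begin

private lemma pT: "premap T" using tree by (simp add: plane_tree_def plane_map_premap)

text \<open>Matched buds and matched leaves are equally many, so a positive total charge leaves a
  leaf over.\<close>

lemma unmatched_leaf_exists:
  assumes "partial_matching T P"
  shows "\<exists>l. l \<in> leaves T - Field P"
proof (rule ccontr)
  assume "\<not> ?thesis"
  then have "card (leaves T) = card P"
    using partial_matching_card(1)[OF pT assms] by (metis DiffI Int_absorb2 subsetI)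
  also have "\<dots> \<le> card (buds T)"
    using partial_matching_card(2)[OF pT assms] finite_half_edges(3)[OF pT] by (metis card_mono inf_le1)
  finally show False using pos by (simp add: total_charge_def)
qed

lemma maximal_matching_buds:
  assumes "partial_matching T P" "\<forall>b l. \<not> matchable T P b l"
  shows "buds T \<subseteq> Domain P"
proof
  fix b assume b: "b \<in> buds T"
  then have "b \<in> darts T" by (simp add: buds_def half_edges_def)
  then interpret contour T b by (rule plane_tree_contour[OF tree])
  have "b \<in> Field P"
    using bud_origin_matchable[of P] b unmatched_leaf_exists[OF assms(1)] assms(2) by blast
  then show "b \<in> Domain P"
    using b partial_matching_card(4)[OF pT assms(1)] by (auto simp: Domain_fst)
qed

text \<open>Confluence of the matching process. Suppose \<open>P\<close> adds \<open>(b, l)\<close>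
  while \<open>Q\<close> pairs \<open>b\<close> with another leaf \<open>l'\<close>. As
  \<open>l'\<close> is not matched in \<open>P\<close>, it lies beyond \<open>l\<close>. By nesting,
  \<open>Q\<close> pairs \<open>l\<close> with some \<open>b2\<close> between \<open>b\<close> and
  \<open>l\<close>; this \<open>b2\<close> is matched in \<open>P\<close>, hence with
  \<open>l\<close>, although \<open>l\<close> was still free.\<close>

lemma partial_matching_le_maximal:
  assumes "partial_matching T P" "partial_matching T Q" "\<forall>b l. \<not> matchable T Q b l"
  shows "P \<subseteq> Q"
proof -
  obtain s where s: "s \<in> leaves T - Field Q" using unmatched_leaf_exists[OF assms(2)] by auto
  have sh: "s \<in> half_edges T" "s \<in> darts T" "s \<notin> Field Q" using s by (auto simp: leaves_def half_edges_def)
  interpret contour T s by (rule plane_tree_contour[OF tree sh(2)])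
  note nest = partial_matching_nested[OF assms(2) sh(1,3)]
  have DQ: "buds T \<subseteq> Domain Q" by (rule maximal_matching_buds[OF assms(2,3)])
  have QT: "b \<in> buds T" "l \<in> leaves T" "b \<in> half_edges T" "l \<in> half_edges T" "b \<in> darts T" "l \<in> darts T"
    if "(b, l) \<in> Q" for b l
    using that partial_matching_Field(1)[OF assms(2)] by (auto simp: leaves_def buds_def half_edges_def)
  note inj = partial_matching_inj[OF assms(2)]
  show ?thesis using assms(1)
  proof induct
    case (match P b l)
    have m: "b \<in> buds T" "b \<notin> Field P" "l \<in> leaves T" "l \<notin> Field P"
      "half_edges T \<inter> between T b l \<subseteq> Field P"
      using match(3) by (auto simp: matchable_def)
    have d: "b \<in> darts T" "l \<in> darts T" and h: "l \<in> half_edges T" and ne: "b \<noteq> l"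
      using m(1,3) by (auto simp: buds_def leaves_def half_edges_def)
    have lr: "l \<notin> buds T" "x \<in> buds T \<Longrightarrow> x \<notin> leaves T" for x using m(3) by (auto simp: buds_def leaves_def)
    obtain l' where l': "(b, l') \<in> Q" using m(1) DQ by auto
    \<comment> \<open>By the induction hypothesis \<open>P\<close> is contained in \<open>Q\<close>,
      so a dart matched in both has the same partner in both.\<close>
    have pair: "x \<in> Field P \<Longrightarrow> (x, y) \<in> Q \<Longrightarrow> (x, y) \<in> P"
      "y \<in> Field P \<Longrightarrow> (x, y) \<in> Q \<Longrightarrow> (x, y) \<in> P" for x y
    proof -
      have *: "leaves T \<inter> buds T = {}" by (auto simp: leaves_def buds_def)
      assume q: "(x, y) \<in> Q"
      { assume "x \<in> Field P"
        then obtain z where "(x, z) \<in> P \<or> (z, x) \<in> P" by (auto simp: Field_def)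
        then show "(x, y) \<in> P"
          using q match(2) inj QT * by (metis disjoint_iff subset_iff) }
      { assume "y \<in> Field P"
        then obtain z where "(y, z) \<in> P \<or> (z, y) \<in> P" by (auto simp: Field_def)
        then show "(x, y) \<in> P"
          using q match(2) inj QT * by (metis disjoint_iff subset_iff) }
    qed
    have "l' = l"
    proof (rule ccontr)
      assume "l' \<noteq> l"
      have "l' \<notin> Field P" using pair(2)[OF _ l'] m(2) by (auto simp: Field_def)
      then have nb: "l' \<notin> between T b l" using m(5) QT(4)[OF l'] by auto
      have lt: "pos b < pos l'" using nest l' by blast
      have "l \<noteq> s" using between_to_origin[OF d(1) QT(6)[OF l'] lt] nb by auto
      have "s \<notin> Field P" using sh(3) match(2) by (auto simp: Field_def)
      then have "\<not> pos l < pos b"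
        using origin_between[OF d] \<open>l \<noteq> s\<close> m(5) sh(1) by auto
      then have bl: "pos b < pos l" using ne pos_eq_iff[OF d] by (metis linorder_neqE_nat)
      then have "\<not> pos l' < pos l" using between_pos[OF d bl, of l'] nb lt QT(6)[OF l'] by auto
      then have ll: "pos l < pos l'"
        using \<open>l' \<noteq> l\<close> pos_eq_iff[OF d(2) QT(6)[OF l']] by (metis linorder_neqE_nat)
      then have "l \<in> Field Q" using nest l' h bl by blast
      then obtain b2 where b2: "(b2, l) \<in> Q" using lr QT(1) by (auto simp: Field_def)
      have "pos b < pos b2" using nest l' b2 bl ll by blast
      moreover have "pos b2 < pos l" using nest b2 by blast
      ultimately have "b2 \<in> Field P" using between_pos[OF d bl, of b2] QT[OF b2] m(5) by auto
      from pair(1)[OF this b2] show False using m(4) by (auto simp: Field_def)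
    qed
    then show ?case using l' match(2) by simp
  qed simp
qed

lemma matching_eqI:
  assumes "partial_matching T Q" "\<forall>b l. \<not> matchable T Q b l"
  shows "matching T = Q"
  unfolding matching_def
proof (rule the_equality)
  fix P assume "partial_matching T P \<and> (\<forall>b l. \<not> matchable T P b l)"
  then show "P = Q"
    using partial_matching_le_maximal[of P Q] partial_matching_le_maximal[of Q P] assms by auto
qed (use assms in simp)

lemma matching_maximal: "partial_matching T (matching T)" "\<forall>b l. \<not> matchable T (matching T) b l"
proof -
  let ?S = "{P. partial_matching T P}"
  have "?S \<subseteq> Pow (buds T \<times> leaves T)" using partial_matching_Field(1) by auto
  then have fin: "finite ?S" using finite_half_edges[OF pT] finite_subset by fastforce
  moreover have "{} \<in> ?S" by (auto intro: partial_matching.empty)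
  ultimately obtain Q where Q: "Q \<in> ?S" "\<And>P. P \<in> ?S \<Longrightarrow> Q \<subseteq> P \<Longrightarrow> Q = P"
    using finite_has_maximal[of ?S] by blast
  have "\<not> matchable T Q b l" for b l
  proof
    assume m: "matchable T Q b l"
    then have "insert (b, l) Q \<in> ?S" using Q(1) by (auto intro: partial_matching.match)
    then have "(b, l) \<in> Q" using Q(2)[of "insert (b, l) Q"] by blast
    then show False using m by (auto simp: matchable_def Field_def)
  qed
  then have "matching T = Q" using Q(1) by (intro matching_eqI) auto
  then show "partial_matching T (matching T)" "\<forall>b l. \<not> matchable T (matching T) b l"
    using Q(1) \<open>\<And>l b. \<not> matchable T Q b l\<close> by auto
qed

lemma single_leaves_card: "int (card (single_leaves T)) = total_charge T"
proof -
  note Q = matching_maximal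
  have "buds T \<inter> Field (matching T) = buds T"
    using maximal_matching_buds[OF Q] by (auto simp: Field_def)
  then have "card (buds T) = card (matching T)" using partial_matching_card(2)[OF pT Q(1)] by simp
  moreover have "card (leaves T) = card (leaves T \<inter> Field (matching T)) + card (single_leaves T)"
    unfolding single_leaves_def using finite_half_edges[OF pT] by (subst card_Un_disjoint[symmetric]) (auto intro: arg_cong[of _ _ card])
  ultimately show ?thesis using partial_matching_card(1)[OF pT Q(1)] by (simp add: total_charge_def)
qed

end

section \<open>Fusing matched pairs of a balanced tree\<close>

lemma involution_permutes:
  assumes "\<And>d. f (f d) = d" "\<And>d. d \<notin> S \<Longrightarrow> f d = d"
  shows "f permutes S"
  unfolding permutes_def using assms by metis

text \<open>The closure with an arbitrary set of fused pairs: while no tree edge is cut, the opening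
  of a closure runs through maps \<open>fuse T P\<close> with shrinking \<open>P\<close>.\<close>

definition fuse :: "'a hmap \<Rightarrow> ('a \<times> 'a) set \<Rightarrow> 'a hmap" where
  "fuse T P = T\<lparr>opp := \<lambda>d. if d \<in> Field P then THE d'. (d, d') \<in> P \<or> (d', d) \<in> P else opp T d\<rparr>"

lemma tree_closure_eq_fuse: "tree_closure T = fuse T (matching T)"
  by (simp add: tree_closure_def fuse_def)

lemma fuse_empty [simp]: "fuse T {} = T"
  by (simp add: fuse_def)

lemma fuse_simps [simp]:
  "darts (fuse T P) = darts T" "rot (fuse T P) = rot T" "black (fuse T P) = black T"
  "root_dart (fuse T P) = root_dart T" "vertices (fuse T P) = vertices T"
  by (simp_all add: fuse_def vertices_def)

locale balanced_tree =
  fixes T :: "'a hmap"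
  assumes balanced: "balanced T"
begin

abbreviation "Q \<equiv> matching T"

lemma tree: "plane_tree T" and tc: "total_charge T \<ge> 1"
  and root_single: "root_dart T \<in> leaves T" "root_dart T \<notin> Field Q"
  using balanced by (auto simp: balanced_def single_leaves_def)

lemma plane: "plane_map T" using tree by (simp add: plane_tree_def)

lemma root_half_edge: "root_dart T \<in> half_edges T" "root_dart T \<in> darts T"
  using root_single(1) by (auto simp: leaves_def half_edges_def)

sublocale contour T "root_dart T"
  by (rule plane_tree_contour[OF tree root_half_edge(2)])

lemma Q: "partial_matching T Q" using matching_maximal(1)[OF tree tc] .

lemma Q_dom: "buds T \<subseteq> Domain Q"
  using maximal_matching_buds[OF tree tc] matching_maximal[OF tree tc] by blast

lemma Q_pairD:
  assumes "(b, l) \<in> Q"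
  shows "b \<in> buds T" "l \<in> leaves T" "b \<in> half_edges T" "l \<in> half_edges T" "b \<in> darts T" "l \<in> darts T"
    "b \<in> black T" "l \<notin> black T" "opp T b = b" "opp T l = l" "b \<noteq> l" "pos b < pos l" "pos b < N" "pos l < N"
proof -
  show b: "b \<in> buds T" and l: "l \<in> leaves T" using assms partial_matching_Field(1)[OF Q] by auto
  from b l show "b \<in> half_edges T" "l \<in> half_edges T" "b \<in> darts T" "l \<in> darts T"
    "b \<in> black T" "l \<notin> black T" "opp T b = b" "opp T l = l" "b \<noteq> l"
    by (auto simp: buds_def leaves_def half_edges_def)
  then show "pos b < N" "pos l < N" by simp_all
  show "pos b < pos l" using partial_matching_nested[OF Q root_half_edge(1) root_single(2)] assms by blast
qed

lemma Q_nested: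
  assumes "(b, l) \<in> Q"
  shows "x \<in> half_edges T \<Longrightarrow> pos b < pos x \<Longrightarrow> pos x < pos l \<Longrightarrow> x \<in> Field Q"
    "(b', l') \<in> Q \<Longrightarrow> pos b < pos b' \<Longrightarrow> pos b' < pos l \<Longrightarrow> pos l' < pos l"
    "(b', l') \<in> Q \<Longrightarrow> pos b < pos l' \<Longrightarrow> pos l' < pos l \<Longrightarrow> pos b < pos b'"
  using partial_matching_nested[OF Q root_half_edge(1) root_single(2)] assms by blast+

lemmas Q_inj = partial_matching_inj[OF Q]

lemma finite_Q: "finite Q" using partial_matching_Field(3)[OF Q] .

lemma Q_pos_neq:
  assumes "(b, l) \<in> Q" "(b', l') \<in> Q"
  shows "pos b \<noteq> pos l'" "(b, l) \<noteq> (b', l') \<Longrightarrow> pos b \<noteq> pos b'" "(b, l) \<noteq> (b', l') \<Longrightarrow> pos l \<noteq> pos l'"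
proof -
  note p = Q_pairD[OF assms(1)] Q_pairD[OF assms(2)]
  show "pos b \<noteq> pos l'" using pos_eq_iff[of b l'] p by metis
  show "pos b \<noteq> pos b'" if "(b, l) \<noteq> (b', l')"
    using pos_eq_iff[of b b'] p Q_inj(1)[of b l l'] assms that by metis
  show "pos l \<noteq> pos l'" if "(b, l) \<noteq> (b', l')"
    using pos_eq_iff[of l l'] p Q_inj(2)[of b l b'] assms that by metis
qed

lemma opp_fuse:
  assumes "P \<subseteq> Q"
  shows "(b, l) \<in> P \<Longrightarrow> opp (fuse T P) b = l" "(b, l) \<in> P \<Longrightarrow> opp (fuse T P) l = b"
    "d \<notin> Field P \<Longrightarrow> opp (fuse T P) d = opp T d"
proof -
  show "d \<notin> Field P \<Longrightarrow> opp (fuse T P) d = opp T d" by (simp add: fuse_def)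
  assume bl: "(b, l) \<in> P"
  then have q: "(b, l) \<in> Q" using assms by auto
  have bl': "b \<in> black T" "l \<notin> black T" using Q_pairD[OF q] by auto
  have "(THE d'. (b, d') \<in> P \<or> (d', b) \<in> P) = l"
  proof (rule the_equality)
    fix d' assume d': "(b, d') \<in> P \<or> (d', b) \<in> P"
    have "(d', b) \<notin> Q" using Q_pairD(8) bl' by blast
    then show "d' = l" using d' q assms Q_inj(1) by blast
  qed (use bl in simp)
  then show "opp (fuse T P) b = l" using bl by (auto simp: fuse_def Field_def)
  have "(THE d'. (l, d') \<in> P \<or> (d', l) \<in> P) = b"
  proof (rule the_equality)
    fix d' assume d': "(l, d') \<in> P \<or> (d', l) \<in> P"
    have "(l, d') \<notin> Q" using Q_pairD(7) bl' by blast
    then show "d' = b" using d' q assms Q_inj(2) by blast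
  qed (use bl in simp)
  then show "opp (fuse T P) l = b" using bl by (auto simp: fuse_def Field_def)
qed

lemma Field_cases:
  assumes "d \<in> Field P"
  obtains l where "(d, l) \<in> P" | b where "(b, d) \<in> P"
  using assms by (auto simp: Field_def)

lemma Field_pair:
  assumes P: "P \<subseteq> Q" and bl: "(b, l) \<in> Q"
  shows "b \<in> Field P \<Longrightarrow> (b, l) \<in> P" "l \<in> Field P \<Longrightarrow> (b, l) \<in> P"
proof -
  have n: "(d, b) \<notin> Q" "(l, d) \<notin> Q" for d using Q_pairD(7,8) bl by blast+
  show "(b, l) \<in> P" if "b \<in> Field P"
    using that
  proof (cases rule: Field_cases)
    case (1 l')
    then have "l' = l" using Q_inj(1)[OF bl] P by blast
    then show ?thesis using 1 by simp
  qed (use n P in blast)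
  show "(b, l) \<in> P" if "l \<in> Field P"
    using that
  proof (cases rule: Field_cases)
    case (2 b')
    then have "b' = b" using Q_inj(2)[OF bl] P by blast
    then show ?thesis using 2 by simp
  qed (use n P in blast)
qed

lemma opp_fuse_Field:
  assumes "P \<subseteq> Q" "d \<in> Field P"
  shows "opp (fuse T P) d \<noteq> d" "opp (fuse T P) (opp (fuse T P) d) = d" "opp (fuse T P) d \<in> black T \<longleftrightarrow> d \<notin> black T"
    "d \<in> darts T" "opp T d = d"
proof -
  have "\<exists>b l. (b, l) \<in> P \<and> (d = b \<and> opp (fuse T P) d = l \<or> d = l \<and> opp (fuse T P) d = b)"
    using assms(2) by (cases rule: Field_cases) (metis opp_fuse(1,2)[OF assms(1)])+
  then obtain b l where bl: "(b, l) \<in> P"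
    and d: "d = b \<and> opp (fuse T P) d = l \<or> d = l \<and> opp (fuse T P) d = b" by blast
  have "(b, l) \<in> Q" using bl assms(1) by auto
  note p = Q_pairD[OF this] and o = opp_fuse(1,2)[OF assms(1) bl]
  show "opp (fuse T P) d \<noteq> d" "opp (fuse T P) (opp (fuse T P) d) = d" "opp (fuse T P) d \<in> black T \<longleftrightarrow> d \<notin> black T"
    "d \<in> darts T" "opp T d = d"
    using d p o by auto
qed

lemma premap_fuse: assumes P: "P \<subseteq> Q" shows "premap (fuse T P)"
proof -
  have inv: "opp (fuse T P) (opp (fuse T P) d) = d" for d
  proof (cases "d \<in> Field P")
    case False
    have "opp T d \<notin> Field P" using False premapD(4)[OF pT, of d] opp_fuse_Field(5)[OF P] by metis
    then show ?thesis using False opp_fuse(3)[OF P] premapD(4)[OF pT] by auto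
  qed (use opp_fuse_Field[OF P] in auto)
  moreover have "opp (fuse T P) permutes darts T"
    using inv
  proof (rule involution_permutes)
    fix d assume "d \<notin> darts T"
    moreover from this have "d \<notin> Field P" using opp_fuse_Field(4)[OF P] by blast
    ultimately show "opp (fuse T P) d = d" using opp_fuse(3)[OF P] opp_outside[OF pT] by metis
  qed
  moreover have "opp (fuse T P) d \<noteq> d \<longrightarrow> (opp (fuse T P) d \<in> black T \<longleftrightarrow> d \<notin> black T)" for d
    using opp_fuse_Field(3)[OF P, of d] opp_fuse(3)[OF P, of d] opp_black[OF pT, of d] by (cases "d \<in> Field P") auto
  ultimately show ?thesis using pT unfolding premap_def fuse_simps by blast
qed

lemma half_edges_fuse: assumes P: "P \<subseteq> Q" shows "half_edges (fuse T P) = half_edges T - Field P"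
proof -
  have "opp (fuse T P) d = d \<longleftrightarrow> opp T d = d \<and> d \<notin> Field P" for d
    using opp_fuse_Field(1)[OF P] opp_fuse(3)[OF P] by (cases "d \<in> Field P") auto
  then show ?thesis unfolding half_edges_def by auto
qed

lemma cut_edge_fuse:
  assumes P: "P \<subseteq> Q" and bl: "(b, l) \<in> P"
  shows "cut_edge (fuse T P) b = fuse T (P - {(b, l)})"
proof -
  let ?P = "P - {(b, l)}"
  have P': "?P \<subseteq> Q" using P by auto
  have q: "(b, l) \<in> Q" using assms by auto
  have nF: "b \<notin> Field ?P" "l \<notin> Field ?P"
    using Q_inj q P Q_pairD[OF q] Q_pairD(7,8) unfolding Field_def by blast+
  have "((opp (fuse T P))(b := b, l := l)) d = opp (fuse T ?P) d" for d
  proof -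
    consider "d = b" | "d = l" | "d \<noteq> b" "d \<noteq> l" "d \<in> Field P" | "d \<noteq> b" "d \<noteq> l" "d \<notin> Field P" by blast
    then show ?thesis
    proof cases
      case 1
      then show ?thesis using nF(1) opp_fuse(3)[OF P'] Q_pairD[OF q] by auto
    next
      case 2
      then show ?thesis using nF(2) opp_fuse(3)[OF P'] Q_pairD[OF q] by auto
    next
      case 3
      from 3(3) show ?thesis
        by (cases rule: Field_cases) (use 3 opp_fuse(1,2)[OF P] opp_fuse(1,2)[OF P'] in auto)
    next
      case 4
      then have "d \<notin> Field ?P" by (auto simp: Field_def)
      then show ?thesis using 4 opp_fuse(3)[OF P] opp_fuse(3)[OF P'] by auto
    qed
  qed
  then have "(opp (fuse T P))(b := b, l := l) = opp (fuse T ?P)" by (rule ext)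
  then show ?thesis
    using opp_fuse(1)[OF P bl] unfolding cut_edge_def by (simp add: fuse_def)
qed

lemma fuse_conn:
  assumes "P \<subseteq> Q" "(x, y) \<in> dart_conn T"
  shows "(x, y) \<in> dart_conn (fuse T P)"
proof -
  have "y \<in> {y. (x, y) \<in> dart_conn (fuse T P)}" using assms(2)
  proof (rule dart_conn_closed)
    fix z assume z: "z \<in> {y. (x, y) \<in> dart_conn (fuse T P)}" "z \<in> darts T"
    show "rot T z \<in> {y. (x, y) \<in> dart_conn (fuse T P)}"
      using z dart_conn_rot[of x z "fuse T P"] by simp
    show "opp T z \<in> {y. (x, y) \<in> dart_conn (fuse T P)}"
      using z dart_conn_opp[of x z "fuse T P"] opp_fuse(3)[OF assms(1), of z] opp_fuse_Field(5)[OF assms(1), of z]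
      by (cases "z \<in> Field P") auto
  qed simp
  then show ?thesis by simp
qed

lemma connected_fuse: "P \<subseteq> Q \<Longrightarrow> connected_map (fuse T P)"
  using plane fuse_conn by (auto simp: connected_map_def plane_map_def)

text \<open>At a fused bud the walk jumps over everything its pair encloses; at a fused leaf it goes
  back to the inner side of the pair.\<close>

lemma next_fuse:
  assumes "P \<subseteq> Q"
  shows "(b, l) \<in> P \<Longrightarrow> next_dart (fuse T P) b = D (Suc (pos l))"
    "(b, l) \<in> P \<Longrightarrow> next_dart (fuse T P) l = D (Suc (pos b))"
    "D x \<notin> Field P \<Longrightarrow> next_dart (fuse T P) (D x) = D (Suc x)"
proof -
  have n: "rot T d = D (Suc (pos d))" if "d \<in> darts T" "opp T d = d" for d
    using next_D[of "pos d"] that by (simp add: next_dart_def)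
  show "next_dart (fuse T P) b = D (Suc (pos l))" if "(b, l) \<in> P"
    using n[of l] Q_pairD[of b l] that assms opp_fuse(1)[OF assms that] by (auto simp: next_dart_def)
  show "next_dart (fuse T P) l = D (Suc (pos b))" if "(b, l) \<in> P"
    using n[of b] Q_pairD[of b l] that assms opp_fuse(2)[OF assms that] by (auto simp: next_dart_def)
  show "next_dart (fuse T P) (D x) = D (Suc x)" if "D x \<notin> Field P"
    using next_D[of x] opp_fuse(3)[OF assms that] by (simp add: next_dart_def)
qed

text \<open>From position \<open>x\<close> the walk moves forward, jumping over whole pairs. The
  first condition on pairs excludes that it meets the leaf of a pair opened before \<open>x\<close>,
  which would send it back; the second one excludes a jump beyond \<open>y\<close>.\<close>

lemma reach_fuse:
  assumes P: "P \<subseteq> Q" and "x \<le> y" "y \<le> N"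
    "\<And>i j. (i, j) \<in> P \<Longrightarrow> pos i < x \<Longrightarrow> x \<le> pos j \<Longrightarrow> pos j < y \<Longrightarrow> False"
    "\<And>i j. (i, j) \<in> P \<Longrightarrow> x \<le> pos i \<Longrightarrow> pos i < y \<Longrightarrow> pos j < y"
  shows "D y \<in> orbit (next_dart (fuse T P)) (D x)"
  using assms(2-)
proof (induction "y - x" arbitrary: x rule: less_induct)
  case less
  let ?f = "next_dart (fuse T P)"
  note self = self_in_orbit_next[OF premap_fuse[OF P]]
  show ?case
  proof (cases "x = y")
    case True
    then show ?thesis using self by simp
  next
    case False
    then have xy: "x < y" "x < N" using less.prems by auto
    have IH: "D y \<in> orbit ?f (D x)" if "?f (D x) = D x'" "x < x'" "x' \<le> y"
      "\<And>i j. (i, j) \<in> P \<Longrightarrow> pos i < x' \<Longrightarrow> x' \<le> pos j \<Longrightarrow> pos j < y \<Longrightarrow> False" for x'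
    proof -
      have "D y \<in> orbit ?f (D x')"
      proof (rule less.hyps)
        show "y - x' < y - x" using that xy by auto
        show "pos j < y" if "(i, j) \<in> P" "x' \<le> pos i" "pos i < y" for i j
          using less.prems(4)[OF that(1)] that \<open>x < x'\<close> by auto
      qed (use that less.prems in auto)
      then show ?thesis
        using permutation_orbit_step[OF premapD(9)[OF premap_fuse[OF P]], of "D x"] that(1) by simp
    qed
    show ?thesis
    proof (cases "D x \<in> Field P")
      case True
      then show ?thesis
      proof (cases rule: Field_cases)
        case (1 l)
        have q: "(D x, l) \<in> Q" using 1 P by auto
        have pl: "pos l < y" using less.prems(4)[OF 1] xy by simp
        show ?thesis
        proof (rule IH[OF next_fuse(1)[OF P 1]])
          show "x < Suc (pos l)" using Q_pairD(12)[OF q] xy by simp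
          show "Suc (pos l) \<le> y" using pl by simp
          fix i j assume ij: "(i, j) \<in> P" "pos i < Suc (pos l)" "Suc (pos l) \<le> pos j" "pos j < y"
          then have q': "(i, j) \<in> Q" using P by auto
          have "pos i < pos l" using Q_pos_neq(1)[OF q' q] ij by simp
          then have "pos i < x" using Q_nested(3)[OF q' q] ij xy by simp
          then show False using less.prems(3)[OF ij(1)] ij pl Q_pairD(12)[OF q] xy by simp
        qed
      next
        case (2 b)
        then have "(b, D x) \<in> Q" using P by auto
        then have "pos b < x" using Q_pairD(12) xy pos_D by metis
        then show ?thesis using less.prems(3)[OF 2] xy by simp
      qed
    next
      case False
      show ?thesis
      proof (rule IH[OF next_fuse(3)[OF P False]])
        fix i j assume ij: "(i, j) \<in> P" "pos i < Suc x" "Suc x \<le> pos j" "pos j < y"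
        then have "i \<in> darts T" "i \<in> Field P" using P Q_pairD(5) by (auto simp: Field_def)
        then have "pos i \<noteq> x" using False D_pos by metis
        then show False using less.prems(3)[OF ij(1)] ij by simp
      qed (use xy in auto)
    qed
  qed
qed

text \<open>Whatever pairs have been fused before, the bud and the leaf of a further pair lie on the
  same face, by the nesting of the pairs. Joining them splits this face and adds an edge.\<close>

lemma euler_fuse:
  assumes "P \<subseteq> Q"
  shows "card (vertices T) + card (faces (fuse T P)) = card (edges (fuse T P)) + 2 \<and>
    card (edges (fuse T P)) = card (edges T) + card P"
  using finite_subset[OF assms finite_Q] assms
proof (induct P rule: finite_induct)
  case empty
  then show ?case using plane by (simp add: plane_map_def)
next
  case (insert p P)
  obtain b l where p: "p = (b, l)" by force
  let ?P = "insert p P"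
  have P: "P \<subseteq> Q" and q: "(b, l) \<in> Q" using insert p by auto
  have c: "cut_edge (fuse T ?P) b = fuse T P"
    using cut_edge_fuse[OF insert(4), of b l] insert(2) by (simp add: p)
  have o: "opp (fuse T ?P) b = l" and ne: "l \<noteq> b"
    using opp_fuse(1)[OF insert(4)] p Q_pairD[OF q] by auto
  note pF = premap_fuse[OF insert(4)]
  have "D (pos l) \<in> orbit (next_dart (fuse T P)) (D (pos b))"
  proof (rule reach_fuse[OF P])
    show "pos b \<le> pos l" "pos l \<le> N" using Q_pairD(12,14)[OF q] by auto
    fix i j assume ij: "(i, j) \<in> P"
    then have q': "(i, j) \<in> Q" "(i, j) \<noteq> (b, l)" using P insert(2) p by auto
    show False if "pos i < pos b" "pos b \<le> pos j" "pos j < pos l"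
      using Q_nested(2)[OF q'(1) q] Q_pos_neq(1)[OF q q'(1)] that by simp
    show "pos j < pos l" if "pos b \<le> pos i" "pos i < pos l"
      using Q_nested(2)[OF q q'(1)] Q_pos_neq(2)[OF q q'(1)] q' that by auto
  qed
  then have l: "l \<in> orbit (next_dart (cut_edge (fuse T ?P) b)) b"
    using Q_pairD(5,6)[OF q] by (simp add: c)
  \<comment> \<open>Fusing reverses cutting, so two darts on one face before the fusion are on
    different faces after it.\<close>
  have "l \<notin> orbit (next_dart (fuse T ?P)) b"
    using orbit_fun_swap_split[OF premapD(9)[OF pF], of l b] l ne
    unfolding next_dart_cut_edge[OF pF o ne] by auto
  note f = card_faces_cut_edge_merge[OF pF o ne this] and e = card_edges_cut_edge[OF pF o ne]
  show ?case using insert(1,2) insert(3)[OF P] f e unfolding c by simp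
qed

text \<open>The closedness condition keeps the unfused half-edges in the infinite face: one enclosed
  by a fused pair would belong to an unfused pair nested inside it.\<close>

lemma plane_map_fuse:
  assumes P: "P \<subseteq> Q"
    and closed: "\<And>b l b' l'. (b, l) \<in> P \<Longrightarrow> (b', l') \<in> Q \<Longrightarrow> pos b < pos b' \<Longrightarrow> pos b' < pos l \<Longrightarrow> (b', l') \<in> P"
  shows "plane_map (fuse T P)"
proof -
  have "h \<in> orbit (next_dart (fuse T P)) (root_dart T)" if h: "h \<in> half_edges T" "h \<notin> Field P" for h
  proof -
    have hd: "h \<in> darts T" using h by (simp add: half_edges_def)
    have "D N \<in> orbit (next_dart (fuse T P)) (D (pos h))"
    proof (rule reach_fuse[OF P])
      show "pos h \<le> N" "N \<le> N" using hd by (auto simp: less_imp_le)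
      fix i j assume ij: "(i, j) \<in> P"
      then have q: "(i, j) \<in> Q" using P by auto
      show "pos j < N" using Q_pairD(14)[OF q] .
      assume a: "pos i < pos h" "pos h \<le> pos j"
      have "h \<noteq> j" using ij h(2) by (auto simp: Field_def)
      then have lt: "pos h < pos j" using a pos_eq_iff[OF hd Q_pairD(6)[OF q]] by simp
      then have "h \<in> Field Q" using Q_nested(1)[OF q h(1)] a by simp
      then show False
      proof (cases rule: Field_cases)
        case (1 l')
        from closed[OF ij 1 a(1) lt] show False using h(2) by (auto simp: Field_def)
      next
        case (2 b')
        have "pos i < pos b'" using Q_nested(3)[OF q 2] a lt by simp
        moreover have "pos b' < pos j" using Q_pairD(12)[OF 2] lt by simp
        ultimately show False using closed[OF ij 2] h(2) by (auto simp: Field_def)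
      qed
    qed
    then have "root_dart T \<in> orbit (next_dart (fuse T P)) h" using hd by simp
    from orbit_next_eq[OF premap_fuse[OF P] this] show ?thesis
      using self_in_orbit_next[OF premap_fuse[OF P], of h] by simp
  qed
  moreover have "root_dart T \<notin> Field P" using root_single(2) P by (auto simp: Field_def)
  ultimately show ?thesis
    unfolding plane_map_iff
    using premap_fuse[OF P] connected_fuse[OF P] euler_fuse[OF P] half_edges_fuse[OF P] root_half_edge
    by auto
qed

text \<open>By Euler's formula each fused pair accounts for one face more than the tree has.\<close>

lemma plane_tree_fuse_iff:
  assumes "P \<subseteq> Q" "plane_tree (fuse T P)"
  shows "P = {}"
proof -
  have "card (faces (fuse T P)) = 1" using assms by (simp add: plane_tree_def)
  moreover have "card (faces T) = 1" using tree by (simp add: plane_tree_def)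
  moreover have "card (vertices T) + card (faces T) = card (edges T) + 2" using plane by (simp add: plane_map_def)
  ultimately have "card P = 0" using euler_fuse[OF assms(1)] by linarith
  then show ?thesis using finite_subset[OF assms(1) finite_Q] by simp
qed

lemma closure_leg_map: "leg_map (nat (total_charge T)) (tree_closure T)"
proof -
  have 1: "plane_map (fuse T Q)" by (rule plane_map_fuse[OF subset_refl])
  have l: "leaves (fuse T Q) = single_leaves T"
    using half_edges_fuse[OF subset_refl] by (auto simp: leaves_def single_leaves_def)
  have "buds T \<subseteq> Field Q" using Q_dom unfolding Field_def by blast
  then have b: "buds (fuse T Q) = {}"
    using half_edges_fuse[OF subset_refl] by (auto simp: buds_def)
  have "card (single_leaves T) = nat (total_charge T)" using single_leaves_card[OF tree tc] by simp
  moreover have "root_dart T \<in> single_leaves T" using root_single by (simp add: single_leaves_def)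
  ultimately show ?thesis
    using 1 l b unfolding leg_map_def tree_closure_eq_fuse by simp
qed

section \<open>The opening of the closure\<close>

text \<open>
  \<open>h x\<close> is the number of matched pairs enclosing position \<open>x\<close>; a leaf counts as enclosed by its
  own pair, a bud does not. The walk goes around the infinite face in rounds, and round \<open>r\<close> visits
  exactly the positions with \<open>h x \<le> r\<close> and cuts exactly the pairs whose bud has \<open>h = r\<close>.
\<close>

definition h :: "nat \<Rightarrow> nat" where
  "h x = card {(i, j) \<in> Q. pos i < x \<and> x \<le> pos j}"

text \<open>The pairs still fused when the walk stands at position \<open>x\<close> in its round
  \<open>r\<close>. The bud at \<open>x\<close> itself has not been traversed yet, hence
  \<open>x \<le> pos i\<close>.\<close>

definition uncut :: "nat \<Rightarrow> nat \<Rightarrow> ('a \<times> 'a) set" where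
  "uncut r x = {(i, j) \<in> Q. r < h (pos i) \<or> r = h (pos i) \<and> x \<le> pos i}"

lemma uncut_subset: "uncut r x \<subseteq> Q" by (auto simp: uncut_def)

lemma finite_enclosing: "finite {(i, j) \<in> Q. pos i < x \<and> x \<le> pos j}"
  by (rule finite_subset[OF _ finite_Q]) auto

lemma h_0 [simp]: "h 0 = 0" by (simp add: h_def)

text \<open>By nesting, every pair around the bud also encloses whatever lies inside its pair; the
  pair itself comes on top and makes the inequality strict.\<close>

lemma h_enclosed:
  assumes "(b, l) \<in> Q" "pos b < x" "x \<le> pos l"
  shows "h (pos b) < h x"
  unfolding h_def
proof (rule psubset_card_mono[OF finite_enclosing psubsetI])
  show "{(i, j) \<in> Q. pos i < pos b \<and> pos b \<le> pos j} \<subseteq> {(i, j) \<in> Q. pos i < x \<and> x \<le> pos j}"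
  proof clarify
    fix i j assume ij: "(i, j) \<in> Q" "pos i < pos b" "pos b \<le> pos j"
    have "pos b < pos j" using Q_pos_neq(1)[OF assms(1) ij(1)] ij by simp
    from Q_nested(2)[OF ij(1) assms(1) ij(2) this] show "pos i < x \<and> x \<le> pos j" using ij assms by simp
  qed
  have "(b, l) \<in> {(i, j) \<in> Q. pos i < x \<and> x \<le> pos j}" "(b, l) \<notin> {(i, j) \<in> Q. pos i < pos b \<and> pos b \<le> pos j}"
    using assms by auto
  then show "{(i, j) \<in> Q. pos i < pos b \<and> pos b \<le> pos j} \<noteq> {(i, j) \<in> Q. pos i < x \<and> x \<le> pos j}" by blast
qed

lemma h_Suc_unmatched:
  assumes "x < N" "D x \<notin> Field Q" shows "h (Suc x) = h x"
proof -
  have "pos i \<noteq> x" "pos j \<noteq> x" if "(i, j) \<in> Q" for i j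
    using that assms(2) Q_pairD(5,6)[OF that] D_pos by (auto simp: Field_def)
  then have "{(i, j) \<in> Q. pos i < Suc x \<and> Suc x \<le> pos j} = {(i, j) \<in> Q. pos i < x \<and> x \<le> pos j}"
    by (fastforce simp: less_Suc_eq Suc_le_eq order_le_less)
  then show ?thesis by (simp add: h_def)
qed

lemma h_Suc_bud:
  assumes "(b, l) \<in> Q" shows "h (Suc (pos b)) \<le> Suc (h (pos b))"
proof -
  have "{(i, j) \<in> Q. pos i < Suc (pos b) \<and> Suc (pos b) \<le> pos j} \<subseteq>
      insert (b, l) {(i, j) \<in> Q. pos i < pos b \<and> pos b \<le> pos j}"
    using Q_pos_neq(2)[OF assms] by (fastforce simp: less_Suc_eq)
  then have "h (Suc (pos b)) \<le> card (insert (b, l) {(i, j) \<in> Q. pos i < pos b \<and> pos b \<le> pos j})"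
    unfolding h_def by (rule card_mono[OF finite.insertI[OF finite_enclosing]])
  also have "\<dots> \<le> Suc (h (pos b))" unfolding h_def using finite_enclosing by (simp add: card_insert_if)
  finally show ?thesis .
qed

lemma h_Suc_leaf:
  assumes "(b, l) \<in> Q" shows "h (Suc (pos l)) \<le> h (pos b)"
  unfolding h_def
proof (rule card_mono[OF finite_enclosing], clarify)
  fix i j assume ij: "(i, j) \<in> Q" "pos i < Suc (pos l)" "Suc (pos l) \<le> pos j"
  have "pos i < pos l" using Q_pos_neq(1)[OF ij(1) assms] ij by simp
  from Q_nested(3)[OF ij(1) assms this] show "pos i < pos b \<and> pos b \<le> pos j"
    using ij Q_pairD(12)[OF assms] by simp
qed

lemma uncut_Suc_eq:
  assumes "x < N" "\<And>l. (D x, l) \<in> Q \<Longrightarrow> h x \<noteq> r"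
  shows "uncut r (Suc x) = uncut r x"
proof -
  have "pos i \<noteq> x" if "(i, j) \<in> Q" "h (pos i) = r" for i j
    using assms(2)[of j] that Q_pairD(5)[OF that(1)] by auto
  then show ?thesis unfolding uncut_def by (fastforce simp: Suc_le_eq order_le_less)
qed

text \<open>At the end of a round no bud of depth \<open>r\<close> lies ahead, so the state agrees
  with the start of the next round.\<close>

lemma uncut_N: "uncut r N = uncut (Suc r) 0"
proof -
  have "\<not> N \<le> pos i" if "(i, j) \<in> Q" for i j using Q_pairD(13)[OF that] by simp
  then show ?thesis by (auto simp: uncut_def)
qed

text \<open>One loop step, provided that it cuts no edge of \<open>T\<close>. At a bud of depth
  \<open>r\<close> the pair is cut, but the next dart is taken before the cut, so the walk still
  jumps behind the leaf; the skipped positions are deeper than \<open>r\<close> and await later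
  rounds. At every other visited dart the walk advances by one position.\<close>

lemma walk_step:
  assumes x: "x < N" "h x \<le> r"
  defines "M \<equiv> fuse T (uncut r x)"
  assumes nc: "D x \<notin> Field Q \<Longrightarrow> \<not> cuttable M (D x)"
  obtains x' where "x < x'" "x' \<le> N" "h x' \<le> r" "\<And>y. x < y \<Longrightarrow> y < x' \<Longrightarrow> r < h y"
    "(if cuttable M (D x) then cut_edge M (D x) else M) = fuse T (uncut r x')"
    "next_dart M (D x) = D x'"
proof -
  note US = uncut_subset[of r x]
  have half: "\<not> cuttable M (D x)" if "D x \<in> Field Q" "D x \<notin> Field (uncut r x)"
    using opp_fuse(3)[OF US that(2)] opp_fuse_Field(5)[OF subset_refl that(1)] by (simp add: cuttable_def M_def)
  consider l where "(D x, l) \<in> uncut r x" | l where "(D x, l) \<in> Q" "(D x, l) \<notin> uncut r x"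
    | b where "(b, D x) \<in> Q" | "D x \<notin> Field Q"
    by (auto simp: Field_def)
  then show ?thesis
  proof cases
    case (1 l)
    have q: "(D x, l) \<in> Q" using 1 US by auto
    have hx: "h x = r" using 1 x by (auto simp: uncut_def)
    have c: "cut_edge M (D x) = fuse T (uncut r x - {(D x, l)})"
      unfolding M_def by (rule cut_edge_fuse[OF US 1])
    have sub: "uncut r x - {(D x, l)} \<subseteq> Q" using US by auto
    \<comment> \<open>Removing a pair leaves another partially fused tree, which is connected, so
      the pair does not separate.\<close>
    have cut: "cuttable M (D x)"
      unfolding cuttable_def separating_def c
      using opp_fuse(1)[OF US 1] Q_pairD[OF q] connected_fuse[OF sub] by (auto simp: M_def)
    have lt: "x < pos l" using Q_pairD(12)[OF q] x by simp
    \<comment> \<open>Everything inside the pair is deeper, so no other bud of depth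
      \<open>r\<close> is skipped.\<close>
    have enc: "r < h y" if "x < y" "y < Suc (pos l)" for y
      using h_enclosed[OF q, of y] that x hx by simp
    have "uncut r x - {(D x, l)} = uncut r (Suc (pos l))"
    proof -
      have "(i, j) \<in> uncut r x - {(D x, l)} \<longleftrightarrow> (i, j) \<in> uncut r (Suc (pos l))" for i j
      proof (cases "(i, j) \<in> Q \<and> h (pos i) = r")
        case False
        moreover have "(i, j) \<noteq> (D x, l)" using False hx x(1) q by auto
        ultimately show ?thesis by (auto simp: uncut_def)
      next
        case True
        have "x \<le> pos i \<and> (i, j) \<noteq> (D x, l) \<longleftrightarrow> Suc (pos l) \<le> pos i"
        proof
          assume a: "x \<le> pos i \<and> (i, j) \<noteq> (D x, l)"
          then have "pos i \<noteq> x" using Q_pos_neq(2)[of i j "D x" l] True q x by auto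
          then have "x < pos i" using a by simp
          then show "Suc (pos l) \<le> pos i" using enc[of "pos i"] True by (auto simp flip: not_less)
        next
          assume a: "Suc (pos l) \<le> pos i"
          then have "pos i \<noteq> pos (D x)" using lt x(1) by simp
          then show "x \<le> pos i \<and> (i, j) \<noteq> (D x, l)" using a lt by auto
        qed
        then show ?thesis using True by (auto simp: uncut_def)
      qed
      then show ?thesis by auto
    qed
    then have "(if cuttable M (D x) then cut_edge M (D x) else M) = fuse T (uncut r (Suc (pos l)))"
      using cut c by simp
    moreover have "next_dart M (D x) = D (Suc (pos l))" unfolding M_def by (rule next_fuse(1)[OF US 1])
    moreover have "h (Suc (pos l)) \<le> r" using h_Suc_leaf[OF q] x hx by simp
    ultimately show ?thesis using that[of "Suc (pos l)"] lt enc Q_pairD(14)[OF q] by simp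
  next
    case (2 l)
    have hx: "h x < r" using 2 x by (auto simp: uncut_def)
    have nF: "D x \<notin> Field (uncut r x)"
      using Field_pair(1)[OF US 2(1)] 2(2) by blast
    have "uncut r (Suc x) = uncut r x" by (rule uncut_Suc_eq) (use hx x in auto)
    moreover have "\<not> cuttable M (D x)" using 2(1) by (intro half nF) (auto simp: Field_def)
    moreover have "h (Suc x) \<le> r" using h_Suc_bud[OF 2(1)] hx x by simp
    moreover have "next_dart M (D x) = D (Suc x)" unfolding M_def by (rule next_fuse(3)[OF US nF])
    ultimately show ?thesis using that[of "Suc x"] x by (auto simp: M_def)
  next
    case (3 b)
    \<comment> \<open>A visited leaf has depth at most \<open>r\<close> and its bud less, so the
      pair was cut in an earlier round.\<close>
    have hb: "h (pos b) < h x" using h_enclosed[OF 3, of x] Q_pairD(12)[OF 3] x by simp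
    have nb: "(D x, l) \<notin> Q" for l using Q_pairD(8)[OF 3] Q_pairD(7) by blast
    have "(b, D x) \<notin> uncut r x" using hb x by (auto simp: uncut_def)
    then have nF: "D x \<notin> Field (uncut r x)"
      using Field_pair(2)[OF US 3] by blast
    have "uncut r (Suc x) = uncut r x" by (rule uncut_Suc_eq) (use nb x in auto)
    moreover have "\<not> cuttable M (D x)" using 3 by (intro half nF) (auto simp: Field_def)
    moreover have "h (Suc x) \<le> r" using h_Suc_leaf[OF 3] hb x by simp
    moreover have "next_dart M (D x) = D (Suc x)" unfolding M_def by (rule next_fuse(3)[OF US nF])
    ultimately show ?thesis using that[of "Suc x"] x by (auto simp: M_def)
  next
    case 4
    have nF: "D x \<notin> Field (uncut r x)" using 4 US by (auto simp: Field_def)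
    have "uncut r (Suc x) = uncut r x" by (rule uncut_Suc_eq) (use 4 x in \<open>auto simp: Field_def\<close>)
    moreover have "h (Suc x) \<le> r" using h_Suc_unmatched[OF x(1) 4] x by simp
    moreover have "next_dart M (D x) = D (Suc x)" unfolding M_def by (rule next_fuse(3)[OF US nF])
    ultimately show ?thesis using that[of "Suc x"] nc[OF 4] x by (auto simp: M_def)
  qed
qed

section \<open>Survival of tree edges\<close>

definition tree_dart :: "nat \<Rightarrow> bool" where
  "tree_dart y \<longleftrightarrow> y < N \<and> D y \<in> black T \<and> opp T (D y) \<noteq> D y"

text \<open>The tree edge traversed from \<open>D y\<close> is not cut when the walk visits \<open>D y\<close> for the first time.\<close>

definition survives :: "nat \<Rightarrow> bool" where
  "survives y \<longleftrightarrow> separating (fuse T (uncut (h y) y)) (D y)"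

text \<open>Fused pairs only add connections, and a tree edge is never one of them, so cutting it
  disturbs none of the pairs.\<close>

lemma cut_fuse_conn_mono:
  assumes P: "P \<subseteq> P'" "P' \<subseteq> Q" and d: "opp T d \<noteq> d"
    and c: "(x, y) \<in> dart_conn (cut_edge (fuse T P) d)"
  shows "(x, y) \<in> dart_conn (cut_edge (fuse T P') d)"
proof -
  have PQ: "P \<subseteq> Q" using P by auto
  have nF: "d \<notin> Field P'" "d \<notin> Field P" "opp T d \<notin> Field P'" "opp T d \<notin> Field P"
    using opp_fuse_Field(5)[OF P(2)] opp_fuse_Field(5)[OF PQ] d premapD(4)[OF pT, of d] by metis+
  define w where "w = opp T d"
  have w: "opp (fuse T P) d = w" "opp (fuse T P') d = w" and ne: "w \<noteq> d"
    using nF opp_fuse(3)[OF P(2)] opp_fuse(3)[OF PQ] d by (auto simp: w_def)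
  note pF = premap_fuse[OF PQ] premap_fuse[OF P(2)]
  note cs = cut_edge_simps[OF pF(1) w(1) ne] cut_edge_simps[OF pF(2) w(2) ne]
  have "y \<in> {y. (x, y) \<in> dart_conn (cut_edge (fuse T P') d)}" using c
  proof (rule dart_conn_closed)
    fix z assume z: "z \<in> {y. (x, y) \<in> dart_conn (cut_edge (fuse T P') d)}"
      "z \<in> darts (cut_edge (fuse T P) d)"
    have zD: "z \<in> darts (cut_edge (fuse T P') d)" using z cs by simp
    show "rot (cut_edge (fuse T P) d) z \<in> {y. (x, y) \<in> dart_conn (cut_edge (fuse T P') d)}"
      using dart_conn_rot[OF _ zD] z cs by simp
    have "opp (cut_edge (fuse T P) d) z = opp (cut_edge (fuse T P') d) z \<or> opp (cut_edge (fuse T P) d) z = z"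
    proof (cases "z \<in> Field P")
      case True
      then have "opp (fuse T P) z = opp (fuse T P') z"
        by (cases rule: Field_cases) (metis P(1) opp_fuse(1,2)[OF PQ] opp_fuse(1,2)[OF P(2)] subsetD)+
      then show ?thesis unfolding cs by simp
    next
      case False
      then have "opp (fuse T P) z = opp T z" by (rule opp_fuse(3)[OF PQ])
      moreover have "opp (fuse T P') z = opp T z \<or> opp T z = z"
        using opp_fuse(3)[OF P(2)] opp_fuse_Field(5)[OF P(2)] by (cases "z \<in> Field P'") auto
      ultimately show ?thesis unfolding cs by auto
    qed
    then show "opp (cut_edge (fuse T P) d) z \<in> {y. (x, y) \<in> dart_conn (cut_edge (fuse T P') d)}"
      using dart_conn_opp[OF _ zD] z by auto
  qed simp
  then show ?thesis by simp
qed

lemma separating_antimono: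
  assumes "P \<subseteq> P'" "P' \<subseteq> Q" "opp T d \<noteq> d" "separating (fuse T P') d"
  shows "separating (fuse T P) d"
  using cut_fuse_conn_mono[OF assms(1-3)] assms(4)
  unfolding separating_def connected_map_def by (auto simp: cut_edge_def)

lemma uncut_antimono:
  assumes "r < r' \<or> r = r' \<and> x \<le> x'"
  shows "uncut r' x' \<subseteq> uncut r x"
  using assms by (auto simp: uncut_def)

text \<open>Later rounds have fewer fused pairs and hence fewer detours, so an edge that separates
  at its first visit separates at every later one.\<close>

lemma survives_later:
  assumes "tree_dart y" "survives y" "h y \<le> r"
  shows "separating (fuse T (uncut r y)) (D y)"
proof (rule separating_antimono)
  show "uncut r y \<subseteq> uncut (h y) y" using assms(3) by (intro uncut_antimono) auto
qed (use assms uncut_subset in \<open>auto simp: survives_def tree_dart_def\<close>)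

lemma cut_edge_fixed: "opp M y = y \<Longrightarrow> opp (cut_edge M d) y = y"
  by (auto simp: cut_edge_def)

text \<open>While no tree edge has been cut (\<open>I1\<close>), the state is given by a round and a
  position, and every tree dart visited so far survives. Once a tree edge has been cut
  (\<open>I2\<close>), it remains cut to the end, so the result is not \<open>T\<close>; and by
  \<open>survives_later\<close> the edge did not separate at its first visit either.\<close>

theorem opening_closure_iff:
  "map_opening (tree_closure T) = T \<longleftrightarrow> (\<forall>y. tree_dart y \<longrightarrow> survives y)"
proof -
  let ?all = "\<forall>y. tree_dart y \<longrightarrow> survives y"
  define I1 where "I1 M d \<longleftrightarrow> (\<exists>r x. x < N \<and> h x \<le> r \<and> M = fuse T (uncut r x) \<and> d = D x \<and>
    (\<forall>y. tree_dart y \<longrightarrow> h y < r \<or> h y = r \<and> y < x \<longrightarrow> survives y))" for M :: "'a hmap" and d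
  define I2 where "I2 M \<longleftrightarrow> \<not> ?all \<and> (\<exists>y. opp T y \<noteq> y \<and> opp M y = y)" for M :: "'a hmap"
  have "uncut 0 0 = Q" by (auto simp: uncut_def)
  then have init: "I1 (tree_closure T) (root_dart (tree_closure T))"
    unfolding I1_def by (intro exI[of _ 0]) (auto simp: tree_closure_eq_fuse)
  have "plane_map (tree_closure T)" using closure_leg_map by (simp add: leg_map_def)
  then have "plane_tree (map_opening (tree_closure T)) \<and>
    (\<exists>d. I1 (map_opening (tree_closure T)) d \<or> I2 (map_opening (tree_closure T)))"
  proof (rule map_opening_rule)
    show "I1 (tree_closure T) (root_dart (tree_closure T)) \<or> I2 (tree_closure T)" using init by simp
    fix M d assume "I1 M d \<or> I2 M"
    then show "I1 (if cuttable M d then cut_edge M d else M) (next_dart M d) \<or>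
      I2 (if cuttable M d then cut_edge M d else M)"
    proof
      assume "I2 M"
      then have "I2 (if cuttable M d then cut_edge M d else M)"
        unfolding I2_def using cut_edge_fixed[of M _ d] by auto
      then show ?thesis by simp
    next
      assume "I1 M d"
      then obtain r x where x: "x < N" "h x \<le> r" and M: "M = fuse T (uncut r x)" and d: "d = D x"
        and s: "\<And>y. tree_dart y \<Longrightarrow> h y < r \<or> h y = r \<and> y < x \<Longrightarrow> survives y"
        by (auto simp: I1_def)
      show ?thesis
      proof (cases "D x \<notin> Field Q \<and> cuttable M d")
        case True
        then have nF: "D x \<notin> Field (uncut r x)" using uncut_subset[of r x] by (auto simp: Field_def)
        have c: "D x \<in> black T" "opp T (D x) \<noteq> D x" "\<not> separating M (D x)"
          using True opp_fuse(3)[OF uncut_subset nF] by (auto simp: cuttable_def M d)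
        then have td: "tree_dart x" using x by (simp add: tree_dart_def)
        have "\<not> survives x" using survives_later[OF td _ x(2)] c M by auto
        moreover have "opp (cut_edge M d) (D x) = D x" using d by (auto simp: cut_edge_def)
        ultimately show ?thesis using True c(2) td unfolding I2_def by auto
      next
        case False
        have nc: "D x \<notin> Field Q \<Longrightarrow> \<not> cuttable (fuse T (uncut r x)) (D x)" using False M d by simp
        obtain x' where x': "x < x'" "x' \<le> N" "h x' \<le> r" "\<And>y. x < y \<Longrightarrow> y < x' \<Longrightarrow> r < h y"
          "(if cuttable M d then cut_edge M d else M) = fuse T (uncut r x')" "next_dart M d = D x'"
          using walk_step[OF x nc] M d by metis
        have s': "survives y" if "tree_dart y" "h y < r \<or> h y = r \<and> y < x'" for y
        proof (cases "h y < r \<or> h y = r \<and> y < x")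
          case True
          then show ?thesis using s that by auto
        next
          case False
          \<comment> \<open>The only newly visited position is \<open>x\<close>, since the skipped
            ones are deeper than \<open>r\<close>.\<close>
          then have y: "y = x" "h y = r" using that(2) x'(4)[of y] by (cases y x rule: linorder_cases; auto)+
          then have o: "opp T (D x) \<noteq> D x" using that by (simp add: tree_dart_def)
          then have nQ: "D x \<notin> Field Q" using opp_fuse_Field(5)[of Q] by auto
          then have nF: "D x \<notin> Field (uncut r x)" using uncut_subset[of r x] by (auto simp: Field_def)
          show ?thesis
            using nc[OF nQ] that y o opp_fuse(3)[OF uncut_subset nF]
            by (auto simp: survives_def cuttable_def tree_dart_def)
        qed
        have "I1 (fuse T (uncut r x')) (D x')"
        proof (cases "x' = N")
          case False
          then show ?thesis using x' s' unfolding I1_def by (intro exI[of _ r] exI[of _ x']) auto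
        next
          \<comment> \<open>After a full turn the walk is at the root again, and the state is read
            as the start of round \<open>r + 1\<close>.\<close>
          case True
          have "survives y" if "tree_dart y" "h y < Suc r" for y
            using s'[of y] that True by (auto simp: tree_dart_def less_Suc_eq)
          then show ?thesis unfolding I1_def True uncut_N
            by (intro exI[of _ "Suc r"] exI[of _ 0]) auto
        qed
        then show ?thesis using x'(5,6) by simp
      qed
    qed
  qed
  then have t: "plane_tree (map_opening (tree_closure T))"
    and "(\<exists>d. I1 (map_opening (tree_closure T)) d) \<or> I2 (map_opening (tree_closure T))" by auto
  from this(2) show ?thesis
  proof
    assume "I2 (map_opening (tree_closure T))"
    then show ?thesis unfolding I2_def by metis
  next
    assume "\<exists>d. I1 (map_opening (tree_closure T)) d"
    then obtain r x where M: "map_opening (tree_closure T) = fuse T (uncut r x)"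
      and s: "\<And>y. tree_dart y \<Longrightarrow> h y < r \<or> h y = r \<and> y < x \<Longrightarrow> survives y"
      by (auto simp: I1_def)
    \<comment> \<open>The loop has stopped at a tree, which leaves no fused pair. Darts not visited
      so far then survive, as every edge of a tree separates.\<close>
    have e: "uncut r x = {}" using plane_tree_fuse_iff[OF uncut_subset] t M by metis
    have "survives y" if y: "tree_dart y" for y
    proof (cases "h y < r \<or> h y = r \<and> y < x")
      case False
      then have "r < h y \<or> r = h y \<and> x \<le> y" by auto
      then have "uncut (h y) y = {}" using uncut_antimono[of r "h y" x y] e by simp
      moreover have "opp T (D y) \<in> orbit (next_dart T) (D y)"
        using single_face orbit_next_eq[OF pT, of "D y"] D_in_darts[of y] opp_in_darts[OF pT, of "D y"] by blast
      ultimately show ?thesis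
        using separating_iff_same_face[OF plane, of "D y"] y by (simp add: survives_def tree_dart_def)
    qed (use s y in auto)
    then show ?thesis using M e by simp
  qed
qed

end

section \<open>Charges of subtrees\<close>

lemma cut_edge_opp:
  assumes "premap M" shows "cut_edge M (opp M d) = cut_edge M d"
  using premapD(4)[OF assms, of d] by (cases "opp M d = d") (auto simp: cut_edge_def fun_upd_twist)

text \<open>A set closed under \<open>rot\<close> is a disjoint union of vertices.\<close>

lemma dvd_card_rot_closed:
  assumes M: "premap M" and deg: "degrees_multiple_of m M" and X: "X \<subseteq> darts M"
    and closed: "\<And>d. d \<in> X \<Longrightarrow> rot M d \<in> X"
  shows "m dvd card X"
proof -
  let ?C = "orbit (rot M) ` X"
  note eq = permutation_orbit_eq[OF premapD(6)[OF M]] and self = permutation_self_in_orbit[OF premapD(6)[OF M]]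
  have "orbit (rot M) d \<subseteq> X" if "d \<in> X" for d
    using closed that by (auto elim: orbit_closed)
  then have U: "\<Union>?C = X" using self by auto
  have "m dvd card (\<Union>?C)"
  proof (rule dvd_partition)
    show "finite (\<Union>?C)" using U X premapD(1)[OF M] finite_subset by metis
    show "\<forall>c\<in>?C. m dvd card c" using deg X by (auto simp: degrees_multiple_of_def vertices_def)
    show "\<forall>c1\<in>?C. \<forall>c2\<in>?C. c1 \<noteq> c2 \<longrightarrow> c1 \<inter> c2 = {}" using eq by blast
  qed
  then show ?thesis by (simp only: U)
qed

lemma card_filter_sum: "finite A \<Longrightarrow> card {x \<in> A. P x} = (\<Sum>x\<in>A. if P x then 1 else 0)"
  by (simp add: sum.If_cases Int_def)

text \<open>The contour enters the subtree below the edge after \<open>D u\<close> and leaves it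
  along \<open>D v\<close>. The root has position 0, so this is the lower subtree; its darts include
  \<open>D v\<close> but not \<open>D u\<close>.\<close>

locale tree_edge = balanced_tree +
  fixes u v :: nat
  assumes uv: "u < v" "v < N" and e: "opp T (D u) = D v"
begin

definition lower :: "'a set" where "lower = {d \<in> darts T. u < pos d \<and> pos d \<le> v}"

abbreviation "C \<equiv> cut_edge T (D u)"

lemma ne: "D v \<noteq> D u" using uv D_eq_iff[of v u] by auto

lemma e': "opp T (D v) = D u" using premapD(4)[OF pT, of "D u"] e by simp

lemmas C_simps = cut_edge_simps[OF pT e ne]
lemmas pC = premap_cut_edge[OF pT e ne]

lemma C_eq: "cut_edge T (D v) = C" using cut_edge_opp[OF pT, of "D u"] e by simp

lemma D_lower: "k < N \<Longrightarrow> D k \<in> lower \<longleftrightarrow> u < k \<and> k \<le> v" by (simp add: lower_def)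

lemma next_C:
  "next_dart C (D v) = D (Suc u)" "next_dart C (D u) = D (Suc v)"
  "k < N \<Longrightarrow> k \<noteq> u \<Longrightarrow> k \<noteq> v \<Longrightarrow> next_dart C (D k) = D (Suc k)"
  unfolding next_dart_cut_edge[OF pT e ne] using ne uv D_eq_iff[of k u] D_eq_iff[of k v]
  by (auto simp: next_D)

text \<open>The cut splits the contour into two cycles: the positions from \<open>u + 1\<close> to
  \<open>v\<close>, and the others, which are traversed from \<open>v + 1\<close> over the origin to
  \<open>u\<close>.\<close>

lemma lower_orbit: "u < k \<Longrightarrow> k \<le> v \<Longrightarrow> D k \<in> orbit (next_dart C) (D v)"
proof (induction k)
  case (Suc k)
  show ?case
  proof (cases "k = u")
    case True
    then show ?thesis using orbit.base[of "next_dart C" "D v"] next_C(1) by simp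
  next
    case False
    then have "D k \<in> orbit (next_dart C) (D v)" using Suc by simp
    then have "next_dart C (D k) \<in> orbit (next_dart C) (D v)" by (rule orbit.step)
    then show ?thesis using next_C(3)[of k] False Suc.prems uv by simp
  qed
qed simp

lemma upper_orbit1: "v < k \<Longrightarrow> k \<le> N \<Longrightarrow> D k \<in> orbit (next_dart C) (D u)"
proof (induction k)
  case (Suc k)
  show ?case
  proof (cases "k = v")
    case True
    then show ?thesis using orbit.base[of "next_dart C" "D u"] next_C(2) by simp
  next
    case False
    then have "D k \<in> orbit (next_dart C) (D u)" using Suc by simp
    then have "next_dart C (D k) \<in> orbit (next_dart C) (D u)" by (rule orbit.step)
    then show ?thesis using next_C(3)[of k] False Suc.prems uv by simp
  qed
qed simp

lemma upper_orbit2: "k \<le> u \<Longrightarrow> D k \<in> orbit (next_dart C) (D u)"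
proof (induction k)
  case 0
  then show ?case using upper_orbit1[of N] uv by simp
next
  case (Suc k)
  then have "next_dart C (D k) \<in> orbit (next_dart C) (D u)" by (auto intro: orbit.step)
  then show ?case using next_C(3)[of k] Suc.prems uv by simp
qed

lemma not_conn: "(D u, D v) \<notin> dart_conn C"
proof -
  have "separating T (D u)"
    using separating_iff_same_face[OF plane, of "D u"] e ne
      single_face orbit_next_eq[OF pT, of "D u"] D_in_darts by (metis subsetD)
  then show ?thesis
    using connected_cut_edge_iff[OF pT _ e ne] plane by (simp add: separating_def plane_map_iff)
qed

lemma upper_conn: "d \<in> darts T \<Longrightarrow> d \<notin> lower \<Longrightarrow> (D u, d) \<in> dart_conn C"
proof -
  assume d: "d \<in> darts T" "d \<notin> lower"
  then have "v < pos d \<or> pos d \<le> u" by (auto simp: lower_def)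
  then have "D (pos d) \<in> orbit (next_dart C) (D u)"
    using upper_orbit1[of "pos d"] upper_orbit2 pos_less[OF d(1)] by auto
  then show ?thesis using orbit_next_conn[OF pC, of "D u" d] d by (simp add: C_simps)
qed

lemma lower_conn: "d \<in> lower \<Longrightarrow> (D v, d) \<in> dart_conn C"
  using lower_orbit[of "pos d"] orbit_next_conn[OF pC, of "D v" d] by (simp add: lower_def C_simps)

lemma comp_lower: "dart_comp C (D v) = lower"
proof
  show "lower \<subseteq> dart_comp C (D v)"
    using lower_conn by (auto simp: dart_comp_def C_simps lower_def)
  show "dart_comp C (D v) \<subseteq> lower"
  proof
    fix d assume d: "d \<in> dart_comp C (D v)"
    show "d \<in> lower"
    proof (rule ccontr)
      assume "d \<notin> lower"
      then have "(D u, d) \<in> dart_conn C" using upper_conn d by (auto simp: dart_comp_def C_simps)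
      then show False using d not_conn dart_conn_sym[OF pC] dart_conn_trans
        by (metis (no_types, lifting) dart_comp_def mem_Collect_eq)
    qed
  qed
qed

lemma comp_upper: "dart_comp C (D u) = darts T - lower"
proof
  show "darts T - lower \<subseteq> dart_comp C (D u)"
    using upper_conn by (auto simp: dart_comp_def C_simps)
  show "dart_comp C (D u) \<subseteq> darts T - lower"
  proof
    fix d assume d: "d \<in> dart_comp C (D u)"
    have "d \<notin> lower"
    proof
      assume "d \<in> lower"
      then have "(D v, d) \<in> dart_conn C" by (rule lower_conn)
      then show False using d not_conn dart_conn_sym[OF pC] dart_conn_trans
        by (metis (no_types, lifting) dart_comp_def mem_Collect_eq)
    qed
    then show "d \<in> darts T - lower" using d by (simp add: dart_comp_def C_simps)
  qed
qed

lemma lower_rot: "d \<in> lower \<Longrightarrow> rot T d \<in> lower"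
  unfolding comp_lower[symmetric] dart_comp_def
  using dart_conn_rot[of "D v" d C] rot_in_darts[OF pT] by (auto simp: C_simps)

lemma lower_opp: "d \<in> lower \<Longrightarrow> opp C d \<in> lower"
  unfolding comp_lower[symmetric] dart_comp_def
  using dart_conn_opp[of "D v" d C] opp_in_darts[OF pC] by (auto simp: C_simps(1))

lemma pair_pos_neq:
  assumes "(i, j) \<in> Q" shows "pos i \<noteq> u" "pos i \<noteq> v" "pos j \<noteq> u" "pos j \<noteq> v"
  using Q_pairD(5,6,9,10)[OF assms] e e' ne by (metis D_pos)+

text \<open>Cutting the edge in \<open>T\<close> leaves two components, \<open>lower\<close> and the
  rest; a detour around the edge in the fused tree has to use a pair with one end in each.\<close>

lemma separating_fuse_iff:
  assumes P: "P \<subseteq> Q"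
  shows "separating (fuse T P) (D u) \<longleftrightarrow> (\<forall>(i, j) \<in> P. i \<in> lower \<longleftrightarrow> j \<in> lower)"
proof -
  let ?F = "cut_edge (fuse T P) (D u)"
  note pF = premap_fuse[OF P]
  have nF: "D u \<notin> Field P" using opp_fuse_Field(5)[OF P] e ne by metis
  have o: "opp (fuse T P) (D u) = D v" using opp_fuse(3)[OF P nF] e by simp
  note F = cut_edge_simps[OF pF o ne] and pF' = premap_cut_edge[OF pF o ne]
  have sep: "separating (fuse T P) (D u) \<longleftrightarrow> (D u, D v) \<notin> dart_conn ?F"
    unfolding separating_def using connected_cut_edge_iff[OF pF connected_fuse[OF P] o ne] by simp
  have nuv: "i \<noteq> D u" "i \<noteq> D v" "j \<noteq> D u" "j \<noteq> D v" if "(i, j) \<in> P" for i j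
    using pair_pos_neq[of i j] that P uv by auto
  have mono: "(x, y) \<in> dart_conn ?F" if "(x, y) \<in> dart_conn C" for x y
    using cut_fuse_conn_mono[of "{}" P "D u" x y] P that e ne by simp
  show ?thesis
  proof
    assume s: "separating (fuse T P) (D u)"
    show "\<forall>(i, j) \<in> P. i \<in> lower \<longleftrightarrow> j \<in> lower"
    proof clarify
      fix i j assume ij: "(i, j) \<in> P"
      have d: "i \<in> darts T" "j \<in> darts T" using Q_pairD(5,6)[of i j] ij P by auto
      have "opp ?F i = j" using opp_fuse(1)[OF P ij] nuv[OF ij] F(6) by simp
      then have c: "(i, j) \<in> dart_conn ?F"
        using dart_conn_opp[of i i ?F] d F(1) by simp
      have cases: "(D u, x) \<in> dart_conn ?F \<and> x \<notin> lower \<or> (D v, x) \<in> dart_conn ?F \<and> x \<in> lower" if "x \<in> darts T" for x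
        using mono upper_conn[OF that] lower_conn[of x] by auto
      show "i \<in> lower \<longleftrightarrow> j \<in> lower"
        using cases[OF d(1)] cases[OF d(2)] c s[unfolded sep] dart_conn_trans dart_conn_sym[OF pF'] by metis
    qed
  next
    assume s: "\<forall>(i, j) \<in> P. i \<in> lower \<longleftrightarrow> j \<in> lower"
    have "x \<in> lower" if "(D v, x) \<in> dart_conn ?F" for x
      using that
    proof (rule dart_conn_closed)
      show "D v \<in> lower" using uv by (simp add: D_lower)
      fix z assume z: "z \<in> lower"
      show "rot ?F z \<in> lower" using lower_rot[OF z] F(2) by simp
      show "opp ?F z \<in> lower"
      proof (cases "z \<in> Field P")
        case True
        then show ?thesis
        proof (cases rule: Field_cases)
          case (1 l)
          then have "opp ?F z = l" using opp_fuse(1)[OF P 1] nuv[OF 1] F(6) by simp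
          then show ?thesis using s 1 z by auto
        next
          case (2 b)
          then have "opp ?F z = b" using opp_fuse(2)[OF P 2] nuv[OF 2] F(6) by simp
          then show ?thesis using s 2 z by auto
        qed
      next
        case False
        then have "opp ?F z = opp C z" using opp_fuse(3)[OF P False] F(6) C_simps(6) by simp
        then show ?thesis using lower_opp[OF z] by simp
      qed
    qed
    moreover have "D u \<notin> lower" using uv by (simp add: D_lower)
    ultimately show "separating (fuse T P) (D u)" unfolding sep using dart_conn_sym[OF pF'] by blast
  qed
qed

lemma separating_fuse_iff':
  assumes P: "P \<subseteq> Q"
  shows "separating (fuse T P) (D v) \<longleftrightarrow> (\<forall>(i, j) \<in> P. i \<in> lower \<longleftrightarrow> j \<in> lower)"
proof -
  have nF: "D u \<notin> Field P" using opp_fuse_Field(5)[OF P] e ne by metis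
  have "opp (fuse T P) (D u) = D v" using opp_fuse(3)[OF P nF] e by simp
  then have "separating (fuse T P) (D v) = separating (fuse T P) (D u)"
    using cut_edge_opp[OF premap_fuse[OF P], of "D u"] by (simp add: separating_def)
  then show ?thesis using separating_fuse_iff[OF P] by simp
qed

end

section \<open>Survival in terms of nesting depth\<close>

context balanced_tree
begin

text \<open>Among the pairs around \<open>z\<close>, take the one with the last bud: all the others
  also enclose this bud.\<close>

lemma innermost_enclosing:
  assumes "0 < h z"
  obtains i j where "(i, j) \<in> Q" "pos i < z" "z \<le> pos j" "h z \<le> Suc (h (pos i))"
proof -
  define S where "S = {(i, j) \<in> Q. pos i < z \<and> z \<le> pos j}"
  define K where "K = (\<lambda>p. pos (fst p)) ` S"
  have hz: "h z = card S" and fS: "finite S" using finite_enclosing[of z] by (simp_all add: h_def S_def)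
  then have fin: "finite K" "K \<noteq> {}" using assms by (auto simp: K_def)
  have "Max K \<in> K" using Max_in[OF fin] .
  then obtain i j where p: "(i, j) \<in> S" "Max K = pos i" by (auto simp: K_def)
  have max: "pos i' \<le> pos i" if "(i', j') \<in> S" for i' j'
  proof -
    have "pos i' \<in> K" using that by (force simp: K_def)
    from Max_ge[OF fin(1) this] show ?thesis by (simp only: p(2))
  qed
  have ij: "(i, j) \<in> Q" "pos i < z" "z \<le> pos j" using p(1) by (auto simp: S_def)
  have "S - {(i, j)} \<subseteq> {(i', j') \<in> Q. pos i' < pos i \<and> pos i \<le> pos j'}"
  proof
    fix x assume "x \<in> S - {(i, j)}"
    then obtain i' j' where x: "x = (i', j')" and a: "(i', j') \<in> S" "(i', j') \<noteq> (i, j)"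
      by (cases x) auto
    then have q: "(i', j') \<in> Q" "z \<le> pos j'" by (auto simp: S_def)
    show "x \<in> {(i', j') \<in> Q. pos i' < pos i \<and> pos i \<le> pos j'}"
      unfolding x using max[OF a(1)] Q_pos_neq(2)[OF q(1) ij(1) a(2)] q ij by simp
  qed
  from card_mono[OF finite_enclosing this] have "card (S - {(i, j)}) \<le> h (pos i)" by (simp only: h_def)
  then have "h z \<le> Suc (h (pos i))"
    unfolding hz using fS p(1) by (simp add: card_Diff_singleton)
  then show ?thesis using that ij by blast
qed

end

context tree_edge
begin

text \<open>Pairs still fused at \<open>u\<close> have buds of depth at least \<open>h u\<close>,
  while a pair around \<open>u\<close> or \<open>v\<close> has a bud of smaller depth than that
  position. So if \<open>h v \<le> h u\<close>, no fused pair joins the two sides. Otherwise the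
  innermost pair around \<open>v\<close> has its bud after \<open>u\<close> and is still
  fused.\<close>

lemma survives_u_iff: "survives u \<longleftrightarrow> h v \<le> h u"
proof
  assume le: "h v \<le> h u"
  have "i \<in> lower \<longleftrightarrow> j \<in> lower" if ij: "(i, j) \<in> uncut (h u) u" for i j
  proof -
    have q: "(i, j) \<in> Q" and hi: "h u \<le> h (pos i)" using ij by (auto simp: uncut_def)
    have "\<not> (pos i < u \<and> u \<le> pos j)" "\<not> (pos i < v \<and> v \<le> pos j)"
      using h_enclosed[OF q, of u] h_enclosed[OF q, of v] hi le by auto
    then show ?thesis using Q_pairD(5,6,12)[OF q] pair_pos_neq[OF q] uv by (auto simp: lower_def)
  qed
  then show "survives u" unfolding survives_def separating_fuse_iff[OF uncut_subset] by auto
next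
  assume s: "survives u"
  show "h v \<le> h u"
  proof (rule ccontr)
    assume n: "\<not> h v \<le> h u"
    then obtain i j where ij: "(i, j) \<in> Q" "pos i < v" "v \<le> pos j" "h v \<le> Suc (h (pos i))"
      using innermost_enclosing[of v] by auto
    have "\<not> pos i < u" using h_enclosed[OF ij(1), of u] ij n uv by auto
    then have "u < pos i" "v < pos j" using pair_pos_neq[OF ij(1)] ij by auto
    then have "i \<in> lower" "j \<notin> lower" using Q_pairD(5,6)[OF ij(1)] ij by (auto simp: lower_def)
    moreover have "(i, j) \<in> uncut (h u) u" using ij n \<open>u < pos i\<close> by (auto simp: uncut_def)
    ultimately show False using s unfolding survives_def separating_fuse_iff[OF uncut_subset] by auto
  qed
qed

text \<open>When the walk first stands at \<open>v\<close>, the buds of depth \<open>h v\<close>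
  before \<open>v\<close> have been passed in the same round and their pairs are cut. Only pairs
  around \<open>u\<close> with a bud deeper than \<open>h v\<close> can still join the two sides,
  and they exist iff \<open>h u\<close> exceeds \<open>h v + 1\<close>.\<close>

lemma survives_v_iff: "survives v \<longleftrightarrow> h u \<le> Suc (h v)"
proof
  assume le: "h u \<le> Suc (h v)"
  have "i \<in> lower \<longleftrightarrow> j \<in> lower" if ij: "(i, j) \<in> uncut (h v) v" for i j
  proof -
    have q: "(i, j) \<in> Q" and hi: "h v < h (pos i) \<or> h v = h (pos i) \<and> v \<le> pos i"
      using ij by (auto simp: uncut_def)
    have "\<not> (pos i < u \<and> u \<le> pos j)" "\<not> (pos i < v \<and> v \<le> pos j)"
      using h_enclosed[OF q, of u] h_enclosed[OF q, of v] hi le uv by auto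
    then show ?thesis using Q_pairD(5,6,12)[OF q] pair_pos_neq[OF q] uv by (auto simp: lower_def)
  qed
  then show "survives v" unfolding survives_def separating_fuse_iff'[OF uncut_subset] by auto
next
  assume s: "survives v"
  show "h u \<le> Suc (h v)"
  proof (rule ccontr)
    assume n: "\<not> h u \<le> Suc (h v)"
    then obtain i j where ij: "(i, j) \<in> Q" "pos i < u" "u \<le> pos j" "h u \<le> Suc (h (pos i))"
      using innermost_enclosing[of u] by auto
    have "\<not> v \<le> pos j" using h_enclosed[OF ij(1), of v] ij n uv by auto
    then have "pos j < v" "u < pos j" using pair_pos_neq[OF ij(1)] ij by auto
    then have "i \<notin> lower" "j \<in> lower" using Q_pairD(5,6)[OF ij(1)] ij by (auto simp: lower_def)
    moreover have "(i, j) \<in> uncut (h v) v" using ij n by (auto simp: uncut_def)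
    ultimately show False using s unfolding survives_def separating_fuse_iff'[OF uncut_subset] by auto
  qed
qed

section \<open>Charge of the lower subtree\<close>

definition lower_charge :: int where
  "lower_charge = int (card (leaves T \<inter> lower)) - int (card (buds T \<inter> lower))"

lemma finite_lower: "finite lower"
  using premapD(1)[OF pT] by (simp add: lower_def)

text \<open>The cut turns \<open>D v\<close> into the root half-edge of the subtree, which
  \<open>charge\<close> does not count.\<close>

lemma charge_lower: "charge (component_at C (D v)) = lower_charge"
proof -
  let ?S = "component_at C (D v)"
  have S: "darts ?S = lower" "root_dart ?S = D v" "black ?S = black T \<inter> lower"
    "\<And>x. x \<in> lower \<Longrightarrow> opp ?S x = opp C x"
    using comp_lower by (simp_all add: component_at_def Let_def dart_comp_def C_simps(3))
  have "half_edges ?S = half_edges C \<inter> lower"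
    unfolding half_edges_def S(1) using S(4) by (auto simp: C_simps(1) lower_def)
  then have he: "half_edges ?S - {D v} = half_edges T \<inter> lower"
    using half_edges_cut_edge[OF pT e ne] uv e' ne by (auto simp: D_lower half_edges_def)
  have "leaves ?S - {D v} = leaves T \<inter> lower" "buds ?S - {D v} = buds T \<inter> lower"
    using he S(3) by (auto simp: leaves_def buds_def)
  then show ?thesis by (simp add: charge_def S(2) lower_charge_def)
qed

text \<open>A pair affects the charge only if exactly one of its ends is in \<open>lower\<close>.
  With the leaf there it encloses \<open>u\<close> but not \<open>v\<close>, with the bud there
  \<open>v\<close> but not \<open>u\<close>. This trades counts of ends for depths.\<close>

lemma lower_charge_eq: "lower_charge = int (h u) - int (h v) + int (card (single_leaves T \<inter> lower))"
proof -
  let ?J = "{p \<in> Q. snd p \<in> lower}" and ?I = "{p \<in> Q. fst p \<in> lower}"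
  have LT: "leaves T \<inter> buds T = {}" by (auto simp: leaves_def buds_def)
  have l: "leaves T \<inter> lower = (single_leaves T \<inter> lower) \<union> snd ` ?J"
  proof
    show "(single_leaves T \<inter> lower) \<union> snd ` ?J \<subseteq> leaves T \<inter> lower"
      using Q_pairD(2) by (auto simp: single_leaves_def)
    show "leaves T \<inter> lower \<subseteq> (single_leaves T \<inter> lower) \<union> snd ` ?J"
    proof
      fix x assume x: "x \<in> leaves T \<inter> lower"
      show "x \<in> (single_leaves T \<inter> lower) \<union> snd ` ?J"
      proof (cases "x \<in> Field Q")
        case True
        then obtain b where "(b, x) \<in> Q" using x LT Q_pairD(1) by (cases rule: Field_cases) blast+
        then have "(b, x) \<in> ?J" using x by simp
        then have "x \<in> snd ` ?J" by (rule rev_image_eqI) simp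
        then show ?thesis ..
      qed (use x in \<open>simp add: single_leaves_def\<close>)
    qed
  qed
  have "card (leaves T \<inter> lower) = card (single_leaves T \<inter> lower) + card (snd ` ?J)"
    unfolding l using finite_Q finite_lower
    by (intro card_Un_disjoint) (auto simp: single_leaves_def Field_def)
  also have "card (snd ` ?J) = card ?J"
    by (intro card_image) (auto simp: inj_on_def dest: Q_inj(2))
  finally have 1: "card (leaves T \<inter> lower) = card (single_leaves T \<inter> lower) + card ?J" .
  have "buds T \<inter> lower = fst ` ?I"
  proof
    show "fst ` ?I \<subseteq> buds T \<inter> lower" using Q_pairD(1) by auto
    show "buds T \<inter> lower \<subseteq> fst ` ?I"
    proof
      fix x assume x: "x \<in> buds T \<inter> lower"
      then obtain y where "(x, y) \<in> Q" using Q_dom by blast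
      then have "(x, y) \<in> ?I" using x by simp
      then show "x \<in> fst ` ?I" by (rule rev_image_eqI) simp
    qed
  qed
  moreover have "card (fst ` ?I) = card ?I"
    by (intro card_image) (auto simp: inj_on_def dest: Q_inj(1))
  ultimately have 2: "card (buds T \<inter> lower) = card ?I" by simp
  have hs: "h z = (\<Sum>p\<in>Q. if pos (fst p) < z \<and> z \<le> pos (snd p) then 1 else 0)" for z
    unfolding h_def card_filter_sum[OF finite_Q, symmetric] by (rule arg_cong[where f = card]) auto
  have "card ?J + h v = card ?I + h u"
    unfolding hs card_filter_sum[OF finite_Q] sum.distrib[symmetric]
  proof (rule sum.cong[OF refl])
    fix p assume "p \<in> Q"
    then obtain i j where p: "p = (i, j)" and q: "(i, j) \<in> Q" by (cases p) auto
    show "(if snd p \<in> lower then 1 else 0) + (if pos (fst p) < v \<and> v \<le> pos (snd p) then 1 else 0) =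
      (if fst p \<in> lower then 1 else 0) + (if pos (fst p) < u \<and> u \<le> pos (snd p) then 1 else (0::nat))"
      using Q_pairD(5,6,12)[OF q] pair_pos_neq[OF q] uv by (auto simp: p lower_def)
  qed
  then show ?thesis using 1 2 by (simp add: lower_charge_def)
qed

text \<open>The darts of one colour in \<open>lower\<close> fill whole vertices, so their number is
  a multiple of \<open>m\<close>. Edges inside \<open>lower\<close> contribute one dart to each
  colour. What remains are the leaves among the white darts, the buds among the black ones, and
  \<open>D v\<close> on the side of its own colour.\<close>

lemma lower_charge_mod:
  assumes deg: "degrees_multiple_of m T"
  shows "D v \<notin> black T \<Longrightarrow> int m dvd lower_charge + 1" "D v \<in> black T \<Longrightarrow> int m dvd lower_charge - 1"
proof -
  let ?A = "{x \<in> lower - {D v}. x \<notin> black T \<and> opp T x \<noteq> x}"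
  let ?B = "{x \<in> lower - {D v}. x \<in> black T \<and> opp T x \<noteq> x}"
  have sub: "lower \<subseteq> darts T" by (auto simp: lower_def)
  \<comment> \<open>The cut edge is the only edge leaving \<open>lower\<close>, and
    \<open>D v\<close> is its only dart there.\<close>
  have o: "opp T x \<in> lower - {D v}" if "x \<in> lower - {D v}" for x
  proof -
    have "x \<noteq> D u" using that uv D_lower[of u] by auto
    then have "opp C x = opp T x" using that by (simp add: C_simps(6))
    moreover have "opp T x \<noteq> D v" using \<open>x \<noteq> D u\<close> e' premapD(4)[OF pT, of x] by metis
    ultimately show ?thesis using lower_opp[of x] that by auto
  qed
  have "bij_betw (opp T) ?A ?B"
  proof (rule bij_betw_imageI)
    show "inj_on (opp T) ?A" using permutes_inj[OF premapD(3)[OF pT]] inj_on_subset by blast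
    show "opp T ` ?A = ?B"
    proof
      show "opp T ` ?A \<subseteq> ?B" using o opp_black[OF pT] premapD(4)[OF pT] by auto
      show "?B \<subseteq> opp T ` ?A"
      proof
        fix x assume x: "x \<in> ?B"
        then have "opp T x \<in> ?A" using o opp_black[OF pT] premapD(4)[OF pT] by auto
        then show "x \<in> opp T ` ?A" using premapD(4)[OF pT, of x, symmetric] by (rule rev_image_eqI)
      qed
    qed
  qed
  then have AB: "card ?A = card ?B" by (rule bij_betw_same_card)
  have fin: "finite lower" "finite (leaves T \<inter> lower)" "finite (buds T \<inter> lower)" "finite ?A" "finite ?B"
    using finite_lower by auto
  have vl: "D v \<in> lower" using uv by (simp add: D_lower)
  have nh: "D v \<notin> leaves T" "D v \<notin> buds T" using e' ne by (auto simp: leaves_def buds_def half_edges_def)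
  have b: "m dvd card (lower \<inter> black T)" and w: "m dvd card (lower - black T)"
    using lower_rot rot_black[OF pT] sub by (auto intro!: dvd_card_rot_closed[OF pT deg])
  have le: "leaves T \<inter> lower = {x \<in> lower. x \<notin> black T \<and> opp T x = x}"
    "buds T \<inter> lower = {x \<in> lower. x \<in> black T \<and> opp T x = x}"
    using sub by (auto simp: leaves_def buds_def half_edges_def)
  have dj: "leaves T \<inter> lower \<inter> ?A = {}" and dj': "buds T \<inter> lower \<inter> ?B = {}"
    by (auto simp: leaves_def buds_def half_edges_def)
  have W: "card (lower - black T) = card (leaves T \<inter> lower) + card ?A + (if D v \<in> black T then 0 else 1)"
  proof -
    have eq: "lower - black T = (leaves T \<inter> lower \<union> ?A) \<union> (if D v \<in> black T then {} else {D v})"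
      unfolding le using vl e' ne by auto
    have "card (lower - black T) = card (leaves T \<inter> lower \<union> ?A) + card (if D v \<in> black T then {} else {D v})"
      unfolding eq using fin nh by (intro card_Un_disjoint) auto
    also have "card (leaves T \<inter> lower \<union> ?A) = card (leaves T \<inter> lower) + card ?A"
      by (rule card_Un_disjoint[OF _ _ dj]) (simp_all only: fin)
    finally show ?thesis by simp
  qed
  have B: "card (lower \<inter> black T) = card (buds T \<inter> lower) + card ?B + (if D v \<in> black T then 1 else 0)"
  proof -
    have eq: "lower \<inter> black T = (buds T \<inter> lower \<union> ?B) \<union> (if D v \<in> black T then {D v} else {})"
      unfolding le using vl e' ne by auto
    have "card (lower \<inter> black T) = card (buds T \<inter> lower \<union> ?B) + card (if D v \<in> black T then {D v} else {})"
      unfolding eq using fin nh by (intro card_Un_disjoint) auto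
    also have "card (buds T \<inter> lower \<union> ?B) = card (buds T \<inter> lower) + card ?B"
      by (rule card_Un_disjoint[OF _ _ dj']) (simp_all only: fin)
    finally show ?thesis by simp
  qed
  have d: "int m dvd int (card (lower - black T)) - int (card (lower \<inter> black T))"
    using b w by (intro dvd_diff) auto
  show "int m dvd lower_charge + 1" if "D v \<notin> black T"
    using d W B AB that by (simp add: lower_charge_def algebra_simps)
  show "int m dvd lower_charge - 1" if "D v \<in> black T"
    using d W B AB that by (simp add: lower_charge_def algebra_simps)
qed

text \<open>The root is one of the \<open>m\<close> single leaves and is not below the edge.\<close>

lemma lower_single_leaves:
  assumes "total_charge T = int m"
  shows "card (single_leaves T \<inter> lower) < m"
proof -
  have "root_dart T \<notin> lower" by (simp add: lower_def)
  moreover have "root_dart T \<in> single_leaves T" using root_single by (simp add: single_leaves_def)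
  moreover have "finite (single_leaves T)" using finite_half_edges(2)[OF pT] by (simp add: single_leaves_def)
  ultimately have "card (single_leaves T \<inter> lower) < card (single_leaves T)"
    by (intro psubset_card_mono) auto
  then show ?thesis using single_leaves_card[OF tree tc] assms by simp
qed

text \<open>A nonnegative charge congruent to -1 modulo \<open>m\<close> is at least
  \<open>m - 1\<close>, hence at least the number of single leaves below the edge, and stays
  nonnegative when these are subtracted.\<close>

lemma survives_u_charge:
  assumes "total_charge T = int m" "degrees_multiple_of m T" "D v \<notin> black T"
  shows "survives u \<longleftrightarrow> lower_charge \<ge> 0"
proof -
  obtain k where k: "lower_charge + 1 = int m * k" using lower_charge_mod(1)[OF assms(2,3)] by (elim dvdE)
  have s: "card (single_leaves T \<inter> lower) < m" by (rule lower_single_leaves[OF assms(1)])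
  show ?thesis
  proof
    assume "survives u"
    then show "lower_charge \<ge> 0" unfolding survives_u_iff lower_charge_eq by simp
  next
    assume "lower_charge \<ge> 0"
    then have "0 < int m * k" using k by simp
    then have "0 < k" by (simp add: zero_less_mult_iff)
    then have "int m * 1 \<le> int m * k" by (intro mult_left_mono) auto
    then show "survives u" unfolding survives_u_iff using k s lower_charge_eq by linarith
  qed
qed

text \<open>Survival bounds the charge by 1 plus the number of single leaves below the edge, hence
  strictly by \<open>m + 1\<close>; being congruent to 1 modulo \<open>m\<close>, it is then at most
  1.\<close>

lemma survives_v_charge:
  assumes "total_charge T = int m" "degrees_multiple_of m T" "D v \<in> black T"
  shows "survives v \<longleftrightarrow> lower_charge \<le> 1"
proof -
  obtain k where k: "lower_charge - 1 = int m * k" using lower_charge_mod(2)[OF assms(2,3)] by (elim dvdE)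
  have s: "card (single_leaves T \<inter> lower) < m" by (rule lower_single_leaves[OF assms(1)])
  show ?thesis
  proof
    assume "survives v"
    then have "int m * k < int m * 1" using k s unfolding survives_v_iff lower_charge_eq by linarith
    then have "k < 1" by (rule mult_left_less_imp_less) simp
    then have "int m * k \<le> 0" by (intro mult_nonneg_nonpos) auto
    then show "lower_charge \<le> 1" using k by simp
  next
    assume "lower_charge \<le> 1"
    then show "survives v" unfolding survives_v_iff lower_charge_eq by simp
  qed
qed

end

context balanced_tree
begin

text \<open>Of the two subtrees at an edge only the one without the root is constrained. It is the
  white one if the black end comes first on the contour, and the black one otherwise.\<close>

theorem blossom_tree_iff:
  assumes "total_charge T = int m" "degrees_multiple_of m T"
  shows "blossom_tree T \<longleftrightarrow> (\<forall>y. tree_dart y \<longrightarrow> survives y)"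
proof -
  let ?B = "\<lambda>b. (root_dart T \<notin> darts (white_subtree T b) \<longrightarrow> charge (white_subtree T b) \<ge> 0) \<and>
    (root_dart T \<notin> darts (black_subtree T b) \<longrightarrow> charge (black_subtree T b) \<le> 1)"
  have darts_comp: "darts (component_at M d) = dart_comp M d" for M :: "'a hmap" and d
    by (simp add: component_at_def Let_def dart_comp_def)
  have key: "?B (D y) \<longleftrightarrow> survives y" if y: "tree_dart y" for y
  proof -
    have yN: "y < N" "D y \<in> black T" "opp T (D y) \<noteq> D y" using y by (auto simp: tree_dart_def)
    define z where "z = pos (opp T (D y))"
    have oD: "opp T (D y) \<in> darts T" using opp_in_darts[OF pT] by simp
    have z: "z < N" "D z = opp T (D y)" using oD by (auto simp: z_def)
    have zb: "D z \<notin> black T" using opp_black[OF pT yN(3)] yN z by simp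
    have "y \<noteq> z" using z yN by auto
    then consider "y < z" | "z < y" by linarith
    then show ?thesis
    proof cases
      case 1
      interpret tree_edge T y z by unfold_locales (use 1 z in auto)
      have w: "white_subtree T (D y) = component_at C (D z)" by (simp add: white_subtree_def z)
      have b: "black_subtree T (D y) = component_at C (D y)" by (simp add: black_subtree_def)
      show ?thesis
        using survives_u_charge[OF assms zb] charge_lower
        unfolding w b darts_comp comp_lower comp_upper by (auto simp: lower_def root_half_edge)
    next
      case 2
      have e: "opp T (D z) = D y" using premapD(4)[OF pT, of "D y"] z by simp
      interpret tree_edge T z y by unfold_locales (use 2 yN e in auto)
      have w: "white_subtree T (D y) = component_at C (D z)" by (simp add: white_subtree_def z C_eq)
      have b: "black_subtree T (D y) = component_at C (D y)" by (simp add: black_subtree_def C_eq)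
      show ?thesis
        using survives_v_charge[OF assms yN(2)] charge_lower
        unfolding w b darts_comp comp_lower comp_upper by (auto simp: lower_def root_half_edge)
    qed
  qed
  have "(\<forall>b \<in> black T. opp T b \<noteq> b \<longrightarrow> ?B b) \<longleftrightarrow> (\<forall>y. tree_dart y \<longrightarrow> ?B (D y))"
  proof
    assume a: "\<forall>y. tree_dart y \<longrightarrow> ?B (D y)"
    show "\<forall>b \<in> black T. opp T b \<noteq> b \<longrightarrow> ?B b"
    proof (intro ballI impI)
      fix b assume b: "b \<in> black T" "opp T b \<noteq> b"
      then have "b \<in> darts T" using premapD(5)[OF pT] by auto
      then have "tree_dart (pos b)" "D (pos b) = b" using b by (auto simp: tree_dart_def)
      then show "?B b" using a by metis
    qed
  qed (simp add: tree_dart_def)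
  then show ?thesis using key tree unfolding blossom_tree_def by blast
qed

theorem opening_closure_blossom_iff:
  assumes "total_charge T = int m" "degrees_multiple_of m T"
  shows "map_opening (tree_closure T) = T \<longleftrightarrow> blossom_tree T"
  unfolding opening_closure_iff blossom_tree_iff[OF assms] ..

end

section \<open>Renaming darts\<close>

text \<open>Darts are moved by a bijection of the whole type, so that \<open>rot\<close> and
  \<open>opp\<close> are conjugated as total functions and renaming has an inverse of the same
  kind.\<close>

definition rename :: "('a \<Rightarrow> 'a) \<Rightarrow> 'a hmap \<Rightarrow> 'a hmap" where
  "rename p M = \<lparr>darts = p ` darts M, rot = p \<circ> rot M \<circ> inv p, opp = p \<circ> opp M \<circ> inv p,
    black = p ` black M, root_dart = p (root_dart M)\<rparr>"

lemma rename_simps [simp]: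
  "darts (rename p M) = p ` darts M" "black (rename p M) = p ` black M"
  "root_dart (rename p M) = p (root_dart M)"
  by (simp_all add: rename_def)

lemma orbit_semiconj:
  assumes "\<And>x. g (p x) = p (f x)"
  shows "orbit g (p x) = p ` orbit f x"
proof -
  have "(g ^^ n) (p x) = p ((f ^^ n) x)" for n by (induct n) (auto simp: assms)
  then show ?thesis unfolding orbit_altdef by auto
qed

lemma image_mset_card_image:
  assumes "inj p"
  shows "image_mset card (mset_set ((`) p ` S)) = image_mset card (mset_set S)"
proof -
  have "inj_on ((`) p) S" using assms by (simp add: inj_image_eq_iff inj_on_def)
  then have "mset_set ((`) p ` S) = image_mset ((`) p) (mset_set S)"
    by (rule image_mset_mset_set[symmetric])
  then show ?thesis using assms by (simp add: image_mset.compositionality comp_def card_image inj_on_subset)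
qed

locale renaming =
  fixes p :: "'a \<Rightarrow> 'a"
  assumes p: "bij p"
begin

lemma inj: "inj p" and surj: "surj p" using p by (simp_all add: bij_def)

lemma p_eq [simp]: "p x = p y \<longleftrightarrow> x = y" using inj by (auto dest: injD)

lemma inv_p [simp]: "inv p (p x) = x" using inj by simp

lemma p_inv [simp]: "p (inv p x) = x" using surj by (rule surj_f_inv_f)

lemma mem_image [simp]: "p x \<in> p ` X \<longleftrightarrow> x \<in> X" using inj by (rule inj_image_mem_iff)

lemma rename_app [simp]:
  "rot (rename p M) (p d) = p (rot M d)" "opp (rename p M) (p d) = p (opp M d)"
  "next_dart (rename p M) (p d) = p (next_dart M d)"
  by (simp_all add: rename_def next_dart_def)

lemma all_p: "(\<forall>x. P x) \<longleftrightarrow> (\<forall>x. P (p x))" by (metis p_inv)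

lemma rename_eqI:
  assumes "darts N = p ` darts M" "\<And>d. rot N (p d) = p (rot M d)" "\<And>d. opp N (p d) = p (opp M d)"
    "black N = p ` black M" "root_dart N = p (root_dart M)"
  shows "N = rename p M"
proof (rule hmap.equality)
  show "rot N = rot (rename p M)" "opp N = opp (rename p M)"
    unfolding fun_eq_iff using assms(2,3) by (subst all_p; simp)+
qed (use assms in auto)

lemma funpow_next: "(next_dart (rename p M) ^^ n) (p d) = p ((next_dart M ^^ n) d)"
  by (induct n) auto

lemma half_edges_rename: "half_edges (rename p M) = p ` half_edges M"
  by (auto simp: half_edges_def)

lemma leaves_rename: "leaves (rename p M) = p ` leaves M"
  unfolding leaves_def half_edges_rename by (simp add: image_set_diff inj)

lemma buds_rename: "buds (rename p M) = p ` buds M"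
  unfolding buds_def half_edges_rename by (simp add: image_Int inj)

lemma vertices_rename: "vertices (rename p M) = (`) p ` vertices M"
proof -
  have "orbit (rot (rename p M)) (p d) = p ` orbit (rot M) d" for d
    by (rule orbit_semiconj) simp
  then show ?thesis unfolding vertices_def by (auto simp: image_iff)
qed

lemma orbit_next_rename: "orbit (next_dart (rename p M)) (p d) = p ` orbit (next_dart M) d"
  by (rule orbit_semiconj) simp

lemma faces_rename: "faces (rename p M) = (`) p ` faces M"
  unfolding faces_def using orbit_next_rename[of M] by (auto simp: image_iff)

lemma edges_rename: "edges (rename p M) = (`) p ` edges M"
proof
  show "edges (rename p M) \<subseteq> (`) p ` edges M"
  proof
    fix e assume "e \<in> edges (rename p M)"
    then obtain d where "d \<in> darts M" "opp M d \<noteq> d" "e = p ` {d, opp M d}"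
      by (auto simp: edges_def)
    then show "e \<in> (`) p ` edges M" unfolding edges_def by blast
  qed
  show "(`) p ` edges M \<subseteq> edges (rename p M)"
  proof
    fix e assume "e \<in> (`) p ` edges M"
    then obtain d where d: "d \<in> darts M" "opp M d \<noteq> d" "e = p ` {d, opp M d}"
      by (auto simp: edges_def)
    then have "e = {p d, opp (rename p M) (p d)}" "opp (rename p M) (p d) \<noteq> p d" "p d \<in> darts (rename p M)"
      by auto
    then show "e \<in> edges (rename p M)" unfolding edges_def by blast
  qed
qed

lemma card_rename [simp]:
  "card (vertices (rename p M)) = card (vertices M)" "card (faces (rename p M)) = card (faces M)"
  "card (edges (rename p M)) = card (edges M)"
  unfolding vertices_rename faces_rename edges_rename
  by (intro card_image; simp add: inj_on_def inj_image_eq_iff inj)+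

lemma dart_conn_rename: "(x, y) \<in> dart_conn M \<Longrightarrow> (p x, p y) \<in> dart_conn (rename p M)"
proof -
  assume "(x, y) \<in> dart_conn M"
  then have "y \<in> {y. (p x, p y) \<in> dart_conn (rename p M)}"
  proof (rule dart_conn_closed)
    fix z assume z: "z \<in> {y. (p x, p y) \<in> dart_conn (rename p M)}" "z \<in> darts M"
    then have c: "(p x, p z) \<in> dart_conn (rename p M)" "p z \<in> darts (rename p M)" by auto
    show "rot M z \<in> {y. (p x, p y) \<in> dart_conn (rename p M)}"
      using dart_conn_rot[OF c] by simp
    show "opp M z \<in> {y. (p x, p y) \<in> dart_conn (rename p M)}"
      using dart_conn_opp[OF c] by simp
  qed simp
  then show ?thesis by simp
qed

lemma connected_rename1: "connected_map M \<Longrightarrow> connected_map (rename p M)"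
  by (auto simp: connected_map_def dart_conn_rename)

lemma premap_rename: "premap M \<Longrightarrow> premap (rename p M)"
proof -
  assume M: "premap M"
  have perm: "(p \<circ> f \<circ> inv p) permutes p ` S" if "f permutes S" for f S
  proof (rule bij_imp_permutes)
    show "bij_betw (p \<circ> f \<circ> inv p) (p ` S) (p ` S)"
    proof (rule bij_betw_imageI)
      show "inj_on (p \<circ> f \<circ> inv p) (p ` S)" using permutes_inj[OF that] by (auto simp: inj_on_def dest: injD)
      show "(p \<circ> f \<circ> inv p) ` p ` S = p ` S" unfolding image_image by (simp add: permutes_image[OF that] flip: image_image[of p f])
    qed
    fix x assume x: "x \<notin> p ` S"
    have "inv p x \<notin> S" using x p_inv[of x] by (metis imageI)
    then show "(p \<circ> f \<circ> inv p) x = x" using permutes_not_in[OF that] by simp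
  qed
  have "rot (rename p M) permutes p ` darts M" "opp (rename p M) permutes p ` darts M"
    using perm[OF premapD(2)[OF M]] perm[OF premapD(3)[OF M]] by (simp_all add: rename_def)
  moreover have "\<forall>d. opp (rename p M) (opp (rename p M) d) = d"
    by (subst all_p) (simp add: premapD(4)[OF M])
  ultimately show ?thesis
    using M by (auto simp: premap_def)
qed

lemma plane_map_rename1: "plane_map M \<Longrightarrow> plane_map (rename p M)"
  unfolding plane_map_iff
  by (auto simp: premap_rename connected_rename1 half_edges_rename orbit_next_rename)

text \<open>Reduces the equivalences below to one implication each.\<close>

lemma rename_inv: "rename (inv p) (rename p M) = M"
proof -
  interpret i: renaming "inv p" by standard (rule bij_imp_bij_inv[OF p])
  show ?thesis
    by (rule i.rename_eqI[symmetric]) (auto simp: image_image rename_def)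
qed

lemma renaming_inv: "renaming (inv p)"
  by standard (rule bij_imp_bij_inv[OF p])

lemma connected_rename: "connected_map (rename p M) \<longleftrightarrow> connected_map M"
  using connected_rename1 renaming.connected_rename1[OF renaming_inv] rename_inv by metis

lemma plane_map_rename: "plane_map (rename p M) \<longleftrightarrow> plane_map M"
  using plane_map_rename1 renaming.plane_map_rename1[OF renaming_inv] rename_inv by metis

lemma plane_tree_rename: "plane_tree (rename p M) \<longleftrightarrow> plane_tree M"
  by (simp add: plane_tree_def plane_map_rename)

lemma cut_edge_rename: "cut_edge (rename p M) (p d) = rename p (cut_edge M d)"
  by (rule rename_eqI) (auto simp: cut_edge_def rename_def)

lemma cuttable_rename: "cuttable (rename p M) (p d) \<longleftrightarrow> cuttable M d"
  by (simp add: cuttable_def separating_def cut_edge_rename connected_rename)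

text \<open>The test and the step of the loop commute with renaming, hence so does the loop, which
  terminates.\<close>

lemma map_opening_rename:
  assumes "plane_map M"
  shows "map_opening (rename p M) = rename p (map_opening M)"
proof -
  let ?b = "\<lambda>(N :: 'a hmap, d :: 'a). \<not> plane_tree N"
  let ?f = "map_prod (rename p) p"
  obtain s where s: "while_option ?b opening_step (M, root_dart M) = Some s"
    using opening_terminates[OF assms] by auto
  have "map_option ?f (while_option ?b opening_step (M, root_dart M)) =
      while_option ?b opening_step (?f (M, root_dart M))"
  proof (rule while_option_commute)
    fix s :: "'a hmap \<times> 'a"
    obtain N d where Nd: "s = (N, d)" by force
    show "?b s = ?b (?f s)" by (simp add: Nd plane_tree_rename)
    show "?f (opening_step s) = opening_step (?f s)"
      by (simp add: Nd opening_step_eq cuttable_rename cut_edge_rename)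
  qed
  then have "while_option ?b opening_step (rename p M, p (root_dart M)) = Some (?f s)" using s by simp
  then show ?thesis using s by (simp add: map_opening_def while_def)
qed

lemma between_rename: "between (rename p M) (p x) (p y) = p ` between M x y"
  unfolding between_def funpow_next by auto

lemma Field_rename: "Field (map_prod p p ` P) = p ` Field P"
  unfolding Field_def by force

lemma matchable_rename:
  "matchable (rename p M) (map_prod p p ` P) (p b) (p l) \<longleftrightarrow> matchable M P b l"
proof -
  have "p ` half_edges M \<inter> p ` between M b l \<subseteq> p ` Field P \<longleftrightarrow> half_edges M \<inter> between M b l \<subseteq> Field P"
    by (simp add: image_Int[OF inj, symmetric] inj_image_subset_iff[OF inj])
  then show ?thesis
    unfolding matchable_def Field_rename buds_rename leaves_rename half_edges_rename between_rename by simp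
qed

lemma partial_matching_rename:
  "partial_matching M P \<Longrightarrow> partial_matching (rename p M) (map_prod p p ` P)"
proof (induct rule: partial_matching.induct)
  case (match P b l)
  then have "matchable (rename p M) (map_prod p p ` P) (p b) (p l)" by (simp add: matchable_rename)
  from partial_matching.match[OF match(2) this] show ?case by simp
qed (simp add: partial_matching.empty)

lemma total_charge_rename: "total_charge (rename p M) = total_charge M"
  unfolding total_charge_def leaves_rename buds_rename
  by (simp add: card_image inj_on_subset[OF inj])

text \<open>As \<open>matching\<close> is a definite description, it is transported by uniqueness:
  the renamed pairs form a maximal partial matching of the renamed tree.\<close>

lemma tree_closure_rename:
  assumes "balanced T"
  shows "tree_closure (rename p T) = rename p (tree_closure T)"
proof -
  interpret T: balanced_tree T by standard (rule assms)
  have t': "plane_tree (rename p T)" "total_charge (rename p T) \<ge> 1"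
    using T.tree T.tc by (simp_all add: plane_tree_rename total_charge_rename)
  have "\<not> matchable (rename p T) (map_prod p p ` matching T) b l" for b l
    using matching_maximal(2)[OF T.tree T.tc] matchable_rename[of T "matching T" "inv p b" "inv p l"] by simp
  then have m: "matching (rename p T) = map_prod p p ` matching T"
    using matching_eqI[OF t' partial_matching_rename[OF T.Q]] by blast
  have "balanced (rename p T)"
    using t' T.root_single by (simp add: balanced_def single_leaves_def m Field_rename leaves_rename)
  then interpret T': balanced_tree "rename p T" by (simp add: balanced_tree_def)
  show ?thesis unfolding tree_closure_eq_fuse
  proof (rule rename_eqI)
    show "rot (fuse (rename p T) (matching (rename p T))) (p d) = p (rot (fuse T (matching T)) d)" for d by simp
    show "opp (fuse (rename p T) (matching (rename p T))) (p d) = p (opp (fuse T (matching T)) d)" for d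
    proof (cases "d \<in> Field (matching T)")
      case False
      then show ?thesis
        using T.opp_fuse(3)[OF subset_refl False] T'.opp_fuse(3)[OF subset_refl, of "p d"] by (simp add: m Field_rename)
    next
      case True
      then show ?thesis
      proof (cases rule: T.Field_cases)
        case (1 l)
        then have "(p d, p l) \<in> matching (rename p T)" unfolding m by force
        then show ?thesis using T.opp_fuse(1)[OF subset_refl 1] T'.opp_fuse(1)[OF subset_refl] by simp
      next
        case (2 b)
        then have "(p b, p d) \<in> matching (rename p T)" unfolding m by force
        then show ?thesis using T.opp_fuse(2)[OF subset_refl 2] T'.opp_fuse(2)[OF subset_refl] by simp
      qed
    qed
  qed simp_all
qed

lemma degree_distribution_rename: "degree_distribution (rename p M) = degree_distribution M"
proof -
  have "{v \<in> vertices (rename p M). v \<inter> black (rename p M) = {}} = (`) p ` {v \<in> vertices M. v \<inter> black M = {}}"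
    unfolding vertices_rename by (auto simp: image_Int[OF inj, symmetric] simp del: mem_image)
  moreover have "{v \<in> vertices (rename p M). v \<subseteq> black (rename p M)} = (`) p ` {v \<in> vertices M. v \<subseteq> black M}"
    unfolding vertices_rename by (auto simp: inj_image_subset_iff[OF inj] simp del: mem_image)
  ultimately show ?thesis by (simp add: degree_distribution_def image_mset_card_image[OF inj])
qed

end

section \<open>Isomorphisms as renamings\<close>

lemma extend_bij_betw:
  assumes f: "bij_betw f A B" and fin: "finite A" "finite B"
  obtains p :: "'a \<Rightarrow> 'a" where "bij p" "\<And>x. x \<in> A \<Longrightarrow> p x = f x"
proof -
  have "card A = card B" using f by (rule bij_betw_same_card)
  \<comment> \<open>A bijection from \<open>B - A\<close> to \<open>A - B\<close> completes
    \<open>f\<close> to a permutation of \<open>A \<union> B\<close>.\<close>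
  then have "card (B - A) = card (A - B)"
    using card_Diff_subset_Int[of B A] card_Diff_subset_Int[of A B] fin by (simp add: Int_commute)
  then obtain g where g: "bij_betw g (B - A) (A - B)"
    using finite_same_card_bij[of "B - A" "A - B"] fin by auto
  define q where "q x = (if x \<in> A then f x else g x)" for x
  have "bij_betw q A B" using f by (simp add: q_def cong: bij_betw_cong)
  moreover have "bij_betw q (B - A) (A - B)"
    using g bij_betw_cong[of "B - A" q g] by (simp add: q_def)
  ultimately have "bij_betw q (A \<union> (B - A)) (B \<union> (A - B))"
    by (rule bij_betw_combine) auto
  then have q: "bij_betw q (A \<union> B) (A \<union> B)" by (simp add: Un_commute)
  define p where "p x = (if x \<in> A \<union> B then q x else x)" for x
  have "bij_betw p (A \<union> B) (A \<union> B)"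
    using q bij_betw_cong[of "A \<union> B" p q] by (simp add: p_def)
  then have "p permutes (A \<union> B)" by (rule bij_imp_permutes) (simp add: p_def)
  then have "bij p" by (rule permutes_bij)
  moreover have "p x = f x" if "x \<in> A" for x using that by (simp add: p_def q_def)
  ultimately show ?thesis using that by blast
qed

text \<open>An isomorphism only relates darts. Both maps fix everything outside their dart sets, so
  an extension of it to a bijection of the type conjugates the total functions as well.\<close>

lemma map_iso_iff: "(M, N) \<in> map_iso \<longleftrightarrow> plane_map M \<and> (\<exists>p. bij p \<and> N = rename p M)"
proof
  assume "(M, N) \<in> map_iso"
  then obtain f where M: "plane_map M" and N: "plane_map N" and f: "bij_betw f (darts M) (darts N)"
    and fd: "\<And>d. d \<in> darts M \<Longrightarrow> f (rot M d) = rot N (f d) \<and> f (opp M d) = opp N (f d) \<and> (f d \<in> black N \<longleftrightarrow> d \<in> black M)"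
    and r: "f (root_dart M) = root_dart N"
    by (auto simp: map_iso_def)
  note pM = plane_map_premap[OF M] and pN = plane_map_premap[OF N]
  obtain p where p: "bij p" and pf: "\<And>x. x \<in> darts M \<Longrightarrow> p x = f x"
    using extend_bij_betw[OF f premapD(1)[OF pM] premapD(1)[OF pN]] by blast
  interpret renaming p by standard (rule p)
  have D: "darts N = p ` darts M" using f pf by (auto simp: bij_betw_def)
  have "N = rename p M"
  proof (rule rename_eqI[OF D])
    show "rot N (p d) = p (rot M d)" for d
    proof (cases "d \<in> darts M")
      case True
      then show ?thesis using fd pf rot_in_darts[OF pM] by simp
    next
      case False
      then show ?thesis using permutes_not_in[OF premapD(2)[OF pM]] permutes_not_in[OF premapD(2)[OF pN]] D by simp
    qed
    show "opp N (p d) = p (opp M d)" for d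
    proof (cases "d \<in> darts M")
      case True
      then show ?thesis using fd pf opp_in_darts[OF pM] by simp
    next
      case False
      then show ?thesis using permutes_not_in[OF premapD(3)[OF pM]] permutes_not_in[OF premapD(3)[OF pN]] D by simp
    qed
    have b: "p d \<in> black N \<longleftrightarrow> d \<in> black M" if "d \<in> darts M" for d using fd pf that by simp
    show "black N = p ` black M"
    proof
      show "black N \<subseteq> p ` black M" using premapD(5)[OF pN] D b by fastforce
      show "p ` black M \<subseteq> black N" using premapD(5)[OF pM] b by auto
    qed
    have "root_dart M \<in> darts M" using M by (auto simp: plane_map_iff half_edges_def)
    then show "root_dart N = p (root_dart M)" using r pf by simp
  qed
  then show "plane_map M \<and> (\<exists>p. bij p \<and> N = rename p M)" using M p by blast
next
  assume "plane_map M \<and> (\<exists>p. bij p \<and> N = rename p M)"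
  then obtain p where M: "plane_map M" and p: "bij p" and N: "N = rename p M" by blast
  interpret renaming p by standard (rule p)
  have "bij_betw p (darts M) (darts N)" using inj by (auto simp: N bij_betw_def intro: inj_on_subset)
  then show "(M, N) \<in> map_iso"
    using M plane_map_rename[of M] by (auto simp: map_iso_def N intro!: exI[of _ p])
qed

lemma map_iso_refl: "plane_map M \<Longrightarrow> (M, M) \<in> map_iso"
  unfolding map_iso_iff by (intro conjI exI[of _ id]) (auto simp: rename_def)

lemma map_iso_trans: "(L, M) \<in> map_iso \<Longrightarrow> (M, N) \<in> map_iso \<Longrightarrow> (L, N) \<in> map_iso"
proof -
  assume "(L, M) \<in> map_iso" "(M, N) \<in> map_iso"
  then obtain p q where L: "plane_map L" and p: "bij p" "M = rename p L" and q: "bij q" "N = rename q M"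
    by (auto simp: map_iso_iff)
  have "N = rename (q \<circ> p) L"
    unfolding p(2) q(2) by (simp add: rename_def o_inv_distrib[OF q(1) p(1)] image_comp comp_assoc)
  then show ?thesis using L bij_comp[OF p(1) q(1)] by (auto simp: map_iso_iff)
qed

lemma tree_closure_iso:
  assumes "balanced T" "(T, T') \<in> map_iso"
  shows "(tree_closure T, tree_closure T') \<in> map_iso"
proof -
  interpret balanced_tree T by standard (rule assms(1))
  obtain p where p: "bij p" "T' = rename p T" using assms(2) by (auto simp: map_iso_iff)
  interpret r: renaming p by standard (rule p(1))
  show ?thesis using r.tree_closure_rename[OF assms(1)] p closure_leg_map by (auto simp: map_iso_iff leg_map_def)
qed

lemma map_opening_iso:
  assumes "plane_map (map_opening M)" "(M, M') \<in> map_iso"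
  shows "(map_opening M, map_opening M') \<in> map_iso"
proof -
  obtain p where M: "plane_map M" and p: "bij p" "M' = rename p M" using assms(2) by (auto simp: map_iso_iff)
  interpret r: renaming p by standard (rule p(1))
  show ?thesis using r.map_opening_rename[OF M] p assms(1) by (auto simp: map_iso_iff)
qed

lemma degree_distribution_iso: "(M, N) \<in> map_iso \<Longrightarrow> degree_distribution N = degree_distribution M"
  by (auto simp: map_iso_iff renaming.degree_distribution_rename renaming_def)

section \<open>The two families\<close>

text \<open>All buds of the opened tree stem from cut edges, so the pairs cut by the opening form a
  maximal matching, and closing restores \<open>M\<close>. Opening this closure then returns the
  tree, and \<open>opening_closure_blossom_iff\<close> turns this into the blossom property.\<close>

lemma opening_leg_map:
  assumes M: "leg_map m M" and m: "0 < m" and deg: "degrees_multiple_of m M"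
  shows "tree_closure (map_opening M) = M" "blossom_tree (map_opening M)" "balanced (map_opening M)"
    "total_charge (map_opening M) = int m" "degrees_multiple_of m (map_opening M)"
    "degree_distribution (map_opening M) = degree_distribution M"
proof -
  let ?T = "map_opening M"
  obtain Q where t: "plane_tree ?T" and Q: "partial_matching ?T Q"
    and QM: "Q \<subseteq> {(b, w). b \<in> black M \<and> opp M b = w \<and> w \<noteq> b}"
    and T: "?T = M\<lparr>opp := \<lambda>d. if d \<in> Field Q then d else opp M d\<rparr>"
    using map_opening_partial_matching[OF M] by blast
  have pM: "premap M" and lM: "card (leaves M) = m" "buds M = {}" "root_dart M \<in> leaves M"
    using M by (auto simp: leg_map_def plane_map_premap)
  have simps: "darts ?T = darts M" "rot ?T = rot M" "black ?T = black M" "root_dart ?T = root_dart M"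
    "vertices ?T = vertices M"
    by (subst T; simp add: vertices_def)+
  have oT: "opp ?T d = (if d \<in> Field Q then d else opp M d)" for d by (subst T) simp
  have FQ: "opp M d \<noteq> d" if d: "d \<in> Field Q" for d
  proof -
    obtain b w where "b \<in> black M" "opp M b = w" "w \<noteq> b" "d = b \<or> d = w"
      using d QM unfolding Field_def by blast
    then show ?thesis using premapD(4)[OF pM] by metis
  qed
  have he: "half_edges ?T = half_edges M \<union> Field Q"
    using opp_outside[OF pM] FQ by (auto simp: half_edges_def oT simps)
  have dis: "half_edges M \<inter> Field Q = {}" using FQ by (auto simp: half_edges_def)
  have bT: "buds ?T \<subseteq> Field Q" using he lM(2) by (auto simp: buds_def simps)
  have lT: "leaves ?T - Field Q = leaves M" using he dis by (auto simp: leaves_def simps)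
  have pT: "premap ?T" using t by (simp add: plane_tree_def plane_map_premap)
  have "card (leaves ?T) = card (leaves ?T \<inter> Field Q) + card (leaves ?T - Field Q)"
    using finite_half_edges(2)[OF pT] by (rule card_Int_Diff)
  moreover have "card (buds ?T) = card Q"
    using partial_matching_card(2)[OF pT Q] bT by (simp add: Int_absorb2)
  ultimately show ch: "total_charge ?T = int m"
    using partial_matching_card(1)[OF pT Q] lT lM(1) by (simp add: total_charge_def)
  then have tc1: "total_charge ?T \<ge> 1" using m by simp
  have mt: "matching ?T = Q"
    using matching_eqI[OF t tc1 Q] bT by (auto simp: matchable_def)
  show bal: "balanced ?T"
    using t tc1 lM(3) lT by (auto simp: balanced_def single_leaves_def mt simps)
  show deg': "degrees_multiple_of m ?T"
    using deg by (simp add: degrees_multiple_of_def simps)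
  show "degree_distribution ?T = degree_distribution M"
    by (simp add: degree_distribution_def simps)
  interpret balanced_tree ?T by standard (rule bal)
  show c: "tree_closure ?T = M"
    unfolding tree_closure_eq_fuse mt
  proof (rule hmap.equality)
    have QQ: "Q \<subseteq> matching ?T" by (simp add: mt)
    show "opp (fuse ?T Q) = opp M"
    proof
      fix d
      show "opp (fuse ?T Q) d = opp M d"
      proof (cases "d \<in> Field Q")
        case False
        then show ?thesis using opp_fuse(3)[OF QQ False] by (simp add: oT)
      next
        case True
        then show ?thesis
        proof (cases rule: Field_cases)
          case (1 l)
          then show ?thesis using opp_fuse(1)[OF QQ 1] QM by auto
        next
          case (2 b)
          then have "opp M b = d" using QM by auto
          then have "opp M d = b" using premapD(4)[OF pM, of b] by simp
          then show ?thesis using opp_fuse(2)[OF QQ 2] by simp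
        qed
      qed
    qed
  qed (simp_all add: simps)
  show "blossom_tree ?T"
    using opening_closure_blossom_iff[OF ch deg'] c by simp
qed

lemma closure_blossom_tree:
  assumes T: "blossom_tree T" "balanced T" and ch: "total_charge T = int m" and deg: "degrees_multiple_of m T"
  shows "map_opening (tree_closure T) = T" "leg_map m (tree_closure T)" "degrees_multiple_of m (tree_closure T)"
    "degree_distribution (tree_closure T) = degree_distribution T"
proof -
  interpret balanced_tree T by standard (rule T)
  show "map_opening (tree_closure T) = T" using opening_closure_blossom_iff[OF ch deg] T by simp
  show "leg_map m (tree_closure T)" using closure_leg_map ch by simp
  show "degrees_multiple_of m (tree_closure T)" "degree_distribution (tree_closure T) = degree_distribution T"
    using deg by (simp_all add: tree_closure_eq_fuse degrees_multiple_of_def degree_distribution_def)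
qed

text \<open>An operation that respects isomorphism sends a class into a single class; the image
  under \<open>map_iso\<close> fills it up.\<close>

lemma lift_iso_class:
  assumes "\<And>T'. (T, T') \<in> map_iso \<Longrightarrow> (F T, F T') \<in> map_iso" "plane_map T"
  shows "lift_iso F (map_iso `` {T}) = map_iso `` {F T}"
  unfolding lift_iso_def using assms map_iso_refl[OF assms(2)] by (blast intro: map_iso_trans)

theorem theorem9:
  fixes m :: nat
  assumes "m \<ge> 3"
  shows
    "(\<forall>T \<in> blossom_family m. tree_closure T \<in> leg_family m \<and>
        (\<forall>T'. (T, T') \<in> map_iso \<longrightarrow> (tree_closure T, tree_closure T') \<in> map_iso)) \<and>
     (\<forall>M \<in> leg_family m. map_opening M \<in> blossom_family m \<and>
        (\<forall>M'. (M, M') \<in> map_iso \<longrightarrow> (map_opening M, map_opening M') \<in> map_iso)) \<and>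
     bij_betw (lift_iso tree_closure) (blossom_family m // map_iso) (leg_family m // map_iso) \<and>
     bij_betw (lift_iso map_opening) (leg_family m // map_iso) (blossom_family m // map_iso) \<and>
     (\<forall>X \<in> blossom_family m // map_iso. lift_iso map_opening (lift_iso tree_closure X) = X) \<and>
     (\<forall>Y \<in> leg_family m // map_iso. lift_iso tree_closure (lift_iso map_opening Y) = Y) \<and>
     (\<forall>X \<in> blossom_family m // map_iso. \<forall>T \<in> X. \<forall>M \<in> lift_iso tree_closure X.
        degree_distribution M = degree_distribution T) \<and>
     (\<forall>Y \<in> leg_family m // map_iso. \<forall>M \<in> Y. \<forall>T \<in> lift_iso map_opening Y.
        degree_distribution T = degree_distribution M)"
proof -
  let ?B = "blossom_family m" and ?L = "leg_family m"
  have F: "tree_closure T \<in> ?L" "plane_map T" "map_opening (tree_closure T) = T"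
    "(T, T') \<in> map_iso \<Longrightarrow> (tree_closure T, tree_closure T') \<in> map_iso"
    "degree_distribution (tree_closure T) = degree_distribution T"
    if "T \<in> ?B" for T T'
    using that closure_blossom_tree[of T m] tree_closure_iso[of T T']
    by (auto simp: blossom_family_def leg_family_def balanced_def plane_tree_def)
  have G: "map_opening M \<in> ?B" "plane_map M" "tree_closure (map_opening M) = M"
    "degree_distribution (map_opening M) = degree_distribution M"
    if "M \<in> ?L" for M
    using that opening_leg_map[of m M] assms
    by (auto simp: blossom_family_def leg_family_def leg_map_def)
  have G': "(map_opening M, map_opening M') \<in> map_iso" if "M \<in> ?L" "(M, M') \<in> map_iso" for M M'
    using map_opening_iso[OF F(2)[OF G(1)[OF that(1)]] that(2)] .
  have lF: "lift_iso tree_closure (map_iso `` {T}) = map_iso `` {tree_closure T}" if "T \<in> ?B" for T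
    using F that by (intro lift_iso_class) auto
  have lG: "lift_iso map_opening (map_iso `` {M}) = map_iso `` {map_opening M}" if "M \<in> ?L" for M
    using G G' that by (intro lift_iso_class) auto
  have FQ: "lift_iso tree_closure X \<in> ?L // map_iso" "lift_iso map_opening (lift_iso tree_closure X) = X"
    if X: "X \<in> ?B // map_iso" for X
  proof -
    obtain T where T: "T \<in> ?B" "X = map_iso `` {T}" using X by (auto elim: quotientE)
    show "lift_iso tree_closure X \<in> ?L // map_iso" using lF T F(1) by (auto intro: quotientI)
    show "lift_iso map_opening (lift_iso tree_closure X) = X"
      using lF[OF T(1)] lG[OF F(1)[OF T(1)]] F(3)[OF T(1)] T by simp
  qed
  have GQ: "lift_iso map_opening Y \<in> ?B // map_iso" "lift_iso tree_closure (lift_iso map_opening Y) = Y"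
    if Y: "Y \<in> ?L // map_iso" for Y
  proof -
    obtain M where M: "M \<in> ?L" "Y = map_iso `` {M}" using Y by (auto elim: quotientE)
    show "lift_iso map_opening Y \<in> ?B // map_iso" using lG M G(1) by (auto intro: quotientI)
    show "lift_iso tree_closure (lift_iso map_opening Y) = Y"
      using lG[OF M(1)] lF[OF G(1)[OF M(1)]] G(3)[OF M(1)] M by simp
  qed
  have "bij_betw (lift_iso tree_closure) (?B // map_iso) (?L // map_iso)"
    by (rule bij_betw_byWitness[where f' = "lift_iso map_opening"]) (use FQ GQ in auto)
  moreover have "bij_betw (lift_iso map_opening) (?L // map_iso) (?B // map_iso)"
    by (rule bij_betw_byWitness[where f' = "lift_iso tree_closure"]) (use FQ GQ in auto)
  moreover have "degree_distribution M = degree_distribution T"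
    if X: "X \<in> ?B // map_iso" "T \<in> X" "M \<in> lift_iso tree_closure X" for X T M
  proof -
    obtain S where S: "S \<in> ?B" "X = map_iso `` {S}" using X(1) by (auto elim: quotientE)
    then have "(S, T) \<in> map_iso" "(tree_closure S, M) \<in> map_iso" using X lF by auto
    then show ?thesis using degree_distribution_iso F(5)[OF S(1)] by metis
  qed
  moreover have "degree_distribution T = degree_distribution M"
    if Y: "Y \<in> ?L // map_iso" "M \<in> Y" "T \<in> lift_iso map_opening Y" for Y T M
  proof -
    obtain N where N: "N \<in> ?L" "Y = map_iso `` {N}" using Y(1) by (auto elim: quotientE)
    then have "(N, M) \<in> map_iso" "(map_opening N, T) \<in> map_iso" using Y lG by auto
    then show ?thesis using degree_distribution_iso G(4)[OF N(1)] by metis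
  qed
  ultimately show ?thesis using F(1,4) G(1) G' FQ(2) GQ(2) by blast
qed

end
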